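(* Let $N\ge2$, $s>0$ and set $2_s^*:=\frac{4N+2s}{2N-4+s}$. Then $$\mathcal S_s(\mathbb R^N_+):=\inf_{u\in C_c^1(\mathbb R^N_+)\setminus\{0\}}\frac{\displaystyle\int_{\mathbb R^N_+}\Bigl(\sum_{i=1}^{N-1}|\partial_iu|^2+x_1^s|\partial_Nu|^2\Bigr)dx}{\Bigl(\displaystyle\int_{\mathbb R^N_+}|u|^{2_s^*}\,dx\Bigr)^{2/2_s^*}}>0.$$ Moreover, the value $\mathcal S_s(\mathbb R^N_+)$ is attained in $H_s\setminus\{0\}$, i.e. there is $u\in H_s\setminus\{0\}$ for which the quotient $$\frac{\displaystyle\int_{\mathbb R^N_+}\Bigl(\sum_{i=1}^{N-1}|\partial_iu|^2+x_1^s|\partial_Nu|^2\Bigr)dx}{\Bigl(\displaystyle\int_{\mathbb R^N_+}|u|^{2_s^*}\,dx\Bigr)^{2/2_s^*}}$$ equals $\mathcal S_s(\mathbb R^N_+)$.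
   Context: $\mathbb R^N_+=\{x\in\mathbb R^N:x_1>0\}$. $H_s$ denotes the closure of $C_c^1(\mathbb R^N_+)$ in the space $$\Bigl\{u\in L^{2_s^*}(\mathbb R^N_+):\|u\|_{H_s}^2:=\int_{\mathbb R^N_+}\Bigl(\sum_{i=1}^{N-1}|\partial_iu|^2+x_1^s|\partial_Nu|^2\Bigr)dx<\infty\Bigr\}$$ with respect to the norm $\|\cdot\|_{H_s}$, where derivatives are distributional. Functions are real-valued. *)

theory Defs
  imports "HOL-Analysis.Analysis"
begin

definition partial_deriv :: "'n::finite \<Rightarrow> (real^'n \<Rightarrow> real) \<Rightarrow> real^'n \<Rightarrow> real" where
  "partial_deriv i f x = frechet_derivative f (at x) (axis i 1)"

primrec Ck :: "nat \<Rightarrow> (real^'n \<Rightarrow> real) \<Rightarrow> bool" where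
  "Ck 0 f \<longleftrightarrow> continuous_on UNIV f"
| "Ck (Suc k) f \<longleftrightarrow> f differentiable_on UNIV \<and> (\<forall>i. Ck k (partial_deriv i f))"

(* An element of C_c^k(W), for W open, is represented by its extension by zero to the whole space. *)
definition Cck :: "nat \<Rightarrow> (real^'n) set \<Rightarrow> (real^'n \<Rightarrow> real) set" where
  "Cck k W = {f. Ck k f \<and> compact (closure {x. f x \<noteq> 0}) \<and> closure {x. f x \<noteq> 0} \<subseteq> W}"

definition test_functions :: "(real^'n) set \<Rightarrow> (real^'n \<Rightarrow> real) set" where
  "test_functions W = (\<Inter>k. Cck k W)"

definition locally_integrable_on :: "(real^'n) set \<Rightarrow> (real^'n \<Rightarrow> real) \<Rightarrow> bool" where
  "locally_integrable_on W f \<longleftrightarrow> (\<forall>K. compact K \<longrightarrow> K \<subseteq> W \<longrightarrow> integrable (lebesgue_on K) f)"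

(* The distributional derivative of u in direction i is (represented by) the function g. *)
definition has_weak_partial ::
    "(real^'n) set \<Rightarrow> 'n \<Rightarrow> (real^'n \<Rightarrow> real) \<Rightarrow> (real^'n \<Rightarrow> real) \<Rightarrow> bool" where
  "has_weak_partial W i u g \<longleftrightarrow>
     locally_integrable_on W u \<and> locally_integrable_on W g \<and>
     (\<forall>\<phi>\<in>test_functions W.
        (\<integral>x. u x * partial_deriv i \<phi> x \<partial>lebesgue_on W) = - (\<integral>x. g x * \<phi> x \<partial>lebesgue_on W))"

(* Determined up to null sets when a weak derivative exists, arbitrary otherwise. *)
definition weak_partial ::
    "(real^'n) set \<Rightarrow> 'n \<Rightarrow> (real^'n \<Rightarrow> real) \<Rightarrow> real^'n \<Rightarrow> real" where
  "weak_partial W i u = (SOME g. has_weak_partial W i u g)"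

(* The coordinates x_1 and x_N enter as two distinct indices a and b of the index type 'n
   (so N = CARD('n) >= 2); the names of the coordinates play no other role. *)

definition half_space :: "'n::finite \<Rightarrow> (real^'n) set" where
  "half_space a = {x. 0 < x $ a}"

definition crit_exponent :: "nat \<Rightarrow> real \<Rightarrow> real" where
  "crit_exponent N s = (4 * real N + 2 * s) / (2 * real N - 4 + s)"

(* D i stands for the i-th partial derivative: classical for C_c^1 functions, weak on H_s. *)
definition energy_density ::
    "'n::finite \<Rightarrow> 'n \<Rightarrow> real \<Rightarrow> ('n \<Rightarrow> real^'n \<Rightarrow> real) \<Rightarrow> real^'n \<Rightarrow> real" where
  "energy_density a b s D x = (\<Sum>i\<in>UNIV - {b}. \<bar>D i x\<bar>\<^sup>2) + (x $ a) powr s * \<bar>D b x\<bar>\<^sup>2"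

definition energy :: "'n::finite \<Rightarrow> 'n \<Rightarrow> real \<Rightarrow> ('n \<Rightarrow> real^'n \<Rightarrow> real) \<Rightarrow> real" where
  "energy a b s D = (\<integral>x. energy_density a b s D x \<partial>lebesgue_on (half_space a))"

definition sobolev_quotient ::
    "'n::finite \<Rightarrow> 'n \<Rightarrow> real \<Rightarrow> ('n \<Rightarrow> real^'n \<Rightarrow> real) \<Rightarrow> (real^'n \<Rightarrow> real) \<Rightarrow> real" where
  "sobolev_quotient a b s D u =
     (let p = crit_exponent CARD('n::finite) s
      in energy a b s D / (\<integral>x. \<bar>u x\<bar> powr p \<partial>lebesgue_on (half_space a)) powr (2 / p))"

definition Hs_norm :: "'n::finite \<Rightarrow> 'n \<Rightarrow> real \<Rightarrow> (real^'n \<Rightarrow> real) \<Rightarrow> real" where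
  "Hs_norm a b s u = sqrt (energy a b s (\<lambda>i. weak_partial (half_space a) i u))"

(* The space of L^p functions (p the critical exponent) of finite norm, before taking the closure.
   Its elements, like those of Hs below, are representatives of classes modulo equality almost
   everywhere in the half space; their values outside the half space are irrelevant. *)
definition Hs_ambient :: "'n::finite \<Rightarrow> 'n \<Rightarrow> real \<Rightarrow> (real^'n \<Rightarrow> real) set" where
  "Hs_ambient a b s = {u.
     u \<in> borel_measurable (lebesgue_on (half_space a)) \<and>
     integrable (lebesgue_on (half_space a)) (\<lambda>x. \<bar>u x\<bar> powr crit_exponent CARD('n::finite) s) \<and>
     (\<forall>i. \<exists>g. has_weak_partial (half_space a) i u g) \<and>
     integrable (lebesgue_on (half_space a))
       (energy_density a b s (\<lambda>i. weak_partial (half_space a) i u))}"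

definition Hs :: "'n::finite \<Rightarrow> 'n \<Rightarrow> real \<Rightarrow> (real^'n \<Rightarrow> real) set" where
  "Hs a b s = {u \<in> Hs_ambient a b s.
     \<forall>\<epsilon>>0. \<exists>\<phi>\<in>Cck 1 (half_space a). Hs_norm a b s (\<lambda>x. u x - \<phi> x) < \<epsilon>}"

(* The infimum is taken over a nonempty set of nonnegative reals, so Inf on the reals is genuine. *)
definition sobolev_const :: "'n::finite \<Rightarrow> 'n \<Rightarrow> real \<Rightarrow> real" where
  "sobolev_const a b s =
     (INF u\<in>Cck 1 (half_space a) - {\<lambda>_. 0}. sobolev_quotient a b s (\<lambda>i. partial_deriv i u) u)"

end

theory Submission
  imports Defs "HOL-Complex_Analysis.Great_Picard"
begin

text \<open>
Write \<open>N = CARD('n)\<close>, let \<open>x$a\<close> be the coordinate vanishing on the boundary of the half space and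
\<open>b\<close> the direction whose derivative carries the weight \<open>(x$a) powr s\<close>. The dilations multiplying
\<open>x$i\<close> by \<open>r\<close> for \<open>i \<noteq> b\<close> and \<open>x$b\<close> by \<open>r powr (1 + s/2)\<close>, together with the translations in all
directions but \<open>a\<close>, preserve the half space and, after multiplying functions by a power of \<open>r\<close>, both
the energy \<open>E\<close> and the integral of \<open>\<bar>u\<bar> powr p\<close>. They make \<open>Q = N + s/2\<close> the effective dimension
and \<open>p = 2Q/(Q-2)\<close> the critical exponent. Since \<open>Q > N\<close>, this \<open>p\<close> is subcritical for the ordinary
Sobolev embedding in dimension \<open>N\<close>, and everything rests on this gap.

The half space is tiled by the images of one box under a discrete set of these symmetries (Whitney
boxes). On each box the weight is comparable to a constant, so the subcritical Poincare-Sobolev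
inequality \<open>poincare_sobolev_box\<close> controls the deviation of \<open>u\<close> from its mean, with a constant that
is the same for all boxes by scaling; Hardy's inequality \<open>hardy\<close> controls the means. If \<open>e\<close> denotes
the sum of the energy density and of \<open>(u/x$a)^2\<close>, this gives
\<open>\<integral>\<^sub>B \<bar>u\<bar> powr p \<le> C (\<integral>\<^sub>B e) powr (p/2)\<close> on every box \<open>B\<close>. Because \<open>p > 2\<close>, summation over the boxes
yields \<open>\<integral> \<bar>u\<bar> powr p \<le> C (sup\<^sub>B \<integral>\<^sub>B \<bar>u\<bar> powr p) powr (1 - 2/p) E(u)\<close>
(\<open>mass_concentration\<close>). One consequence is the Sobolev inequality, so that the infimum \<open>S\<close> is
positive. The other is that a minimising sequence \<open>u\<^sub>m\<close> with \<open>\<integral> \<bar>u\<^sub>m\<bar> powr p = 1\<close> has a fixed amount of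
mass on one box, which a symmetry moves to a fixed box \<open>w0\<close> (\<open>near_minimiser\<close>).

The Poincare-Sobolev inequality on small boxes has a small constant. Hence a function of bounded
energy is determined up to a small error by finitely many averages on each Whitney box, and a
subsequence of \<open>u\<^sub>m\<close> is Cauchy in \<open>L\<^sup>p\<close> of every box (\<open>local_cauchy_subsequence\<close>). To obtain a limit
of finite energy, the energy is minimised approximately over the convex hulls of the tails of the
sequence. By the parallelogram identity these near minimisers \<open>v\<^sub>k\<close> converge in energy to some \<open>u\<close>,
which is therefore in the closure of the test functions, and minimality gives
\<open>(1 - 2^-k) E(v\<^sub>k - u\<^sub>m) \<le> E(u\<^sub>m) - E(v\<^sub>k) + 2^-k\<close> for large \<open>m\<close> (\<open>tail_minimization\<close>).

Let \<open>A = \<integral> \<bar>u\<bar> powr p\<close> and \<open>d = lim E(v\<^sub>k) = E(u)\<close>. On the support of \<open>v\<^sub>k\<close> the \<open>u\<^sub>m\<close> converge to \<open>u\<close>, so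
off this support they keep at least the mass \<open>1 - A\<close>, and there \<open>v\<^sub>k - u\<^sub>m = - u\<^sub>m\<close>. The Sobolev
inequality for \<open>v\<^sub>k - u\<^sub>m\<close> now turns the last estimate into \<open>S (1 - A) powr (2/p) \<le> S - d\<close>, while the
Sobolev inequality for \<open>v\<^sub>k\<close> gives \<open>S A powr (2/p) \<le> d\<close>. Since \<open>2/p < 1\<close> and \<open>A > 0\<close>, these two
force \<open>A = 1\<close> and \<open>d = S\<close>: the limit \<open>u\<close> attains the infimum. It remains to identify the limits of the
derivatives of \<open>v\<^sub>k\<close> with the weak derivatives of \<open>u\<close>, which uses the fundamental lemma of the calculus
of variations and hence an explicit supply of smooth functions of compact support.
\<close>

section \<open>Functions of class C1\<close>

lemma partial_deriv_eq:
  assumes "(f has_derivative D) (at x)"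
  shows "partial_deriv i f x = D (axis i 1)"
  using frechet_derivative_at[OF assms] by (simp add: partial_deriv_def)

lemma Ck1_has_derivative:
  fixes f :: "real^'n \<Rightarrow> real"
  assumes "Ck (Suc 0) f"
  shows "(f has_derivative (\<lambda>h. \<Sum>i\<in>UNIV. h$i * partial_deriv i f x)) (at x)"
proof -
  have "f differentiable (at x)"
    using assms by (simp add: differentiable_on_def)
  then have D: "(f has_derivative frechet_derivative f (at x)) (at x)"
    by (simp add: frechet_derivative_works)
  then interpret L: linear "frechet_derivative f (at x)"
    by (rule has_derivative_linear)
  have "frechet_derivative f (at x) h = (\<Sum>i\<in>UNIV. h$i * partial_deriv i f x)" for h
  proof -
    have "frechet_derivative f (at x) h = frechet_derivative f (at x) (\<Sum>i\<in>UNIV. (h$i) *\<^sub>R axis i 1)"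
      using basis_expansion[of h] by (simp add: scalar_mult_eq_scaleR)
    also have "\<dots> = (\<Sum>i\<in>UNIV. h$i * partial_deriv i f x)"
      by (simp add: L.sum L.scale partial_deriv_def)
    finally show ?thesis .
  qed
  then have "frechet_derivative f (at x) = (\<lambda>h. \<Sum>i\<in>UNIV. h$i * partial_deriv i f x)" by blast
  with D show ?thesis by simp
qed

lemma Ck_imp_continuous:
  fixes f :: "real^'n \<Rightarrow> real"
  assumes "Ck k f"
  shows "continuous_on UNIV f"
  using assms by (cases k) (auto intro: differentiable_imp_continuous_on)

lemma Ck1_partial_continuous:
  assumes "Ck (Suc 0) f"
  shows "continuous_on UNIV (partial_deriv i f)"
  using assms by simp

lemma Ck1I:
  fixes f :: "real^'n \<Rightarrow> real"
  assumes "\<And>x. (f has_derivative D x) (at x)"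
    and "\<And>i. continuous_on UNIV (\<lambda>x. D x (axis i 1))"
  shows "Ck (Suc 0) f" "partial_deriv i f = (\<lambda>x. D x (axis i 1))"
proof -
  have *: "partial_deriv j f = (\<lambda>x. D x (axis j 1))" for j
    using partial_deriv_eq[OF assms(1)] by auto
  show "partial_deriv i f = (\<lambda>x. D x (axis i 1))" by (rule *)
  have "f differentiable_on UNIV"
    using assms(1) by (auto simp: differentiable_on_def differentiable_def)
  then show "Ck (Suc 0) f" using assms(2) * by simp
qed

lemma line_has_derivative:
  fixes u :: "real^'n \<Rightarrow> real"
  assumes u: "Ck (Suc 0) u"
  shows "((\<lambda>t. u (x + t *\<^sub>R v)) has_field_derivative (\<Sum>i\<in>UNIV. v$i * partial_deriv i u (x + t *\<^sub>R v))) (at t)"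
proof -
  have 1: "((\<lambda>t. x + t *\<^sub>R v) has_derivative (\<lambda>h. h *\<^sub>R v)) (at t)"
    by (auto intro!: derivative_eq_intros)
  have "((\<lambda>t. u (x + t *\<^sub>R v)) has_derivative (\<lambda>h. \<Sum>i\<in>UNIV. (h *\<^sub>R v)$i * partial_deriv i u (x + t *\<^sub>R v))) (at t)"
    using has_derivative_compose[OF 1 Ck1_has_derivative[OF u]] .
  moreover have "(\<lambda>h. \<Sum>i\<in>UNIV. (h *\<^sub>R v)$i * partial_deriv i u (x + t *\<^sub>R v)) =
     (*) (\<Sum>i\<in>UNIV. v$i * partial_deriv i u (x + t *\<^sub>R v))"
    by (auto simp: sum_distrib_left sum_distrib_right mult_ac)
  ultimately show ?thesis by (simp add: has_field_derivative_def)
qed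

text \<open>
The mean value theorem for \<open>t \<mapsto> \<integral> u (x + t v) dx\<close>. It serves to compare averages over translated boxes
and, applied to a box that contains the support, to integrate by parts.
\<close>

lemma integral_translate_mvt:
  fixes u :: "real^'n \<Rightarrow> real"
  assumes u: "Ck (Suc 0) u"
  shows "\<exists>\<xi>\<in>{0<..<1}. integral (cbox c d) (\<lambda>x. u (x + v)) - integral (cbox c d) u
    = integral (cbox c d) (\<lambda>x. \<Sum>i\<in>UNIV. v$i * partial_deriv i u (x + \<xi> *\<^sub>R v))"
proof -
  define \<Phi> where "\<Phi> t = integral (cbox c d) (\<lambda>x. u (x + t *\<^sub>R v))" for t :: real
  define \<Phi>' where "\<Phi>' t = integral (cbox c d) (\<lambda>x. \<Sum>i\<in>UNIV. v$i * partial_deriv i u (x + t *\<^sub>R v))" for t :: real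
  note [continuous_intros] = continuous_on_compose2[OF Ck_imp_continuous[OF u]]
     continuous_on_compose2[OF Ck1_partial_continuous[OF u]]
  have "(\<Phi> has_field_derivative \<Phi>' t) (at t)" for t
    unfolding \<Phi>_def \<Phi>'_def
    by (rule leibniz_rule_field_derivative[where U=UNIV, simplified])
       (use line_has_derivative[OF u] in \<open>auto intro!: integrable_continuous continuous_intros simp: split_beta\<close>)
  from MVT2[of 0 1 \<Phi> \<Phi>', OF _ this] obtain z where "0 < z" "z < 1" "\<Phi> 1 - \<Phi> 0 = \<Phi>' z"
    by auto
  then show ?thesis unfolding \<Phi>_def \<Phi>'_def by auto
qed

section \<open>Half-open boxes\<close>

text \<open>
The vector \<open>l\<close> lists the side lengths. The boxes are half-open so that a subdivision is an exact
partition, in which every point finds its cell by rounding down (\<open>mem_cell\<close>).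
\<close>

definition hbox :: "real^'n \<Rightarrow> real^'n \<Rightarrow> (real^'n) set" where
  "hbox c l = {x. \<forall>i. c$i \<le> x$i \<and> x$i < c$i + l$i}"

definition vol :: "real^'n \<Rightarrow> real" where
  "vol l = (\<Prod>i\<in>UNIV. l$i)"

lemma hbox_borel [measurable]: "hbox c l \<in> sets borel"
proof -
  have "hbox c l = (\<Inter>i. {x. c$i \<le> x$i} \<inter> {x. x$i < c$i + l$i})"
    by (auto simp: hbox_def)
  also have "\<dots> \<in> sets borel"
    by (intro sets.countable_INT' sets.Int borel_closed borel_open)
       (auto intro!: closed_Collect_le open_Collect_less continuous_intros)
  finally show ?thesis .
qed

lemma hbox_subset_cbox: "hbox c l \<subseteq> cbox c (c + l)"
  by (auto simp: hbox_def mem_box_cart less_imp_le)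

lemma box_subset_hbox: "box c (c + l) \<subseteq> hbox c l"
  by (auto simp: hbox_def mem_box_cart less_imp_le)

lemma continuous_set_integrable:
  fixes f :: "real^'n \<Rightarrow> real"
  assumes "continuous_on UNIV f" "A \<in> sets borel" "bounded A"
  shows "set_integrable lborel A f"
proof -
  obtain d where "A \<subseteq> cbox (-d) d"
    using bounded_subset_cbox_symmetric[OF assms(3)] by blast
  moreover have "set_integrable lborel (cbox (-d) d) f"
    unfolding set_integrable_def
    using borel_integrable_compact[OF compact_cbox continuous_on_subset[OF assms(1)], of "-d" d]
    by (simp add: indicator_def scaleR_conv_of_real if_distrib cong: if_cong)
  ultimately show ?thesis
    using set_integrable_subset assms(2) by (metis sets_lborel)
qed

lemma bounded_hbox: "bounded (hbox c l)"
  using hbox_subset_cbox bounded_cbox bounded_subset by blast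

lemma hbox_integrable:
  fixes f :: "real^'n \<Rightarrow> real"
  assumes "continuous_on UNIV f"
  shows "set_integrable lborel (hbox c l) f"
  using continuous_set_integrable[OF assms hbox_borel bounded_hbox] .

lemma set_integral_hbox:
  fixes f :: "real^'n \<Rightarrow> real"
  assumes "continuous_on UNIV f"
  shows "(LINT x:hbox c l|lborel. f x) = integral (cbox c (c + l)) f"
proof -
  have "(LINT x:hbox c l|lborel. f x) = integral (hbox c l) f"
    using set_borel_integral_eq_integral(2)[OF hbox_integrable[OF assms]] .
  also have "\<dots> = integral (cbox c (c + l)) f"
  proof (rule integral_subset_negligible[OF hbox_subset_cbox])
    show "negligible (cbox c (c + l) - hbox c l)"
      by (rule negligible_subset[OF negligible_frontier_interval[of c "c + l"]])
         (use box_subset_hbox in auto)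
  qed
  finally show ?thesis .
qed

lemma measure_hbox:
  assumes "\<And>i. l$i \<ge> 0"
  shows "measure lborel (hbox c l) = vol l"
proof -
  have "measure lborel (hbox c l) = (LINT x:hbox c l|lborel. 1)"
    by (simp add: set_lebesgue_integral_def)
  also have "\<dots> = integral (cbox c (c + l)) (\<lambda>_. 1)"
    by (rule set_integral_hbox) auto
  also have "\<dots> = measure lborel (cbox c (c + l))" by simp
  also have "\<dots> = vol l"
  proof -
    have "cbox c (c + l) \<noteq> {}"
      using assms by (auto simp: interval_eq_empty_cart not_less)
    then show ?thesis using content_cbox_cart[of c "c + l"] by (simp add: vol_def)
  qed
  finally show ?thesis .
qed

lemma set_integral_hbox_const:
  assumes "\<And>i. l$i \<ge> 0"
  shows "(LINT x:hbox c l|lborel. k) = k * vol l"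
  using measure_hbox[OF assms, of c] by (simp add: set_lebesgue_integral_def mult.commute)

definition cell_index :: "nat \<Rightarrow> ('n::finite \<Rightarrow> nat) set" where
  "cell_index n = {m. \<forall>i. m i < n}"

text \<open>
The corner of the cell with index \<open>m\<close> when all sides of the box are divided into \<open>n\<close> equal parts.
\<close>

definition cell :: "real^'n \<Rightarrow> real^'n \<Rightarrow> nat \<Rightarrow> ('n \<Rightarrow> nat) \<Rightarrow> real^'n" where
  "cell c l n m = (\<chi> i. c$i + l$i * real (m i) / real n)"

lemma cell_index_PiE: "cell_index n = (PiE UNIV (\<lambda>_::'n::finite. {..<n}))"
  by (auto simp: cell_index_def PiE_def)

lemma finite_cell_index [simp]: "finite (cell_index n :: ('n::finite \<Rightarrow> nat) set)"
  by (simp add: cell_index_PiE finite_PiE)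

lemma card_cell_index: "card (cell_index n :: ('n::finite \<Rightarrow> nat) set) = n ^ CARD('n)"
  by (simp add: cell_index_PiE card_PiE)

lemma mem_cell:
  assumes "n > 0" "\<And>i. l$i > 0"
  shows "x \<in> hbox (cell c l n m) (l /\<^sub>R real n) \<longleftrightarrow> (\<forall>i. int (m i) = \<lfloor>real n * (x$i - c$i) / l$i\<rfloor>)"
proof -
  have "(cell c l n m $ i \<le> x$i \<and> x$i < cell c l n m $ i + (l /\<^sub>R real n) $ i) \<longleftrightarrow>
     (int (m i) = \<lfloor>real n * (x$i - c$i) / l$i\<rfloor>)" for i
  proof -
    have "(int (m i) = \<lfloor>real n * (x$i - c$i) / l$i\<rfloor>) \<longleftrightarrow>
       real (m i) \<le> real n * (x$i - c$i) / l$i \<and> real n * (x$i - c$i) / l$i < real (m i) + 1"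
      by (metis (mono_tags) floor_eq_iff of_int_of_nat_eq)
    also have "\<dots> \<longleftrightarrow> (cell c l n m $ i \<le> x$i \<and> x$i < cell c l n m $ i + (l /\<^sub>R real n) $ i)"
      using assms(1) assms(2)[of i] by (simp add: cell_def field_simps)
    finally show ?thesis by blast
  qed
  then show ?thesis by (simp add: hbox_def)
qed

lemma hbox_eq_Union_cells:
  assumes "n > 0" "\<And>i. l$i > 0"
  shows "hbox c l = (\<Union>m\<in>cell_index n. hbox (cell c l n m) (l /\<^sub>R real n))"
proof (intro set_eqI iffI)
  fix x assume x: "x \<in> hbox c l"
  define m where "m i = nat \<lfloor>real n * (x$i - c$i) / l$i\<rfloor>" for i
  have *: "0 \<le> real n * (x$i - c$i) / l$i" "real n * (x$i - c$i) / l$i < real n" for i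
  proof -
    have "0 \<le> x$i - c$i" "x$i - c$i < l$i" using x by (auto simp: hbox_def algebra_simps)
    then show "0 \<le> real n * (x$i - c$i) / l$i" "real n * (x$i - c$i) / l$i < real n"
      using assms(1) assms(2)[of i] by (auto simp: pos_divide_less_eq)
  qed
  have "m \<in> cell_index n"
    using * by (auto simp: cell_index_def m_def nat_less_iff floor_less_iff)
  moreover have "x \<in> hbox (cell c l n m) (l /\<^sub>R real n)"
    unfolding mem_cell[OF assms] using * by (simp add: m_def)
  ultimately show "x \<in> (\<Union>m\<in>cell_index n. hbox (cell c l n m) (l /\<^sub>R real n))" by blast
next
  fix x assume "x \<in> (\<Union>m\<in>cell_index n. hbox (cell c l n m) (l /\<^sub>R real n))"
  then obtain m where m: "\<And>i. m i < n" and x: "\<And>i. int (m i) = \<lfloor>real n * (x$i - c$i) / l$i\<rfloor>"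
    unfolding mem_cell[OF assms] by (auto simp: cell_index_def mem_cell[OF assms])
  have "c$i \<le> x$i \<and> x$i < c$i + l$i" for i
  proof -
    have "real (m i) \<le> real n * (x$i - c$i) / l$i \<and> real n * (x$i - c$i) / l$i < real (m i) + 1"
      using x[of i] by (metis (mono_tags) floor_eq_iff of_int_of_nat_eq)
    moreover have "real (m i) + 1 \<le> real n" using m[of i] by linarith
    ultimately have "0 \<le> real n * (x$i - c$i) / l$i" "real n * (x$i - c$i) / l$i < real n"
      by linarith+
    then have "0 \<le> x$i - c$i" "real n * (x$i - c$i) < real n * l$i"
      using assms(1) assms(2)[of i]
      by (auto simp: pos_divide_less_eq zero_le_mult_iff zero_le_divide_iff)
    then show ?thesis using assms(1) by (simp add: mult_less_cancel_left_pos)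
  qed
  then show "x \<in> hbox c l" by (simp add: hbox_def)
qed

lemma disjoint_cells:
  assumes "n > 0" "\<And>i. l$i > 0"
  shows "disjoint_family_on (\<lambda>m. hbox (cell c l n m) (l /\<^sub>R real n)) (cell_index n)"
proof -
  have "m = m'" if "x \<in> hbox (cell c l n m) (l /\<^sub>R real n)" "x \<in> hbox (cell c l n m') (l /\<^sub>R real n)" for x m m'
    using that unfolding mem_cell[OF assms] by (metis ext of_nat_eq_iff)
  then show ?thesis unfolding disjoint_family_on_def by blast
qed

lemma set_integral_finite_disjoint_UN:
  fixes f :: "'a \<Rightarrow> real"
  assumes "finite I" "disjoint_family_on A I" "\<And>i. i \<in> I \<Longrightarrow> A i \<in> sets M"
    "\<And>i. i \<in> I \<Longrightarrow> set_integrable M (A i) f"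
  shows "(LINT x:(\<Union>i\<in>I. A i)|M. f x) = (\<Sum>i\<in>I. LINT x:A i|M. f x)"
proof -
  have "indicat_real (\<Union>i\<in>I. A i) x = (\<Sum>i\<in>I. indicat_real (A i) x)" for x
    using assms(1,2) by (simp add: indicator_UN_disjoint)
  then show ?thesis unfolding set_lebesgue_integral_def
    using assms(4) by (simp add: sum_distrib_right set_integrable_def)
qed

lemma set_integral_cells:
  fixes f :: "real^'n \<Rightarrow> real"
  assumes "n > 0" "\<And>i. l$i > 0" "continuous_on UNIV f"
  shows "(LINT x:hbox c l|lborel. f x) = (\<Sum>m\<in>cell_index n. LINT x:hbox (cell c l n m) (l /\<^sub>R real n)|lborel. f x)"
  by (subst hbox_eq_Union_cells[OF assms(1,2)], rule set_integral_finite_disjoint_UN)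
     (auto intro: disjoint_cells hbox_integrable assms)

lemma vol_scale: "vol (l /\<^sub>R real n) = vol (l::real^'n) / real n ^ CARD('n)"
  by (simp add: vol_def prod_dividef divide_inverse prod.distrib mult.commute power_inverse)

lemma vol_pos: "(\<And>i. l$i > 0) \<Longrightarrow> vol l > 0"
  by (simp add: vol_def prod_pos)

section \<open>A Poincare-Sobolev inequality on boxes\<close>

text \<open>
Convexity of the \<open>p\<close>-th power, with weights proportional to \<open>X\<close> and \<open>Y\<close>. When \<open>X\<close> and \<open>Y\<close> are bounds for
two \<open>L\<^sup>p\<close> norms, integration gives Minkowski's inequality, even if the two summands are only defined
cell by cell: the cells can be added up before \<open>powr_split_identity\<close> is applied.
\<close>

lemma powr_add_le_split:
  fixes p :: real
  assumes "p \<ge> 1" "s \<ge> 0" "t \<ge> 0" "X > 0" "Y > 0"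
  shows "(s + t) powr p \<le> (X + Y) powr (p - 1) * (s powr p * X powr (1 - p) + t powr p * Y powr (1 - p))"
proof -
  have mono: "1 \<le> (X + Y) powr (p - 1) * Z powr (1 - p)" if "0 < Z" "Z \<le> X + Y" for Z
  proof -
    have "Z powr (p - 1) \<le> (X + Y) powr (p - 1)"
      using that assms by (intro powr_mono2) auto
    then have "Z powr (p - 1) * Z powr (1 - p) \<le> (X + Y) powr (p - 1) * Z powr (1 - p)"
      by (rule mult_right_mono) simp
    moreover have "Z powr (p - 1) * Z powr (1 - p) = 1" using that by (simp flip: powr_add)
    ultimately show ?thesis by simp
  qed
  consider "s = 0" | "t = 0" | "s > 0" "t > 0" using assms by linarith
  then show ?thesis
  proof cases
    case 1
    then show ?thesis using mult_left_mono[OF mono[of Y], of "t powr p"] assms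
      by (simp add: mult_ac)
  next
    case 2
    then show ?thesis using mult_left_mono[OF mono[of X], of "s powr p"] assms
      by (simp add: mult_ac)
  next
    case 3
    define \<mu> where "\<mu> = Y / (X + Y)"
    have l: "0 \<le> \<mu>" "\<mu> \<le> 1" "1 - \<mu> = X / (X + Y)" using assms by (auto simp: \<mu>_def field_simps)
    define a where "a = s * (X + Y) / X"
    define b where "b = t * (X + Y) / Y"
    have ab: "a > 0" "b > 0" using 3 assms by (auto simp: a_def b_def)
    have "(1 - \<mu>) * a = s" "\<mu> * b = t"
      using assms unfolding l(3) a_def by (simp_all add: b_def \<mu>_def)
    then have "s + t = (1 - \<mu>) * a + \<mu> * b" by simp
    then have "(s + t) powr p \<le> (1 - \<mu>) * a powr p + \<mu> * b powr p"
      using convex_onD[OF powr_convex[OF assms(1)] l(1,2), of a b] ab by simp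
    also have "(1 - \<mu>) * a powr p = (X + Y) powr (p - 1) * (s powr p * X powr (1 - p))"
      unfolding l(3) a_def using assms 3
      by (simp add: powr_mult powr_divide powr_diff)
    also have "\<mu> * b powr p = (X + Y) powr (p - 1) * (t powr p * Y powr (1 - p))"
      unfolding \<mu>_def b_def using assms 3
      by (simp add: powr_mult powr_divide powr_diff)
    finally show ?thesis by (simp add: algebra_simps)
  qed
qed

lemma powr_split_identity:
  fixes p :: real
  assumes "X > 0" "Y > 0"
  shows "(X + Y) powr (p - 1) * (X powr p * X powr (1 - p) + Y powr p * Y powr (1 - p)) = (X + Y) powr p"
proof -
  have "X powr p * X powr (1 - p) = X" "Y powr p * Y powr (1 - p) = Y"
    using assms by (simp_all flip: powr_add)
  then show ?thesis using assms by (simp add: powr_diff)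
qed

text \<open>
With \<open>r = p/2\<close> this lets the \<open>p\<close>-th powers of the local norms be summed to the power of the total energy.
\<close>

lemma sum_powr_le:
  fixes x :: "'a \<Rightarrow> real"
  assumes "finite I" "\<And>i. i \<in> I \<Longrightarrow> x i \<ge> 0" "r \<ge> 1"
  shows "(\<Sum>i\<in>I. x i powr r) \<le> (\<Sum>i\<in>I. x i) powr r"
proof -
  have *: "z powr r = z * z powr (r - 1)" if "z \<ge> 0" for z :: real
    using that by (cases "z = 0") (auto simp: powr_diff)
  have "(\<Sum>i\<in>I. x i powr r) \<le> (\<Sum>i\<in>I. x i * (\<Sum>i\<in>I. x i) powr (r - 1))"
    using assms by (intro sum_mono) (auto simp: * intro!: mult_left_mono powr_mono2 member_le_sum)
  also have "\<dots> = (\<Sum>i\<in>I. x i) powr r"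
    using assms by (subst *[of "sum x I"]) (auto simp: sum_distrib_right intro: sum_nonneg)
  finally show ?thesis .
qed

lemma hbox_integral_translate:
  fixes f :: "real^'n \<Rightarrow> real"
  assumes [measurable]: "f \<in> borel_measurable borel"
  shows "(LINT x:hbox (c + v) l|lborel. f x) = (LINT x:hbox c l|lborel. f (x + v))"
proof -
  have "(LINT x:hbox (c + v) l|lborel. f x) = (LINT x:hbox (c + v) l|(distr lborel borel ((+) v)). f x)"
    by (simp add: lborel_distr_plus)
  also have "\<dots> = (LINT x|lborel. indicat_real (hbox (c + v) l) (v + x) * f (v + x))"
    unfolding set_lebesgue_integral_def by (subst integral_distr) auto
  also have "\<dots> = (LINT x:hbox c l|lborel. f (x + v))"
    unfolding set_lebesgue_integral_def
    by (intro Bochner_Integration.integral_cong) (auto simp: indicator_def hbox_def algebra_simps)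
  finally show ?thesis .
qed

lemma hbox_cauchy_schwarz:
  fixes f :: "real^'n \<Rightarrow> real"
  assumes f: "continuous_on UNIV f" and l: "\<And>i. l$i > 0"
  shows "(LINT x:hbox c l|lborel. f x)\<^sup>2 \<le> vol l * (LINT x:hbox c l|lborel. (f x)\<^sup>2)"
proof -
  define I where "I = (LINT x:hbox c l|lborel. f x)"
  define k where "k = I / vol l"
  have v: "vol l > 0" using l by (rule vol_pos)
  have "0 \<le> (LINT x:hbox c l|lborel. (f x - k)\<^sup>2)"
    unfolding set_lebesgue_integral_def by (intro integral_nonneg_AE) auto
  also have "\<dots> = (LINT x:hbox c l|lborel. (f x)\<^sup>2 - (2 * k) * f x + k\<^sup>2)"
    by (simp add: power2_eq_square algebra_simps)
  also have "\<dots> = (LINT x:hbox c l|lborel. (f x)\<^sup>2) - 2 * k * I + k\<^sup>2 * vol l"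
  proof -
    have 1: "set_integrable lborel (hbox c l) (\<lambda>x. (f x)\<^sup>2)"
      "set_integrable lborel (hbox c l) (\<lambda>x. (2 * k) * f x)"
      "set_integrable lborel (hbox c l) (\<lambda>x. k\<^sup>2)"
      using f by (auto intro!: hbox_integrable continuous_intros)
    have "(LINT x:hbox c l|lborel. (f x)\<^sup>2 - (2 * k) * f x + k\<^sup>2)
      = (LINT x:hbox c l|lborel. (f x)\<^sup>2) - (LINT x:hbox c l|lborel. (2 * k) * f x) + (LINT x:hbox c l|lborel. k\<^sup>2)"
      using set_integral_add(2)[OF set_integral_diff(1)[OF 1(1,2)] 1(3)] set_integral_diff(2)[OF 1(1,2)] by simp
    then show ?thesis unfolding I_def using l
      by (simp add: set_integral_hbox_const less_imp_le)
  qed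
  also have "\<dots> = (LINT x:hbox c l|lborel. (f x)\<^sup>2) - I\<^sup>2 / vol l"
    using v by (simp add: k_def field_simps power2_eq_square)
  finally show ?thesis using v by (simp add: I_def field_simps)
qed

lemma hbox_integral_mono_set:
  fixes f :: "real^'n \<Rightarrow> real"
  assumes "continuous_on UNIV f" "\<And>x. f x \<ge> 0" "A \<subseteq> hbox c l" "A \<in> sets borel"
  shows "(LINT x:A|lborel. f x) \<le> (LINT x:hbox c l|lborel. f x)"
proof -
  have "bounded A" using assms(3) bounded_hbox bounded_subset by blast
  then have "set_integrable lborel A f" using continuous_set_integrable assms by blast
  then show ?thesis using hbox_integrable[OF assms(1), of c l] assms
    unfolding set_lebesgue_integral_def set_integrable_def
    by (intro integral_mono) (auto simp: indicator_def)
qed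

lemma hbox_integral_nonneg:
  assumes "\<And>x. f x \<ge> (0::real)"
  shows "(LINT x:A|M. f x) \<ge> 0"
  unfolding set_lebesgue_integral_def using assms by (intro integral_nonneg_AE) auto

text \<open>
The squared gradient in the coordinates that turn a box with sides \<open>l\<close> into the unit cube.
\<close>

definition grad_sq :: "real^'n \<Rightarrow> (real^'n \<Rightarrow> real) \<Rightarrow> real^'n \<Rightarrow> real" where
  "grad_sq l u x = (\<Sum>i\<in>UNIV. (l$i)\<^sup>2 * (partial_deriv i u x)\<^sup>2)"

lemma continuous_grad_sq:
  assumes "Ck (Suc 0) u" shows "continuous_on UNIV (grad_sq l u)"
  unfolding grad_sq_def using Ck1_partial_continuous[OF assms] by (intro continuous_intros) auto

lemma grad_sq_nonneg: "grad_sq l u x \<ge> 0"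
  by (simp add: grad_sq_def sum_nonneg)

text \<open>
Two cells of the bisected box differ by a translation \<open>v\<close> with \<open>\<bar>v$i\<bar> \<le> l$i/2\<close>, and the cells in between
stay in the box. So the difference is an integral of the derivative along \<open>v\<close> over one such cell.
\<close>

lemma cell_integral_diff:
  fixes u :: "real^'n \<Rightarrow> real" and c :: "real^'n"
  assumes u: "Ck (Suc 0) u" and l: "\<And>i. l$i > 0" and m: "m \<in> cell_index 2" "m' \<in> cell_index 2"
  defines "q \<equiv> \<lambda>m. hbox (cell c l 2 m) (l /\<^sub>R real 2)"
  shows "((LINT x:q m'|lborel. u x) - (LINT x:q m|lborel. u x))\<^sup>2
    \<le> vol (l /\<^sub>R real 2) * (real CARD('n) / 4 * (LINT x:hbox c l|lborel. grad_sq l u x))"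
proof -
  define l' where "l' = l /\<^sub>R real 2"
  define C where "C = cell c l 2 m"
  define v where "v = cell c l 2 m' - C"
  have mle: "m i \<le> 1" "m' i \<le> 1" for i using m by (auto simp: cell_index_def less_2_cases_iff dest!: spec[of _ i])
  have v: "v$i = l$i / 2 * (real (m' i) - real (m i))" for i
    by (simp add: v_def C_def cell_def field_simps)
  have vabs: "(v$i)\<^sup>2 \<le> (l$i)\<^sup>2 / 4" for i
  proof -
    have "m i = 0 \<or> m i = 1" "m' i = 0 \<or> m' i = 1" using mle[of i] by auto
    then have "(real (m' i) - real (m i))\<^sup>2 \<le> 1" by auto
    then have "(l$i / 2)\<^sup>2 * (real (m' i) - real (m i))\<^sup>2 \<le> (l$i/2)\<^sup>2"
      by (simp add: mult_left_le)
    then show ?thesis unfolding v power_mult_distrib by (simp add: power_divide)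
  qed
  have cu: "continuous_on UNIV u" using Ck_imp_continuous[OF u] .
  note cpu = Ck1_partial_continuous[OF u]
  define g where "g x = (\<Sum>i\<in>UNIV. v$i * partial_deriv i u x)" for x
  have cg: "continuous_on UNIV g" unfolding g_def using cpu by (intro continuous_intros) auto
  have [measurable]: "u \<in> borel_measurable borel" "g \<in> borel_measurable borel"
    using cu cg borel_measurable_continuous_onI by auto
  have "(LINT x:q m'|lborel. u x) = (LINT x:hbox (C + v) l'|lborel. u x)"
    by (simp add: q_def l'_def v_def)
  also have "\<dots> = (LINT x:hbox C l'|lborel. u (x + v))"
    by (rule hbox_integral_translate) simp
  also have "\<dots> = integral (cbox C (C + l')) (\<lambda>x. u (x + v))"
    by (rule set_integral_hbox) (intro continuous_on_compose2[OF cu] continuous_intros, auto)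
  finally have e1: "(LINT x:q m'|lborel. u x) = integral (cbox C (C + l')) (\<lambda>x. u (x + v))" .
  have e2: "(LINT x:q m|lborel. u x) = integral (cbox C (C + l')) u"
    unfolding q_def C_def l'_def by (rule set_integral_hbox[OF cu])
  obtain \<xi> where \<xi>: "0 < \<xi>" "\<xi> < 1" and
    mvt: "integral (cbox C (C + l')) (\<lambda>x. u (x + v)) - integral (cbox C (C + l')) u
       = integral (cbox C (C + l')) (\<lambda>x. g (x + \<xi> *\<^sub>R v))"
    using integral_translate_mvt[OF u, of C "C + l'" v] unfolding g_def by auto
  note mvt
  also have "integral (cbox C (C + l')) (\<lambda>x. g (x + \<xi> *\<^sub>R v)) = (LINT x:hbox C l'|lborel. g (x + \<xi> *\<^sub>R v))"
    by (rule set_integral_hbox[symmetric]) (intro continuous_on_compose2[OF cg] continuous_intros, auto)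
  also have "\<dots> = (LINT x:hbox (C + \<xi> *\<^sub>R v) l'|lborel. g x)"
    by (rule hbox_integral_translate[symmetric]) simp
  finally have e3: "(LINT x:q m'|lborel. u x) - (LINT x:q m|lborel. u x) = (LINT x:hbox (C + \<xi> *\<^sub>R v) l'|lborel. g x)"
    using e1 e2 by simp
  have l': "l'$i > 0" for i using l by (simp add: l'_def)
  have sub: "hbox (C + \<xi> *\<^sub>R v) l' \<subseteq> hbox c l"
  proof
    fix x assume x: "x \<in> hbox (C + \<xi> *\<^sub>R v) l'"
    have "c$i \<le> x$i \<and> x$i < c$i + l$i" for i
    proof -
      define \<mu> where "\<mu> = real (m i) + \<xi> * (real (m' i) - real (m i))"
      have "m i = 0 \<or> m i = 1" "m' i = 0 \<or> m' i = 1" using mle[of i] by auto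
      then have "0 \<le> \<mu>" "\<mu> \<le> 1" using \<xi> by (auto simp: \<mu>_def)
      then have "0 \<le> l$i / 2 * \<mu>" "l$i/2 * \<mu> \<le> l$i/2" using l[of i] by auto
      moreover have "(C + \<xi> *\<^sub>R v) $ i = c$i + l$i / 2 * \<mu>"
        unfolding C_def \<mu>_def by (simp add: cell_def v field_simps)
      moreover have "(C + \<xi> *\<^sub>R v) $ i \<le> x$i" "x$i < (C + \<xi> *\<^sub>R v) $ i + l$i / 2"
        using x by (auto simp: hbox_def l'_def dest!: spec[of _ i])
      ultimately show ?thesis by linarith
    qed
    then show "x \<in> hbox c l" by (simp add: hbox_def)
  qed
  have gle: "(g x)\<^sup>2 \<le> real CARD('n) / 4 * grad_sq l u x" for x
  proof -
    have "(g x)\<^sup>2 \<le> (\<Sum>i\<in>UNIV. (v$i * partial_deriv i u x)\<^sup>2) * real CARD('n)"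
      unfolding g_def by (rule sum_squared_le_sum_of_squares)
    also have "\<dots> \<le> (\<Sum>i\<in>UNIV. (l$i)\<^sup>2 / 4 * (partial_deriv i u x)\<^sup>2) * real CARD('n)"
      using mult_right_mono[OF vabs] by (intro mult_right_mono sum_mono) (auto simp: power_mult_distrib)
    also have "\<dots> = real CARD('n) / 4 * grad_sq l u x"
      by (simp add: grad_sq_def sum_distrib_left sum_distrib_right mult_ac)
    finally show ?thesis .
  qed
  have "((LINT x:q m'|lborel. u x) - (LINT x:q m|lborel. u x))\<^sup>2 \<le>
     vol l' * (LINT x:hbox (C + \<xi> *\<^sub>R v) l'|lborel. (g x)\<^sup>2)"
    unfolding e3 using cg l' by (rule hbox_cauchy_schwarz)
  also have "\<dots> \<le> vol l' * (LINT x:hbox (C + \<xi> *\<^sub>R v) l'|lborel. real CARD('n) / 4 * grad_sq l u x)"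
    using vol_pos[of l'] l' gle continuous_grad_sq[OF u, of l] cg
    by (intro mult_left_mono set_integral_mono hbox_integrable continuous_intros) (auto simp: less_imp_le)
  also have "\<dots> \<le> vol l' * (LINT x:hbox c l|lborel. real CARD('n) / 4 * grad_sq l u x)"
    using vol_pos[of l'] l' continuous_grad_sq[OF u, of l] sub grad_sq_nonneg[of l u]
    by (intro mult_left_mono hbox_integral_mono_set continuous_intros) (auto simp: less_imp_le)
  finally show ?thesis by (simp add: l'_def)
qed

definition avg :: "real^'n \<Rightarrow> real^'n \<Rightarrow> (real^'n \<Rightarrow> real) \<Rightarrow> real" where
  "avg c l u = (LINT x:hbox c l|lborel. u x) / vol l"

lemma avg_cell_diff:
  fixes u :: "real^'n \<Rightarrow> real"
  assumes u: "Ck (Suc 0) u" and l: "\<And>i. l$i > 0" and m: "m \<in> cell_index 2"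
  shows "\<bar>avg (cell c l 2 m) (l /\<^sub>R real 2) u - avg c l u\<bar>
    \<le> sqrt (real CARD('n) * 2 ^ CARD('n) / 4 * (LINT x:hbox c l|lborel. grad_sq l u x) / vol l)"
proof -
  define N where "N = CARD('n)"
  define G where "G = (LINT x:hbox c l|lborel. grad_sq l u x)"
  define I where "I m = (LINT x:hbox (cell c l 2 m) (l /\<^sub>R real 2)|lborel. u x)" for m
  define D where "D = sqrt (vol (l /\<^sub>R real 2) * (real N / 4 * G))"
  have vl: "vol (l /\<^sub>R real 2) = vol l / 2 ^ N" using vol_scale[of 2 l] by (simp add: N_def)
  have v: "vol l > 0" using vol_pos[OF l] .
  have G: "G \<ge> 0" unfolding G_def by (rule hbox_integral_nonneg) (rule grad_sq_nonneg)
  have D: "\<bar>I m' - I m\<bar> \<le> D" if "m' \<in> cell_index 2" for m'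
    using cell_integral_diff[OF u l m that, of c] unfolding D_def I_def G_def N_def
    by (intro real_le_rsqrt) auto
  have "(LINT x:hbox c l|lborel. u x) = (\<Sum>m'\<in>cell_index 2. I m')"
    unfolding I_def using set_integral_cells[OF _ l Ck_imp_continuous[OF u], of 2] by simp
  moreover have "real (card (cell_index 2 :: ('n \<Rightarrow> nat) set)) = 2 ^ N"
    by (simp add: card_cell_index N_def)
  ultimately have "2 ^ N * I m - (LINT x:hbox c l|lborel. u x) = (\<Sum>m'\<in>(cell_index 2 :: ('n \<Rightarrow> nat) set). I m - I m')"
    by (simp add: sum_subtractf)
  then have "\<bar>2 ^ N * I m - (LINT x:hbox c l|lborel. u x)\<bar> \<le> (\<Sum>m'\<in>(cell_index 2 :: ('n \<Rightarrow> nat) set). \<bar>I m - I m'\<bar>)"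
    by simp
  also have "\<dots> \<le> (\<Sum>m'\<in>(cell_index 2 :: ('n \<Rightarrow> nat) set). D)"
    using D by (intro sum_mono) (simp add: abs_minus_commute)
  also have "\<dots> = 2 ^ N * D" by (simp add: card_cell_index N_def)
  finally have "\<bar>2 ^ N * I m - (LINT x:hbox c l|lborel. u x)\<bar> / vol l \<le> 2 ^ N * D / vol l"
    using v by (simp add: divide_right_mono)
  moreover have "avg (cell c l 2 m) (l /\<^sub>R real 2) u - avg c l u = (2 ^ N * I m - (LINT x:hbox c l|lborel. u x)) / vol l"
    unfolding avg_def vl using v by (simp add: I_def field_simps)
  moreover have "2 ^ N * D / vol l = sqrt (real N * 2 ^ N / 4 * G / vol l)"
  proof -
    have "(2 ^ N * D / vol l)\<^sup>2 = (2 ^ N)\<^sup>2 * (vol l / 2 ^ N * (real N / 4 * G)) / (vol l)\<^sup>2"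
      using G v unfolding D_def vl by (simp add: power_mult_distrib power_divide)
    also have "\<dots> = real N * 2 ^ N / 4 * G / vol l"
      using v by (simp add: field_simps power2_eq_square)
    finally have "(2 ^ N * D / vol l)\<^sup>2 = real N * 2 ^ N / 4 * G / vol l" .
    moreover have "D \<ge> 0" unfolding D_def vl using G v by simp
    ultimately show ?thesis using v by (metis divide_nonneg_pos mult_nonneg_nonneg real_sqrt_unique zero_le_numeral zero_le_power)
  qed
  ultimately show ?thesis using v by (simp add: G_def N_def)
qed

lemma lipschitz_of_bounded_partials:
  fixes u :: "real^'n \<Rightarrow> real"
  assumes u: "Ck (Suc 0) u" and L: "\<And>i x. \<bar>partial_deriv i u x\<bar> \<le> L"
    and xy: "\<And>i. \<bar>x$i - y$i\<bar> \<le> l$i"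
  shows "\<bar>u x - u y\<bar> \<le> L * (\<Sum>i\<in>UNIV. l$i)"
proof -
  obtain z :: real where z: "u (y + 1 *\<^sub>R (x - y)) - u (y + 0 *\<^sub>R (x - y)) =
     (1 - 0) * (\<Sum>i\<in>UNIV. (x - y)$i * partial_deriv i u (y + z *\<^sub>R (x - y)))"
    using MVT2[of 0 1 "\<lambda>t. u (y + t *\<^sub>R (x - y))", OF _ line_has_derivative[OF u]] by auto
  then have "\<bar>u x - u y\<bar> = \<bar>\<Sum>i\<in>UNIV. (x - y)$i * partial_deriv i u (y + z *\<^sub>R (x - y))\<bar>" by simp
  also have "\<dots> \<le> (\<Sum>i\<in>UNIV. \<bar>(x - y)$i\<bar> * \<bar>partial_deriv i u (y + z *\<^sub>R (x - y))\<bar>)"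
    unfolding abs_mult[symmetric] by (rule sum_abs)
  also have "\<dots> \<le> (\<Sum>i\<in>UNIV. l$i * L)"
  proof (rule sum_mono)
    fix i
    have "0 \<le> l$i" using xy[of i] by linarith
    then show "\<bar>(x - y)$i\<bar> * \<bar>partial_deriv i u (y + z *\<^sub>R (x - y))\<bar> \<le> l$i * L"
      using xy[of i] L by (intro mult_mono) auto
  qed
  finally show ?thesis by (simp add: sum_distrib_left mult.commute)
qed

lemma deviation_from_avg:
  fixes u :: "real^'n \<Rightarrow> real"
  assumes u: "Ck (Suc 0) u" and L: "\<And>i x. \<bar>partial_deriv i u x\<bar> \<le> L" and l: "\<And>i. l$i > 0"
    and x: "x \<in> hbox c l"
  shows "\<bar>u x - avg c l u\<bar> \<le> L * (\<Sum>i\<in>UNIV. l$i)"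
proof -
  define B where "B = L * (\<Sum>i\<in>UNIV. l$i)"
  have v: "vol l > 0" using vol_pos[OF l] .
  note cu = Ck_imp_continuous[OF u]
  have bd: "\<bar>u x - u y\<bar> \<le> B" if "y \<in> hbox c l" for y
    unfolding B_def
  proof (rule lipschitz_of_bounded_partials[OF u L])
    show "\<bar>x $ i - y $ i\<bar> \<le> l $ i" for i
      using x that unfolding hbox_def by (auto dest!: spec[of _ i])
  qed
  have int: "set_integrable lborel (hbox c l) u" by (rule hbox_integrable[OF cu])
  have cint: "set_integrable lborel (hbox c l) (\<lambda>y. k)" for k :: real
    by (intro hbox_integrable continuous_intros)
  have "(LINT y:hbox c l|lborel. u y) \<le> (LINT y:hbox c l|lborel. u x + B)"
    using bd by (intro set_integral_mono int cint) (auto simp: abs_le_iff algebra_simps)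
  moreover have "(LINT y:hbox c l|lborel. u x - B) \<le> (LINT y:hbox c l|lborel. u y)"
    using bd by (intro set_integral_mono int cint) (force simp: abs_le_iff algebra_simps)
  ultimately have "(u x - B) * vol l \<le> (LINT y:hbox c l|lborel. u y)" "(LINT y:hbox c l|lborel. u y) \<le> (u x + B) * vol l"
    using l by (simp_all add: set_integral_hbox_const less_imp_le)
  then have "u x - B \<le> avg c l u" "avg c l u \<le> u x + B"
    using v by (auto simp: avg_def field_simps)
  then show ?thesis by (simp add: B_def abs_le_iff)
qed

text \<open>
The floor \<open>\<epsilon>\<close> makes this positive even where the gradient vanishes, which gives every fixed function some
finite constant in the inequality to be proved. The factor \<open>\<Sum>i. (l$i)\<^sup>2\<close> lets the floor scale under
subdivision like \<open>grad_sq\<close>; at the end \<open>\<epsilon>\<close> tends to 0.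
\<close>

definition grad_energy :: "real \<Rightarrow> real^'n \<Rightarrow> real^'n \<Rightarrow> (real^'n \<Rightarrow> real) \<Rightarrow> real" where
  "grad_energy \<epsilon> c l u = (LINT x:hbox c l|lborel. grad_sq l u x + \<epsilon> * (\<Sum>i\<in>UNIV. (l$i)\<^sup>2))"

lemma grad_energy_eq:
  fixes u :: "real^'n \<Rightarrow> real"
  assumes u: "Ck (Suc 0) u" and l: "\<And>i. l$i > 0"
  shows "grad_energy \<epsilon> c l u = grad_energy 0 c l u + \<epsilon> * (\<Sum>i\<in>UNIV. (l$i)\<^sup>2) * vol l"
proof -
  have 1: "set_integrable lborel (hbox c l) (grad_sq l u)"
    "set_integrable lborel (hbox c l) (\<lambda>_. \<epsilon> * (\<Sum>i\<in>UNIV. (l$i)\<^sup>2))"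
    by (intro hbox_integrable continuous_grad_sq[OF u] continuous_intros)+
  show ?thesis
    unfolding grad_energy_def using set_integral_add(2)[OF 1] l
    by (simp add: set_integral_hbox_const less_imp_le)
qed

lemma grad_energy_nonneg: "0 \<le> grad_energy 0 c l u"
  unfolding grad_energy_def by (intro hbox_integral_nonneg) (simp add: grad_sq_nonneg)

text \<open>
The power of the volume is the one for which the Poincare-Sobolev inequality has the same constant on
all boxes.
\<close>

definition box_norm :: "real \<Rightarrow> real \<Rightarrow> real^'n \<Rightarrow> real^'n \<Rightarrow> (real^'n \<Rightarrow> real) \<Rightarrow> real" where
  "box_norm p \<epsilon> c l u = vol l powr (1/p - 1/2) * sqrt (grad_energy \<epsilon> c l u)"

lemma scale_grad_sq: "grad_sq (l /\<^sub>R real n) u x = grad_sq l u x / (real n)\<^sup>2"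
  by (simp add: grad_sq_def sum_divide_distrib divide_inverse power_mult_distrib power_inverse mult_ac sum_distrib_left)

text \<open>
The exponent of the gain under subdivision, in dimension \<open>N\<close>.
\<close>

abbreviation sobolev_gain :: "nat \<Rightarrow> real \<Rightarrow> real" where
  "sobolev_gain N p \<equiv> 1 - real N / 2 + real N / p"

text \<open>
Subdivision gains a power of \<open>n\<close>: a cell has sides shorter by the factor \<open>1/n\<close> and volume smaller by
\<open>1/n^N\<close>, and the exponents combine to \<open>sobolev_gain\<close>. It is positive exactly if \<open>p\<close> is subcritical.
\<close>

lemma sum_box_norm_cells:
  fixes u :: "real^'n \<Rightarrow> real"
  assumes u: "Ck (Suc 0) u" and l: "\<And>i. l$i > 0" and p: "p \<ge> 2" and n: "n > 0" and e: "\<epsilon> \<ge> 0"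
  shows "(\<Sum>m\<in>cell_index n. box_norm p \<epsilon> (cell c l n m) (l /\<^sub>R real n) u powr p)
    \<le> (real n powr - sobolev_gain CARD('n) p * box_norm p \<epsilon> c l u) powr p"
proof -
  define N where "N = real CARD('n)"
  define H where "H x = grad_sq l u x + \<epsilon> * (\<Sum>i\<in>UNIV. (l$i)\<^sup>2)" for x
  define h where "h m = (LINT x:hbox (cell c l n m) (l /\<^sub>R real n)|lborel. H x)" for m
  define \<theta> where "\<theta> = real n powr - (1 - N / 2 + N / p)"
  have v: "vol l > 0" using vol_pos[OF l] .
  have H0: "H x \<ge> 0" for x using e by (auto simp: H_def grad_sq_nonneg intro!: add_nonneg_nonneg mult_nonneg_nonneg sum_nonneg)
  have h0: "h m \<ge> 0" for m unfolding h_def by (rule hbox_integral_nonneg[OF H0])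
  have cH: "continuous_on UNIV H" unfolding H_def by (intro continuous_intros continuous_grad_sq[OF u])
  have ge: "grad_energy \<epsilon> (cell c l n m) (l /\<^sub>R real n) u = h m / (real n)\<^sup>2" for m
  proof -
    have "(\<Sum>i\<in>UNIV. ((l /\<^sub>R real n)$i)\<^sup>2) = (\<Sum>i\<in>UNIV. (l$i)\<^sup>2) / (real n)\<^sup>2"
      by (simp add: sum_divide_distrib divide_inverse power_mult_distrib power_inverse mult_ac sum_distrib_left)
    then have "grad_sq (l /\<^sub>R real n) u x + \<epsilon> * (\<Sum>i\<in>UNIV. ((l /\<^sub>R real n)$i)\<^sup>2) = H x / (real n)\<^sup>2" for x
      unfolding scale_grad_sq H_def by (simp only: add_divide_distrib times_divide_eq_right)
    then show ?thesis unfolding grad_energy_def h_def by (simp only: set_integral_divide_zero)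
  qed
  have bn: "box_norm p \<epsilon> (cell c l n m) (l /\<^sub>R real n) u = \<theta> * (vol l powr (1/p - 1/2) * sqrt (h m))" for m
  proof -
    have "(vol l / real n ^ CARD('n)) powr (1/p - 1/2) * inverse (real n) = \<theta> * vol l powr (1/p-1/2)"
    proof -
      have e1: "(vol l / real n ^ CARD('n)) powr (1/p - 1/2) = vol l powr (1/p - 1/2) * real n powr (- (N * (1/p - 1/2)))"
        using v n unfolding N_def
        by (simp add: powr_divide powr_minus_divide powr_powr flip: powr_realpow)
      have e2: "inverse (real n) = real n powr (-1)" using n by (simp add: powr_minus)
      have e3: "real n powr (- (N * (1/p - 1/2))) * real n powr (-1) = \<theta>"
        unfolding \<theta>_def powr_add[symmetric] by (simp add: algebra_simps)
      show ?thesis unfolding e1 e2 mult.assoc e3 by (rule mult.commute)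
    qed
    moreover have "sqrt (h m / (real n)\<^sup>2) = inverse (real n) * sqrt (h m)"
      using n by (simp add: real_sqrt_divide field_simps)
    ultimately show ?thesis unfolding box_norm_def ge vol_scale by (simp add: mult_ac)
  qed
  have pow: "(\<theta> * (vol l powr (1/p - 1/2) * sqrt z)) powr p = (\<theta> * vol l powr (1/p - 1/2)) powr p * z powr (p/2)"
    if "z \<ge> 0" for z
  proof -
    have "sqrt z powr p = z powr (p/2)" using that by (simp add: powr_powr flip: powr_half_sqrt)
    then show ?thesis unfolding mult.assoc[symmetric] using that by (subst powr_mult) (auto simp: \<theta>_def)
  qed
  have "(\<Sum>m\<in>cell_index n. box_norm p \<epsilon> (cell c l n m) (l /\<^sub>R real n) u powr p)
      = (\<theta> * vol l powr (1/p - 1/2)) powr p * (\<Sum>m\<in>(cell_index n :: ('n \<Rightarrow> nat) set). h m powr (p/2))"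
    unfolding bn sum_distrib_left by (intro sum.cong refl pow h0)
  also have "\<dots> \<le> (\<theta> * vol l powr (1/p - 1/2)) powr p * (\<Sum>m\<in>(cell_index n :: ('n \<Rightarrow> nat) set). h m) powr (p/2)"
    using h0 p by (intro mult_left_mono sum_powr_le) auto
  also have "(\<Sum>m\<in>cell_index n. h m) = grad_energy \<epsilon> c l u"
    unfolding h_def grad_energy_def H_def[symmetric] using set_integral_cells[OF n l cH, of c] by simp
  also have "(\<theta> * vol l powr (1/p - 1/2)) powr p * grad_energy \<epsilon> c l u powr (p/2) = (\<theta> * box_norm p \<epsilon> c l u) powr p"
  proof -
    have "grad_energy \<epsilon> c l u \<ge> 0" unfolding grad_energy_def using H0 by (intro hbox_integral_nonneg) (simp add: H_def)
    then show ?thesis unfolding box_norm_def by (rule pow[symmetric])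
  qed
  finally show ?thesis by (simp add: \<theta>_def N_def)
qed

text \<open>
One constant \<open>K\<close> for one function but for all boxes at once, so that it can be applied to the cells of a box.
\<close>

definition poincare_bound :: "real \<Rightarrow> real \<Rightarrow> (real^'n \<Rightarrow> real) \<Rightarrow> real \<Rightarrow> bool" where
  "poincare_bound p \<epsilon> u K \<longleftrightarrow> (\<forall>c l. (\<forall>i. l$i > 0) \<longrightarrow>
     (LINT x:hbox c l|lborel. \<bar>u x - avg c l u\<bar> powr p) \<le> (K * box_norm p \<epsilon> c l u) powr p)"

text \<open>
A bound for the derivatives makes the deviation proportional to the sides, and the floor \<open>\<epsilon>\<close> bounds the
right-hand side from below by the same quantity. The constant depends on the function; it only starts the
improvement below.
\<close>

lemma poincare_bound_apriori:
  fixes u :: "real^'n \<Rightarrow> real"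
  assumes u: "Ck (Suc 0) u" and L: "\<And>i x. \<bar>partial_deriv i u x\<bar> \<le> L" and e: "\<epsilon> > 0" and p: "p > 2"
  shows "poincare_bound p \<epsilon> u ((L + 1) * sqrt (real CARD('n) / \<epsilon>))"
  unfolding poincare_bound_def
proof (intro allI impI)
  fix c l :: "real^'n" assume "\<forall>i. l$i > 0"
  then have l: "\<And>i. l$i > 0" by simp
  define K where "K = (L + 1) * sqrt (real CARD('n) / \<epsilon>)"
  define F where "F = grad_energy \<epsilon> c l u"
  have v: "vol l > 0" using vol_pos[OF l] .
  have L0: "L \<ge> 0" using L[of undefined undefined] by linarith
  have FS: "\<epsilon> * (\<Sum>i\<in>UNIV. (l$i)\<^sup>2) * vol l \<le> F"
    unfolding F_def using grad_energy_eq[OF u l, of \<epsilon> c] grad_energy_nonneg[of c l u] by linarith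
  have F0: "F \<ge> 0"
    by (rule order_trans[OF _ FS]) (use e v in \<open>auto intro!: mult_nonneg_nonneg sum_nonneg\<close>)
  have "L * (\<Sum>i\<in>UNIV. l$i) \<le> K * sqrt (F / vol l)"
  proof -
    have "(\<Sum>i\<in>UNIV. l$i)\<^sup>2 \<le> (\<Sum>i\<in>UNIV. (l$i)\<^sup>2) * real CARD('n)"
      by (rule sum_squared_le_sum_of_squares)
    also have "\<dots> \<le> (F / (\<epsilon> * vol l)) * real CARD('n)"
      using FS v e by (intro mult_right_mono) (auto simp: field_simps)
    finally have "(\<Sum>i\<in>UNIV. l$i) \<le> sqrt (real CARD('n) / \<epsilon> * (F / vol l))"
      by (intro real_le_rsqrt) (simp add: field_simps)
    then have "L * (\<Sum>i\<in>UNIV. l$i) \<le> (L + 1) * sqrt (real CARD('n) / \<epsilon> * (F / vol l))"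
      using L0 sum_nonneg[of UNIV "\<lambda>i. l$i"] l by (intro mult_mono) (auto simp: less_imp_le)
    then show ?thesis by (simp only: K_def real_sqrt_mult mult.assoc)
  qed
  then have dev: "\<bar>u x - avg c l u\<bar> \<le> K * sqrt (F / vol l)" if "x \<in> hbox c l" for x
    using deviation_from_avg[OF u L l that] by linarith
  have cont: "continuous_on UNIV (\<lambda>x. \<bar>u x - avg c l u\<bar> powr p)"
    using p by (intro continuous_on_powr' continuous_intros Ck_imp_continuous[OF u]) auto
  have "(LINT x:hbox c l|lborel. \<bar>u x - avg c l u\<bar> powr p) \<le> (LINT x:hbox c l|lborel. (K * sqrt (F / vol l)) powr p)"
    using dev p by (intro set_integral_mono hbox_integrable cont continuous_intros) (auto intro!: powr_mono2)
  also have "\<dots> = (K * sqrt (F / vol l)) powr p * vol l"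
    using l by (simp add: set_integral_hbox_const less_imp_le)
  also have "\<dots> = (K * (vol l powr (1/p - 1/2) * sqrt F)) powr p"
  proof -
    have "(sqrt (F / vol l)) powr p * vol l = (vol l powr (1/p - 1/2) * sqrt F) powr p"
    proof -
      have "(vol l powr (1/p - 1/2)) powr p = vol l powr (1 - p/2)"
        unfolding powr_powr using p by (intro arg_cong2[where f="(powr)"]) (auto simp: field_simps)
      also have "\<dots> = vol l / vol l powr (p/2)" using v by (simp add: powr_diff)
      finally show ?thesis using v F0
        by (simp add: powr_mult powr_divide powr_powr real_sqrt_divide flip: powr_half_sqrt)
    qed
    then show ?thesis using L0 e v F0
      by (simp add: powr_mult K_def mult_ac)
  qed
  finally show "(LINT x:hbox c l|lborel. \<bar>u x - avg c l u\<bar> powr p) \<le> ((L + 1) * sqrt (real CARD('n) / \<epsilon>) * box_norm p \<epsilon> c l u) powr p"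
    by (simp add: K_def box_norm_def F_def)
qed

text \<open>
On a bisected box, \<open>u\<close> minus its mean is the sum of \<open>u\<close> minus its mean on the cell, where the assumed bound
applies and gains the factor \<open>2 powr - sobolev_gain\<close>, and of the jump between the two means, which
\<open>avg_cell_diff\<close> bounds by an absolute constant.
\<close>

lemma poincare_bound_step:
  fixes u :: "real^'n \<Rightarrow> real"
  assumes u: "Ck (Suc 0) u" and e: "\<epsilon> > 0" and p: "p > 2" and K: "poincare_bound p \<epsilon> u K" "K > 0"
  shows "poincare_bound p \<epsilon> u (sqrt (real CARD('n) * 2 ^ CARD('n) / 4) +
     2 powr - sobolev_gain CARD('n) p * K)"
  unfolding poincare_bound_def
proof (intro allI impI)
  fix c l :: "real^'n" assume "\<forall>i. l$i > 0"
  then have l: "\<And>i. l$i > 0" by simp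
  define C where "C = sqrt (real CARD('n) * 2 ^ CARD('n) / 4)"
  define \<theta> where "\<theta> = 2 powr - sobolev_gain CARD('n) p"
  define A where "A = box_norm p \<epsilon> c l u"
  define cc where "cc = cell c l 2"
  define l' where "l' = l /\<^sub>R real 2"
  define X where "X = \<theta> * K * A"
  define Y where "Y = C * A"
  have v: "vol l > 0" using vol_pos[OF l] .
  have l': "l'$i > 0" for i using l by (simp add: l'_def)
  have lsum: "(\<Sum>i\<in>UNIV. (l$i)\<^sup>2) > 0"
    using l by (intro sum_pos) (auto simp: zero_less_power2 dest: less_imp_neq[symmetric])
  have F0: "grad_energy 0 c l u \<ge> 0" by (rule grad_energy_nonneg)
  then have F: "grad_energy \<epsilon> c l u > 0" "grad_energy 0 c l u \<le> grad_energy \<epsilon> c l u"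
    unfolding grad_energy_eq[OF u l, of \<epsilon> c] using e lsum v by (auto intro!: add_nonneg_pos)
  then have A: "A > 0" using v by (simp add: A_def box_norm_def)
  have C: "C > 0" by (simp add: C_def)
  have XY: "X > 0" "Y > 0" using A C K(2) by (auto simp: X_def Y_def \<theta>_def)
  note cu = Ck_imp_continuous[OF u]
  have cont: "continuous_on UNIV (\<lambda>x. \<bar>u x - k\<bar> powr p)" for k
    using p by (intro continuous_on_powr' continuous_intros cu) auto
  have *: "(LINT x:hbox (cc m) l'|lborel. \<bar>u x - avg c l u\<bar> powr p)
      \<le> (X + Y) powr (p - 1) * (X powr (1 - p) * (LINT x:hbox (cc m) l'|lborel. \<bar>u x - avg (cc m) l' u\<bar> powr p)
           + Y powr (1 - p) * (Y powr p * vol l' / vol l))"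
    if m: "m \<in> cell_index 2" for m
  proof -
    define b where "b = avg (cc m) l' u"
    define d where "d = \<bar>b - avg c l u\<bar>"
    have "d \<le> Y / vol l powr (1/p)"
    proof -
      have "d \<le> C * sqrt (grad_energy 0 c l u / vol l)"
        using avg_cell_diff[OF u l m, of c] unfolding d_def b_def cc_def l'_def C_def grad_energy_def
        by (simp add: real_sqrt_mult real_sqrt_divide)
      also have "\<dots> \<le> C * sqrt (grad_energy \<epsilon> c l u / vol l)"
        using C F v by (intro mult_left_mono) (auto simp: divide_right_mono)
      also have "\<dots> = Y / vol l powr (1/p)"
        using v unfolding Y_def A_def box_norm_def
        by (simp add: powr_diff real_sqrt_divide flip: powr_half_sqrt)
      finally show ?thesis .
    qed
    then have dp: "d powr p \<le> Y powr p / vol l"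
    proof -
      assume "d \<le> Y / vol l powr (1/p)"
      then have "d powr p \<le> (Y / vol l powr (1/p)) powr p" using p by (intro powr_mono2) (auto simp: d_def)
      also have "\<dots> = Y powr p / vol l" using XY v p by (simp add: powr_divide powr_powr)
      finally show ?thesis .
    qed
    have "(LINT x:hbox (cc m) l'|lborel. \<bar>u x - avg c l u\<bar> powr p)
       \<le> (LINT x:hbox (cc m) l'|lborel. (X + Y) powr (p - 1) * (X powr (1 - p) * \<bar>u x - b\<bar> powr p + Y powr (1 - p) * (Y powr p / vol l)))"
    proof (intro set_integral_mono hbox_integrable cont continuous_intros)
      fix x
      have "\<bar>u x - avg c l u\<bar> powr p \<le> (\<bar>u x - b\<bar> + d) powr p"
        using p by (intro powr_mono2) (auto simp: d_def)
      also have "\<dots> \<le> (X + Y) powr (p - 1) * (\<bar>u x - b\<bar> powr p * X powr (1 - p) + d powr p * Y powr (1 - p))"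
        using p XY by (intro powr_add_le_split) (auto simp: d_def)
      also have "\<dots> \<le> (X + Y) powr (p - 1) * (\<bar>u x - b\<bar> powr p * X powr (1 - p) + Y powr p / vol l * Y powr (1 - p))"
        using dp by (intro mult_left_mono add_left_mono mult_right_mono) auto
      finally show "\<bar>u x - avg c l u\<bar> powr p \<le> (X + Y) powr (p - 1) * (X powr (1 - p) * \<bar>u x - b\<bar> powr p + Y powr (1 - p) * (Y powr p / vol l))"
        by (simp add: mult_ac)
    qed
    also have "\<dots> = (X + Y) powr (p - 1) * (X powr (1 - p) * (LINT x:hbox (cc m) l'|lborel. \<bar>u x - b\<bar> powr p)
           + Y powr (1 - p) * (Y powr p / vol l) * vol l')"
    proof -
      have 1: "set_integrable lborel (hbox (cc m) l') (\<lambda>x. X powr (1 - p) * \<bar>u x - b\<bar> powr p)"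
        "set_integrable lborel (hbox (cc m) l') (\<lambda>x. Y powr (1 - p) * (Y powr p / vol l))"
        by (intro hbox_integrable continuous_intros cont)+
      show ?thesis using set_integral_add(2)[OF 1] l'
        by (simp add: set_integral_hbox_const less_imp_le)
    qed
    finally show ?thesis unfolding b_def by (simp add: mult_ac)
  qed
  have "(LINT x:hbox c l|lborel. \<bar>u x - avg c l u\<bar> powr p) =
     (\<Sum>m\<in>cell_index 2. LINT x:hbox (cc m) l'|lborel. \<bar>u x - avg c l u\<bar> powr p)"
    unfolding cc_def l'_def by (rule set_integral_cells) (auto intro: l cont)
  also have "\<dots> \<le> (\<Sum>m\<in>cell_index 2. (X + Y) powr (p - 1) * (X powr (1 - p) * (LINT x:hbox (cc m) l'|lborel. \<bar>u x - avg (cc m) l' u\<bar> powr p)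
           + Y powr (1 - p) * (Y powr p * vol l' / vol l)))"
    by (rule sum_mono[OF *])
  also have "\<dots> = (X + Y) powr (p - 1) * (X powr (1 - p) * (\<Sum>m\<in>cell_index 2. LINT x:hbox (cc m) l'|lborel. \<bar>u x - avg (cc m) l' u\<bar> powr p)
           + Y powr (1 - p) * Y powr p)"
  proof -
    have "2 ^ CARD('n) * (vol l' / vol l) = 1" unfolding l'_def vol_scale using v by simp
    then have "2 ^ CARD('n) * (Y powr (1 - p) * (Y powr p * vol l' / vol l)) = Y powr (1 - p) * Y powr p"
      by (metis (no_types, lifting) mult.commute mult.left_commute mult_1 times_divide_eq_right)
    then show ?thesis
      by (simp add: sum.distrib card_cell_index flip: sum_distrib_left)
  qed
  also have "\<dots> \<le> (X + Y) powr (p - 1) * (X powr (1 - p) * X powr p + Y powr (1 - p) * Y powr p)"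
  proof (intro mult_left_mono add_right_mono)
    have "(\<Sum>m\<in>cell_index 2. LINT x:hbox (cc m) l'|lborel. \<bar>u x - avg (cc m) l' u\<bar> powr p) \<le>
       (\<Sum>m\<in>cell_index 2. (K * box_norm p \<epsilon> (cc m) l' u) powr p)"
      using K(1) l' unfolding poincare_bound_def by (intro sum_mono) auto
    also have "\<dots> = K powr p * (\<Sum>m\<in>cell_index 2. box_norm p \<epsilon> (cc m) l' u powr p)"
      using K(2) by (simp add: powr_mult sum_distrib_left box_norm_def)
    also have "\<dots> \<le> K powr p * (\<theta> * A) powr p"
      using sum_box_norm_cells[OF u l, of p 2 \<epsilon> c] p e K(2)
      unfolding cc_def l'_def \<theta>_def A_def by (intro mult_left_mono) auto
    also have "\<dots> = X powr p" using K(2) A by (simp add: X_def powr_mult \<theta>_def mult_ac)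
    finally show "(\<Sum>m\<in>cell_index 2. LINT x:hbox (cc m) l'|lborel. \<bar>u x - avg (cc m) l' u\<bar> powr p) \<le> X powr p" .
  qed auto
  also have "\<dots> = (X + Y) powr p"
    using powr_split_identity[OF XY, of p] by (simp add: mult.commute)
  finally show "(LINT x:hbox c l|lborel. \<bar>u x - avg c l u\<bar> powr p)
    \<le> ((sqrt (real CARD('n) * 2 ^ CARD('n) / 4) + 2 powr - sobolev_gain CARD('n) p * K) * box_norm p \<epsilon> c l u) powr p"
    unfolding X_def Y_def A_def C_def \<theta>_def by (simp add: algebra_simps)
qed

text \<open>
If \<open>K\<close> is admissible, so is \<open>C + \<theta> K\<close> with \<open>\<theta> < 1\<close>; hence the infimum of the admissible constants is at most
\<open>C / (1 - \<theta>)\<close>. The factor 2 in the statement leaves room for an admissible constant above the infimum.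
\<close>

lemma poincare_bound_uniform:
  fixes u :: "real^'n \<Rightarrow> real"
  assumes u: "Ck (Suc 0) u" and L: "\<And>i x. \<bar>partial_deriv i u x\<bar> \<le> L" and e: "\<epsilon> > 0" and p: "p > 2"
    and \<delta>: "sobolev_gain CARD('n) p > 0"
  shows "poincare_bound p \<epsilon> u (2 * sqrt (real CARD('n) * 2 ^ CARD('n) / 4) /
     (1 - 2 powr - sobolev_gain CARD('n) p))"
proof -
  define C where "C = sqrt (real CARD('n) * 2 ^ CARD('n) / 4)"
  define \<theta> where "\<theta> = 2 powr - sobolev_gain CARD('n) p"
  have C: "C > 0" by (simp add: C_def)
  have "\<theta> < 2 powr 0" unfolding \<theta>_def using \<delta> by (intro powr_less_mono) auto
  then have th: "0 < \<theta>" "\<theta> < 1" by (auto simp: \<theta>_def)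
  define \<K> where "\<K> = {K. K > 0 \<and> poincare_bound p \<epsilon> u K}"
  have L0: "L \<ge> 0" using L[of undefined undefined] by linarith
  then have "(L + 1) * sqrt (real CARD('n) / \<epsilon>) \<in> \<K>"
    using poincare_bound_apriori[OF u L e p] e by (auto simp: \<K>_def)
  then have ne: "\<K> \<noteq> {}" by blast
  have step: "C + \<theta> * K \<in> \<K>" if "K \<in> \<K>" for K
    using poincare_bound_step[OF u e p, of K] that C th by (auto simp: \<K>_def C_def \<theta>_def add_pos_pos)
  have bdd: "bdd_below \<K>" by (rule bdd_belowI[of _ 0]) (auto simp: \<K>_def)
  \<comment> \<open>The best constant; \<open>step\<close> passes to the infimum.\<close>
  define M where "M = Inf \<K>"
  have "M \<le> C + \<theta> * M"
  proof (rule field_le_epsilon)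
    fix \<eta> :: real assume "\<eta> > 0"
    then obtain K where K: "K \<in> \<K>" "K < M + \<eta>"
      using cInf_lessD[OF ne, of "M + \<eta>"] by (auto simp: M_def)
    have "M \<le> C + \<theta> * K" unfolding M_def by (rule cInf_lower[OF step[OF K(1)] bdd])
    also have "\<dots> \<le> C + \<theta> * (M + \<eta>)" using K th by simp
    also have "\<dots> \<le> C + \<theta> * M + \<eta>" using th \<open>\<eta> > 0\<close> by (simp add: algebra_simps)
    finally show "M \<le> C + \<theta> * M + \<eta>" .
  qed
  then have "M \<le> C / (1 - \<theta>)" using th by (simp add: field_simps)
  also have "\<dots> < 2 * C / (1 - \<theta>)" using C th by (simp add: field_simps)
  finally obtain K where K: "K \<in> \<K>" "K < 2 * C / (1 - \<theta>)"
    using cInf_lessD[OF ne] by (auto simp: M_def)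
  have "poincare_bound p \<epsilon> u (2 * C / (1 - \<theta>))"
    unfolding poincare_bound_def
  proof (intro allI impI)
    fix c l :: "real^'n" assume l: "\<forall>i. l$i > 0"
    have "box_norm p \<epsilon> c l u \<ge> 0"
    proof -
      have "grad_energy \<epsilon> c l u \<ge> 0" unfolding grad_energy_def
        using e by (intro hbox_integral_nonneg add_nonneg_nonneg grad_sq_nonneg mult_nonneg_nonneg sum_nonneg) auto
      then show ?thesis by (simp add: box_norm_def)
    qed
    then have "(K * box_norm p \<epsilon> c l u) powr p \<le> (2 * C / (1 - \<theta>) * box_norm p \<epsilon> c l u) powr p"
      using K p by (intro powr_mono2 mult_right_mono mult_nonneg_nonneg) (auto simp: \<K>_def)
    moreover have "(LINT x:hbox c l|lborel. \<bar>u x - avg c l u\<bar> powr p) \<le> (K * box_norm p \<epsilon> c l u) powr p"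
      using K(1) l unfolding \<K>_def poincare_bound_def by blast
    ultimately show "(LINT x:hbox c l|lborel. \<bar>u x - avg c l u\<bar> powr p) \<le> (2 * C / (1 - \<theta>) * box_norm p \<epsilon> c l u) powr p"
      by linarith
  qed
  then show ?thesis by (simp add: C_def \<theta>_def)
qed

theorem poincare_sobolev_box:
  fixes u :: "real^'n \<Rightarrow> real"
  assumes u: "Ck (Suc 0) u" and L: "\<And>i x. \<bar>partial_deriv i u x\<bar> \<le> L" and p: "p > 2"
    and \<delta>: "sobolev_gain CARD('n) p > 0"
  shows "poincare_bound p 0 u (2 * sqrt (real CARD('n) * 2 ^ CARD('n) / 4) /
     (1 - 2 powr - sobolev_gain CARD('n) p))" (is "poincare_bound p 0 u ?K")
  unfolding poincare_bound_def
proof (intro allI impI)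
  fix c l :: "real^'n" assume "\<forall>i. l$i > 0"
  then have l: "\<And>i. l$i > 0" by simp
  define S where "S = (\<Sum>i\<in>UNIV. (l$i)\<^sup>2) * vol l"
  have S: "S \<ge> 0" using vol_pos[OF l] by (auto simp: S_def sum_nonneg)
  have th: "?K \<ge> 0"
  proof -
    have "2 powr - sobolev_gain CARD('n) p < 2 powr 0"
      using \<delta> by (intro powr_less_mono) auto
    then show ?thesis by simp
  qed
  have "((\<lambda>\<epsilon>. (?K * (vol l powr (1/p - 1/2) * sqrt (grad_energy 0 c l u + \<epsilon> * S))) powr p) \<longlongrightarrow>
     (?K * (vol l powr (1/p - 1/2) * sqrt (grad_energy 0 c l u + 0 * S))) powr p) (at_right 0)"
  proof (intro tendsto_powr2 tendsto_mult_left tendsto_real_sqrt tendsto_const tendsto_add tendsto_mult_right tendsto_ident_at)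
    show "\<forall>\<^sub>F \<epsilon> in at_right 0. 0 \<le> ?K * (vol l powr (1/p - 1/2) * sqrt (grad_energy 0 c l u + \<epsilon> * S))"
      using S grad_energy_nonneg[of c l u]
      by (intro eventually_at_rightI[of 0 1] mult_nonneg_nonneg[OF th]) auto
  qed (use p in auto)
  moreover have "\<forall>\<^sub>F \<epsilon> in at_right 0. (LINT x:hbox c l|lborel. \<bar>u x - avg c l u\<bar> powr p)
     \<le> (?K * (vol l powr (1/p - 1/2) * sqrt (grad_energy 0 c l u + \<epsilon> * S))) powr p"
  proof (rule eventually_at_rightI[of 0 1])
    fix \<epsilon> :: real assume "\<epsilon> \<in> {0<..<1}"
    then have "\<epsilon> > 0" by simp
    from poincare_bound_uniform[OF u L this p \<delta>] l
    have "(LINT x:hbox c l|lborel. \<bar>u x - avg c l u\<bar> powr p) \<le> (?K * box_norm p \<epsilon> c l u) powr p"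
      unfolding poincare_bound_def by blast
    then show "(LINT x:hbox c l|lborel. \<bar>u x - avg c l u\<bar> powr p)
     \<le> (?K * (vol l powr (1/p - 1/2) * sqrt (grad_energy 0 c l u + \<epsilon> * S))) powr p"
      unfolding box_norm_def grad_energy_eq[OF u l, of \<epsilon> c] by (simp add: S_def mult_ac)
  qed auto
  ultimately show "(LINT x:hbox c l|lborel. \<bar>u x - avg c l u\<bar> powr p) \<le> (?K * box_norm p 0 c l u) powr p"
    unfolding box_norm_def by (intro tendsto_lowerbound) auto
qed

text \<open>
From here on \<open>Ck (Suc 0)\<close> is treated as an opaque predicate; unfolding it would lose the lemmas above.
\<close>

declare Ck.simps(2) [simp del]

section \<open>Compactly supported functions\<close>

abbreviation supp :: "(real^'n \<Rightarrow> real) \<Rightarrow> (real^'n) set" where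
  "supp f \<equiv> closure {x. f x \<noteq> 0}"

lemma Cck1_iff: "f \<in> Cck 1 W \<longleftrightarrow> Ck (Suc 0) f \<and> compact (supp f) \<and> supp f \<subseteq> W"
  unfolding Cck_def One_nat_def by simp

lemma Cck1_D:
  assumes "f \<in> Cck 1 W"
  shows "Ck (Suc 0) f" "compact (supp f)" "supp f \<subseteq> W"
    "continuous_on UNIV f" "continuous_on UNIV (partial_deriv i f)"
    "\<And>x. (f has_derivative (\<lambda>h. \<Sum>i\<in>UNIV. h$i * partial_deriv i f x)) (at x)"
  using assms Ck_imp_continuous[of "Suc 0" f] Ck1_partial_continuous[of f i] Ck1_has_derivative[of f]
  unfolding Cck1_iff by auto

lemma Cck1_I:
  assumes "Ck (Suc 0) f" "compact K" "K \<subseteq> W" "\<And>x. x \<notin> K \<Longrightarrow> f x = 0"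
  shows "f \<in> Cck 1 W"
proof -
  have "supp f \<subseteq> K"
    using assms(2,4) by (intro closure_minimal compact_imp_closed) auto
  moreover from this have "compact (supp f)"
    using assms(2) by (meson bounded_subset closed_closure compact_eq_bounded_closed)
  ultimately show ?thesis using assms unfolding Cck1_iff by blast
qed

lemma has_derivative_zero_off_support:
  fixes f :: "real^'n \<Rightarrow> real"
  assumes "x \<notin> supp f"
  shows "(f has_derivative (\<lambda>_. 0)) (at x)"
proof (rule has_derivative_transform_within_open[where f="\<lambda>_. 0" and s="- supp f"])
  show "\<And>y. y \<in> - supp f \<Longrightarrow> 0 = f y"
    using closure_subset[of "{x. f x \<noteq> 0}"] by auto
qed (use assms in auto)

lemma zero_off_support:
  fixes f :: "real^'n \<Rightarrow> real"
  assumes "x \<notin> supp f"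
  shows "f x = 0" "partial_deriv i f x = 0"
proof -
  show "f x = 0" using assms closure_subset[of "{x. f x \<noteq> 0}"] by blast
  show "partial_deriv i f x = 0"
    using partial_deriv_eq[OF has_derivative_zero_off_support[OF assms]] .
qed

lemma sum_axis: "(\<Sum>j\<in>UNIV. (axis i 1 :: real^'n)$j * F j) = F i"
  by (simp add: axis_def if_distrib[of "\<lambda>x. x * _"] cong: if_cong)

lemma Ck1_lincomb:
  fixes f g :: "real^'n \<Rightarrow> real"
  assumes "Ck (Suc 0) f" "Ck (Suc 0) g"
  shows "Ck (Suc 0) (\<lambda>x. \<alpha> * f x + \<beta> * g x)"
    "partial_deriv i (\<lambda>x. \<alpha> * f x + \<beta> * g x) = (\<lambda>x. \<alpha> * partial_deriv i f x + \<beta> * partial_deriv i g x)"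
proof -
  have D: "((\<lambda>x. \<alpha> * f x + \<beta> * g x) has_derivative (\<lambda>h. \<alpha> * (\<Sum>i\<in>UNIV. h$i * partial_deriv i f x) + \<beta> * (\<Sum>i\<in>UNIV. h$i * partial_deriv i g x))) (at x)" for x
    using assms by (intro derivative_intros Ck1_has_derivative)
  note c = Ck1_partial_continuous[OF assms(1)] Ck1_partial_continuous[OF assms(2)]
  have cont: "continuous_on UNIV (\<lambda>x. \<alpha> * partial_deriv i f x + \<beta> * partial_deriv i g x)" for i
    by (intro continuous_intros c)
  show "Ck (Suc 0) (\<lambda>x. \<alpha> * f x + \<beta> * g x)"
    "partial_deriv i (\<lambda>x. \<alpha> * f x + \<beta> * g x) = (\<lambda>x. \<alpha> * partial_deriv i f x + \<beta> * partial_deriv i g x)"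
    using Ck1I[OF D] cont unfolding sum_axis by blast+
qed

lemma Cck1_lincomb:
  assumes "f \<in> Cck 1 W" "g \<in> Cck 1 W"
  shows "(\<lambda>x. \<alpha> * f x + \<beta> * g x) \<in> Cck 1 W"
proof (rule Cck1_I)
  show "Ck (Suc 0) (\<lambda>x. \<alpha> * f x + \<beta> * g x)"
    using Ck1_lincomb(1) assms Cck1_D(1) by blast
  show "compact (supp f \<union> supp g)"
    using assms Cck1_D(2) by (intro compact_Un)
  show "supp f \<union> supp g \<subseteq> W"
    using assms Cck1_D(3) by blast
  show "\<alpha> * f x + \<beta> * g x = 0" if "x \<notin> supp f \<union> supp g" for x
  proof -
    have "f x = 0" "g x = 0" using that zero_off_support(1)[of x f] zero_off_support(1)[of x g] by blast+
    then show ?thesis by simp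
  qed
qed

lemma Cck1_bounded_partials:
  fixes f :: "real^'n \<Rightarrow> real"
  assumes "f \<in> Cck 1 W"
  obtains L where "\<And>i x. \<bar>partial_deriv i f x\<bar> \<le> L"
proof -
  define K where "K = supp f"
  have "\<exists>L. \<forall>x. \<bar>partial_deriv i f x\<bar> \<le> L" for i
  proof -
    have "compact (partial_deriv i f ` K)"
      using Cck1_D(2,5)[OF assms] unfolding K_def
      by (intro compact_continuous_image) (auto intro: continuous_on_subset)
    then obtain L where L: "\<And>x. x \<in> K \<Longrightarrow> \<bar>partial_deriv i f x\<bar> \<le> L"
      using compact_imp_bounded bounded_iff by (metis image_eqI real_norm_def)
    have "\<bar>partial_deriv i f x\<bar> \<le> max L 0" for x
    proof (cases "x \<in> K")
      case True
      then show ?thesis using L[of x] by simp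
    next
      case False
      then show ?thesis using zero_off_support(2)[of x f i] unfolding K_def by simp
    qed
    then show ?thesis by blast
  qed
  then obtain L where L: "\<And>i x. \<bar>partial_deriv i f x\<bar> \<le> L i" by metis
  have "\<bar>partial_deriv i f x\<bar> \<le> (\<Sum>i\<in>UNIV. \<bar>L i\<bar>)" for i x
    using L[of i x] member_le_sum[of i UNIV "\<lambda>i. \<bar>L i\<bar>"] by auto
  then show thesis using that by blast
qed

lemma compact_support_integrable:
  fixes g :: "real^'n \<Rightarrow> real"
  assumes "continuous_on UNIV g" "compact K" "\<And>x. x \<notin> K \<Longrightarrow> g x = 0"
  shows "integrable lborel g"
proof -
  have "set_integrable lborel K g"
    using assms by (intro continuous_set_integrable) (auto simp: compact_imp_bounded compact_imp_closed)
  moreover have "(\<lambda>x. indicat_real K x *\<^sub>R g x) = g"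
    using assms(3) by (auto simp: indicator_def fun_eq_iff)
  ultimately show ?thesis by (simp add: set_integrable_def)
qed

lemma integral_cbox_of_support:
  fixes g :: "real^'n \<Rightarrow> real"
  assumes "continuous_on UNIV g" "\<And>x. x \<notin> cbox c d \<Longrightarrow> g x = 0"
  shows "integral (cbox c d) g = (\<integral>x. g x \<partial>lborel)"
proof -
  have "set_integrable lborel (cbox c d) g"
    using assms by (intro continuous_set_integrable) auto
  then have "(LINT x:cbox c d|lborel. g x) = integral (cbox c d) g"
    by (rule set_borel_integral_eq_integral(2))
  moreover have "(\<lambda>x. indicat_real (cbox c d) x *\<^sub>R g x) = g"
    using assms(2) by (auto simp: indicator_def fun_eq_iff)
  ultimately show ?thesis by (simp add: set_lebesgue_integral_def)
qed

lemma lborel_integral_translate: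
  fixes g :: "real^'n \<Rightarrow> real"
  assumes [measurable]: "g \<in> borel_measurable borel"
  shows "(\<integral>x. g (x + v) \<partial>lborel) = (\<integral>x. g x \<partial>lborel)"
proof -
  have "(\<integral>x. g x \<partial>lborel) = (\<integral>x. g x \<partial>(distr lborel borel ((+) v)))"
    by (simp add: lborel_distr_plus)
  also have "\<dots> = (\<integral>x. g (v + x) \<partial>lborel)" by (subst integral_distr) auto
  finally show ?thesis by (simp add: add.commute)
qed

text \<open>
The box is larger than the support by 1 in every direction, so a translation by at most 1 does not change
the integral over the box.
\<close>

lemma integral_partial_deriv_zero:
  fixes w :: "real^'n \<Rightarrow> real"
  assumes w: "w \<in> Cck 1 W"
  shows "(\<integral>x. partial_deriv i w x \<partial>lborel) = 0"
proof -
  define K where "K = supp w"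
  obtain d where d: "K \<subseteq> cbox (-d) d"
    using bounded_subset_cbox_symmetric compact_imp_bounded Cck1_D(2)[OF w] unfolding K_def by blast
  define v :: "real^'n" where "v = axis i 1"
  define c' where "c' = -d - 1"
  define d' where "d' = d + 1"
  have out: "x + t *\<^sub>R v \<notin> K" if "x \<notin> cbox c' d'" "0 \<le> t" "t \<le> 1" for x t
  proof
    assume "x + t *\<^sub>R v \<in> K"
    then have "x + t *\<^sub>R v \<in> cbox (-d) d" using d by blast
    then have 1: "- d$j \<le> x$j + (t *\<^sub>R v)$j" "x$j + (t *\<^sub>R v)$j \<le> d$j" for j
      by (auto simp: mem_box_cart)
    have 2: "0 \<le> (t *\<^sub>R v)$j" "(t *\<^sub>R v)$j \<le> 1" for j
      using that by (auto simp: v_def axis_def)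
    have "c'$j \<le> x$j" "x$j \<le> d'$j" for j
      using 1[of j] 2[of j] unfolding c'_def d'_def by simp_all
    then have "x \<in> cbox c' d'" by (simp add: mem_box_cart)
    with that show False by blast
  qed
  obtain \<xi> where \<xi>: "0 < \<xi>" "\<xi> < 1" and
    mvt: "integral (cbox c' d') (\<lambda>x. w (x + v)) - integral (cbox c' d') w
       = integral (cbox c' d') (\<lambda>x. \<Sum>i\<in>UNIV. v$i * partial_deriv i w (x + \<xi> *\<^sub>R v))"
    using integral_translate_mvt[OF Cck1_D(1)[OF w], of c' d' v] by auto
  have [measurable]: "w \<in> borel_measurable borel" "partial_deriv i w \<in> borel_measurable borel"
    using Cck1_D(4,5)[OF w] borel_measurable_continuous_onI by auto
  have "integral (cbox c' d') (\<lambda>x. w (x + v)) = (\<integral>x. w (x + v) \<partial>lborel)"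
  proof (rule integral_cbox_of_support)
    show "continuous_on UNIV (\<lambda>x. w (x + v))"
      by (intro continuous_on_compose2[OF Cck1_D(4)[OF w]] continuous_intros) auto
    show "w (x + v) = 0" if "x \<notin> cbox c' d'" for x
      using out[OF that, of 1] zero_off_support(1)[of "x + v" w] unfolding K_def by simp
  qed
  moreover have "integral (cbox c' d') w = (\<integral>x. w x \<partial>lborel)"
  proof (rule integral_cbox_of_support[OF Cck1_D(4)[OF w]])
    show "w x = 0" if "x \<notin> cbox c' d'" for x
      using out[OF that, of 0] zero_off_support(1)[of x w] unfolding K_def by simp
  qed
  moreover have "integral (cbox c' d') (\<lambda>x. partial_deriv i w (x + \<xi> *\<^sub>R v)) = (\<integral>x. partial_deriv i w (x + \<xi> *\<^sub>R v) \<partial>lborel)"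
  proof (rule integral_cbox_of_support)
    show "continuous_on UNIV (\<lambda>x. partial_deriv i w (x + \<xi> *\<^sub>R v))"
      by (intro continuous_on_compose2[OF Cck1_D(5)[OF w]] continuous_intros) auto
    show "partial_deriv i w (x + \<xi> *\<^sub>R v) = 0" if "x \<notin> cbox c' d'" for x
      using out[OF that, of \<xi>] \<xi> zero_off_support(2)[of "x + \<xi> *\<^sub>R v" w] unfolding K_def by simp
  qed
  moreover have "(\<lambda>x. \<Sum>i\<in>UNIV. v$i * partial_deriv i w (x + \<xi> *\<^sub>R v)) = (\<lambda>x. partial_deriv i w (x + \<xi> *\<^sub>R v))"
    unfolding v_def sum_axis ..
  ultimately show ?thesis
    using mvt lborel_integral_translate[of w v] lborel_integral_translate[of "partial_deriv i w" "\<xi> *\<^sub>R v"] by simp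
qed

text \<open>
On the boundary hyperplane the quotient is 0 by the convention for division by 0, in accordance with
the values of \<open>f\<close> nearby.
\<close>

lemma continuous_on_UNIV_divide_support:
  fixes f :: "real^'n \<Rightarrow> real"
  assumes f: "continuous_on UNIV f" and K: "closed K" "\<And>x. x \<in> K \<Longrightarrow> x$a > 0" "\<And>x. x \<notin> K \<Longrightarrow> f x = 0"
  shows "continuous_on UNIV (\<lambda>x. f x / x$a)"
proof -
  have "continuous_on {x. x$a > 0} (\<lambda>x. f x / x$a)"
    by (intro continuous_intros continuous_on_subset[OF f]) auto
  moreover have "continuous_on (-K) (\<lambda>x. f x / x$a)"
    using K(3) by (subst continuous_on_cong[OF refl, where g="\<lambda>_. 0"]) auto
  ultimately have "continuous_on ({x. x$a > 0} \<union> -K) (\<lambda>x. f x / x$a)"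
    using K(1) by (intro continuous_on_open_Un) (auto intro!: open_Collect_less continuous_intros)
  moreover have "{x. x$a > 0} \<union> -K = UNIV" using K(2) by auto
  ultimately show ?thesis by simp
qed

text \<open>
Integrate the derivative of \<open>u\<^sup>2 / x$a\<close> in direction \<open>a\<close>, which is \<open>2 q \<partial>\<^sub>a u - q\<^sup>2\<close> with \<open>q = u / x$a\<close>, and
complete the square.
\<close>

lemma hardy:
  fixes u :: "real^'n \<Rightarrow> real"
  assumes u: "u \<in> Cck 1 (half_space a)"
  shows "integrable lborel (\<lambda>x. (u x / x$a)\<^sup>2)" "integrable lborel (\<lambda>x. (partial_deriv a u x)\<^sup>2)"
    "(\<integral>x. (u x / x$a)\<^sup>2 \<partial>lborel) \<le> 4 * (\<integral>x. (partial_deriv a u x)\<^sup>2 \<partial>lborel)"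
proof -
  define K where "K = supp u"
  have K: "compact K" "closed K" "\<And>x. x \<in> K \<Longrightarrow> x$a > 0" "\<And>x. x \<notin> K \<Longrightarrow> u x = 0"
    using Cck1_D(2,3)[OF u] zero_off_support(1)[of _ u] unfolding K_def half_space_def by blast+
  note cu = Cck1_D(4)[OF u] and cp = Cck1_D(5)[OF u]
  define q where "q x = u x / x$a" for x
  have cq: "continuous_on UNIV q"
    unfolding q_def by (rule continuous_on_UNIV_divide_support[OF cu K(2-4)])
  \<comment> \<open>Off the support this is 0, in particular near the hyperplane \<open>x$a = 0\<close>.\<close>
  define w where "w x = (u x)\<^sup>2 / x$a" for x
  define D where "D x h = 2 * q x * (\<Sum>i\<in>UNIV. h$i * partial_deriv i u x) - (q x)\<^sup>2 * h$a" for x h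
  have D: "(w has_derivative D x) (at x)" for x
  proof (cases "x \<in> K")
    case True
    then have xa: "x$a > 0" using K by blast
    have 1: "((\<lambda>x. (u x)\<^sup>2) has_derivative (\<lambda>h. 2 * u x * (\<Sum>i\<in>UNIV. h$i * partial_deriv i u x))) (at x)"
      using has_derivative_power[OF Cck1_D(6)[OF u], of 2] by (simp add: mult_ac)
    have 2: "((\<lambda>x. x$a) has_derivative (\<lambda>h. h$a)) (at x)"
      by (intro bounded_linear_imp_has_derivative bounded_linear_vec_nth)
    have "((\<lambda>x. (u x)\<^sup>2 / x$a) has_derivative
       (\<lambda>h. (2 * u x * (\<Sum>i\<in>UNIV. h$i * partial_deriv i u x) * x$a - (u x)\<^sup>2 * h$a) / (x$a * x$a))) (at x)"
      using has_derivative_divide'[OF 1 2] xa by simp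
    moreover have "(\<lambda>h. (2 * u x * (\<Sum>i\<in>UNIV. h$i * partial_deriv i u x) * x$a - (u x)\<^sup>2 * h$a) / (x$a * x$a)) = D x"
      using xa by (auto simp: D_def q_def diff_divide_distrib power2_eq_square)
    ultimately show ?thesis unfolding w_def by simp
  next
    case False
    have "(w has_derivative (\<lambda>_. 0)) (at x)"
      by (rule has_derivative_transform_within_open[where f="\<lambda>_. 0" and s="- K"])
         (use False K in \<open>auto simp: w_def\<close>)
    moreover have "D x = (\<lambda>_. 0)" using K(4)[OF False] by (auto simp: D_def q_def)
    ultimately show ?thesis by simp
  qed
  have cD: "continuous_on UNIV (\<lambda>x. D x (axis i 1))" for i
    unfolding D_def sum_axis by (intro continuous_intros cq cp)
  have w: "Ck (Suc 0) w" "partial_deriv a w = (\<lambda>x. D x (axis a 1))"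
    by (rule Ck1I[OF D cD])+
  have "w \<in> Cck 1 UNIV"
    by (rule Cck1_I[OF w(1) K(1)]) (auto simp: w_def K(4))
  then have "(\<integral>x. D x (axis a 1) \<partial>lborel) = 0"
    using integral_partial_deriv_zero[of w UNIV a] unfolding w(2) by blast
  moreover have "D x (axis a 1) = 2 * q x * partial_deriv a u x - (q x)\<^sup>2" for x
    unfolding D_def sum_axis by (simp add: axis_def)
  ultimately have z: "(\<integral>x. 2 * q x * partial_deriv a u x - (q x)\<^sup>2 \<partial>lborel) = 0" by simp
  have q0: "q x = 0" if "x \<notin> K" for x using K(4)[OF that] by (simp add: q_def)
  have p0: "partial_deriv a u x = 0" if "x \<notin> K" for x
    using that zero_off_support(2)[of x u] unfolding K_def by blast
  have i1: "integrable lborel (\<lambda>x. (q x)\<^sup>2)"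
    by (rule compact_support_integrable[OF _ K(1)], intro continuous_intros cq) (simp add: q0)
  then show "integrable lborel (\<lambda>x. (u x / x$a)\<^sup>2)" by (simp add: q_def)
  show i2: "integrable lborel (\<lambda>x. (partial_deriv a u x)\<^sup>2)"
    by (rule compact_support_integrable[OF _ K(1)], intro continuous_intros cp) (simp add: p0)
  have i3: "integrable lborel (\<lambda>x. 2 * q x * partial_deriv a u x - (q x)\<^sup>2)"
    by (rule compact_support_integrable[OF _ K(1)], intro continuous_intros cq cp) (simp add: q0)
  have "(\<integral>x. (q x)\<^sup>2 \<partial>lborel) =
     (\<integral>x. (q x)\<^sup>2 + 2 * (2 * q x * partial_deriv a u x - (q x)\<^sup>2) \<partial>lborel)"
    using Bochner_Integration.integral_add[OF i1 integrable_mult_right[OF i3, of 2]] z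
    by (simp only: integral_mult_right_zero)
  also have "\<dots> \<le> (\<integral>x. 4 * (partial_deriv a u x)\<^sup>2 \<partial>lborel)"
  proof (rule integral_mono)
    show "(q x)\<^sup>2 + 2 * (2 * q x * partial_deriv a u x - (q x)\<^sup>2) \<le> 4 * (partial_deriv a u x)\<^sup>2" for x
      using zero_le_power2[of "q x - 2 * partial_deriv a u x"] by (simp add: power2_eq_square algebra_simps)
  qed (intro Bochner_Integration.integrable_add integrable_mult_right i1 i2 i3)+
  finally show "(\<integral>x. (u x / x$a)\<^sup>2 \<partial>lborel) \<le> 4 * (\<integral>x. (partial_deriv a u x)\<^sup>2 \<partial>lborel)"
    unfolding q_def by simp
qed

section \<open>The degenerate energy\<close>

locale degenerate_energy =
  fixes a b :: "'n::finite" and s :: real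
  assumes ab: "a \<noteq> b" and s_pos: "s > 0"
begin

text \<open>
The homogeneous dimension, that is the exponent with which the dilations scale volumes.
\<close>

definition hdim :: real where "hdim = real CARD('n) + s / 2"

definition p :: real where "p = crit_exponent CARD('n) s"

text \<open>
The truncation at 0 makes the weights continuous on the whole space; all functions to which they are applied
vanish off the half space.
\<close>

definition weight :: "'n \<Rightarrow> real^'n \<Rightarrow> real" where
  "weight i x = (if i = b then (max 0 (x$a)) powr s else 1)"

definition dens :: "(real^'n \<Rightarrow> real) \<Rightarrow> real^'n \<Rightarrow> real" where
  "dens u x = (\<Sum>i\<in>UNIV. weight i x * (partial_deriv i u x)\<^sup>2)"

definition en :: "(real^'n \<Rightarrow> real) \<Rightarrow> real" where
  "en u = (\<integral>x. dens u x \<partial>lborel)"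

definition mass :: "(real^'n \<Rightarrow> real) \<Rightarrow> real" where
  "mass u = (\<integral>x. \<bar>u x\<bar> powr p \<partial>lborel)"

abbreviation "HS \<equiv> half_space a"
abbreviation "C1H \<equiv> Cck 1 (half_space a)"

lemma card_ge_2: "CARD('n) \<ge> 2"
proof -
  have "card {a, b} \<le> CARD('n)" by (rule card_mono) auto
  then show ?thesis using ab by simp
qed

lemma hdim_gt_2: "hdim > 2"
  using card_ge_2 s_pos by (simp add: hdim_def)

lemma p_eq: "p = 2 * hdim / (hdim - 2)"
  unfolding p_def crit_exponent_def hdim_def using hdim_gt_2[unfolded hdim_def] by (simp add: field_simps)

lemma p_gt_2: "p > 2"
  unfolding p_eq using hdim_gt_2 by (simp add: field_simps)

lemma hdim_inverse: "1 / p - 1 / 2 = - (1 / hdim)"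
  unfolding p_eq using hdim_gt_2 by (simp add: field_simps)

text \<open>
The decisive inequality: the gain is \<open>1 - N / hdim\<close>, and \<open>hdim\<close> exceeds \<open>N\<close> by \<open>s/2\<close>.
\<close>

lemma subcritical: "sobolev_gain CARD('n) p > 0"
proof -
  have "1 - real CARD('n) / 2 + real CARD('n) / p = 1 + real CARD('n) * (1 / p - 1 / 2)"
    by (simp add: algebra_simps)
  also have "\<dots> = (s / 2) / hdim" unfolding hdim_inverse using hdim_gt_2
    by (simp add: field_simps hdim_def)
  finally show ?thesis using hdim_gt_2 s_pos by simp
qed

lemma weight_nonneg: "weight i x \<ge> 0" by (simp add: weight_def)

lemma weight_pos: "x \<in> HS \<Longrightarrow> weight i x > 0"
  by (simp add: weight_def half_space_def)

lemma weight_a [simp]: "weight a x = 1" using ab by (simp add: weight_def)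

lemma continuous_weight: "continuous_on UNIV (weight i)"
proof (cases "i = b")
  case True
  have "continuous_on UNIV (\<lambda>x::real^'n. (max 0 (x$a)) powr s)"
    using s_pos by (intro continuous_on_powr' continuous_on_max continuous_intros) auto
  then show ?thesis using True by (simp add: weight_def[abs_def])
qed (simp add: weight_def[abs_def])

lemma open_HS: "open HS" unfolding half_space_def by (intro open_Collect_less continuous_intros)

lemma HS_borel [measurable]: "HS \<in> sets borel" using open_HS by simp

lemma dens_nonneg: "dens u x \<ge> 0"
  unfolding dens_def by (intro sum_nonneg mult_nonneg_nonneg weight_nonneg) auto

lemma continuous_dens: "u \<in> C1H \<Longrightarrow> continuous_on UNIV (dens u)"
  unfolding dens_def by (intro continuous_intros continuous_weight Cck1_D(5))

lemma dens_off_support: "x \<notin> supp u \<Longrightarrow> dens u x = 0"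
  unfolding dens_def by (simp add: zero_off_support(2))

lemma integrable_dens:
  assumes "u \<in> C1H" shows "integrable lborel (dens u)"
  by (rule compact_support_integrable[OF continuous_dens[OF assms] Cck1_D(2)[OF assms]]) (rule dens_off_support)

lemma p_pos: "p > 0" using p_gt_2 by simp

lemma continuous_mass: "u \<in> C1H \<Longrightarrow> continuous_on UNIV (\<lambda>x. \<bar>u x\<bar> powr p)"
  using p_gt_2 by (intro continuous_on_powr' continuous_intros Cck1_D(4)) auto

lemma integrable_mass:
  assumes "u \<in> C1H" shows "integrable lborel (\<lambda>x. \<bar>u x\<bar> powr p)"
proof (rule compact_support_integrable[OF continuous_mass[OF assms] Cck1_D(2)[OF assms]])
  fix x assume "x \<notin> supp u"
  from zero_off_support(1)[OF this] show "\<bar>u x\<bar> powr p = 0" by simp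
qed

lemma en_nonneg: "en u \<ge> 0"
  unfolding en_def by (intro integral_nonneg_AE) (simp add: dens_nonneg)

lemma mass_nonneg: "mass u \<ge> 0"
  unfolding mass_def by (intro integral_nonneg_AE) simp

lemma hardy_en:
  assumes u: "u \<in> C1H" shows "(\<integral>x. (u x / x$a)\<^sup>2 \<partial>lborel) \<le> 4 * en u"
proof -
  have "(\<integral>x. (partial_deriv a u x)\<^sup>2 \<partial>lborel) \<le> en u"
    unfolding en_def
  proof (rule integral_mono[OF hardy(2)[OF u] integrable_dens[OF u]])
    show "(partial_deriv a u x)\<^sup>2 \<le> dens u x" for x
      unfolding dens_def using member_le_sum[of a UNIV "\<lambda>i. weight i x * (partial_deriv i u x)\<^sup>2"]
      by (simp add: weight_nonneg)
  qed
  then show ?thesis using hardy(3)[OF u] by linarith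
qed

lemma lebesgue_HS_integral:
  fixes f :: "real^'n \<Rightarrow> real"
  assumes "f \<in> borel_measurable borel"
  shows "(\<integral>x. f x \<partial>lebesgue_on HS) = (LINT x:HS|lborel. f x)"
proof -
  have "(\<integral>x. f x \<partial>lebesgue_on HS) = (\<integral>x. indicat_real HS x *\<^sub>R f x \<partial>lebesgue)"
    by (rule integral_restrict_space) simp
  also have "\<dots> = (\<integral>x. indicat_real HS x *\<^sub>R f x \<partial>lborel)"
    by (rule integral_completion) (use assms in measurable)
  finally show ?thesis by (simp add: set_lebesgue_integral_def)
qed

lemma energy_density_eq:
  assumes "x \<in> HS"
  shows "energy_density a b s D x = (\<Sum>i\<in>UNIV. weight i x * (D i x)\<^sup>2)"
proof -
  have "(\<Sum>i\<in>UNIV. weight i x * (D i x)\<^sup>2) = weight b x * (D b x)\<^sup>2 + (\<Sum>i\<in>UNIV - {b}. weight i x * (D i x)\<^sup>2)"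
    by (rule sum.remove) auto
  also have "(\<Sum>i\<in>UNIV - {b}. weight i x * (D i x)\<^sup>2) = (\<Sum>i\<in>UNIV - {b}. (D i x)\<^sup>2)"
    by (rule sum.cong) (auto simp: weight_def)
  also have "weight b x = (x$a) powr s" using assms by (simp add: weight_def half_space_def)
  finally show ?thesis by (simp add: energy_density_def)
qed

lemma set_integral_HS:
  fixes f :: "real^'n \<Rightarrow> real"
  assumes "\<And>x. x \<notin> HS \<Longrightarrow> f x = 0"
  shows "(LINT x:HS|lborel. f x) = (\<integral>x. f x \<partial>lborel)"
  unfolding set_lebesgue_integral_def
  by (rule Bochner_Integration.integral_cong) (use assms in \<open>auto simp: indicator_def\<close>)

lemma C1H_off_HS:
  assumes "u \<in> C1H" "x \<notin> HS"
  shows "u x = 0" "partial_deriv i u x = 0" "dens u x = 0"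
  using assms Cck1_D(3)[OF assms(1)] zero_off_support[of x u] dens_off_support[of x u] by blast+

lemma energy_C1H:
  assumes u: "u \<in> C1H"
  shows "energy a b s (\<lambda>i. partial_deriv i u) = en u"
proof -
  have "energy a b s (\<lambda>i. partial_deriv i u) = (\<integral>x. dens u x \<partial>lebesgue_on HS)"
    unfolding energy_def
    by (rule Bochner_Integration.integral_cong) (auto simp: energy_density_eq dens_def space_restrict_space)
  also have "\<dots> = (LINT x:HS|lborel. dens u x)"
    by (rule lebesgue_HS_integral) (use continuous_dens[OF u] borel_measurable_continuous_onI in blast)
  also have "\<dots> = en u"
    unfolding en_def by (rule set_integral_HS) (rule C1H_off_HS(3)[OF u])
  finally show ?thesis .
qed

lemma mass_C1H:
  assumes u: "u \<in> C1H"
  shows "(\<integral>x. \<bar>u x\<bar> powr p \<partial>lebesgue_on HS) = mass u"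
proof -
  have "(\<integral>x. \<bar>u x\<bar> powr p \<partial>lebesgue_on HS) = (LINT x:HS|lborel. \<bar>u x\<bar> powr p)"
    by (rule lebesgue_HS_integral) (use continuous_mass[OF u] borel_measurable_continuous_onI in blast)
  also have "\<dots> = mass u"
    unfolding mass_def by (rule set_integral_HS) (simp add: C1H_off_HS(1)[OF u])
  finally show ?thesis .
qed

lemma quotient_C1H:
  assumes u: "u \<in> C1H"
  shows "sobolev_quotient a b s (\<lambda>i. partial_deriv i u) u = en u / mass u powr (2 / p)"
  unfolding sobolev_quotient_def Let_def p_def[symmetric] energy_C1H[OF u] mass_C1H[OF u] ..

section \<open>Whitney boxes\<close>

definition side :: "int \<Rightarrow> real^'n" where
  "side k = (\<chi> i. if i = b then (2 powr real_of_int k) powr (1 + s / 2) else 2 powr real_of_int k)"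

text \<open>
A pair \<open>w = (k, m)\<close> names the box of scale \<open>2^k\<close> at position \<open>m\<close> in the grid of that scale. It is a Whitney
box if \<open>m a = 1\<close>, so that its distance to the boundary equals its side in direction \<open>a\<close>.
\<close>

definition corner :: "int \<times> ('n \<Rightarrow> int) \<Rightarrow> real^'n" where
  "corner w = (\<chi> i. side (fst w) $ i * real_of_int (snd w i))"

definition wbox :: "int \<times> ('n \<Rightarrow> int) \<Rightarrow> (real^'n) set" where
  "wbox w = hbox (corner w) (side (fst w))"

definition whitney :: "(int \<times> ('n \<Rightarrow> int)) set" where
  "whitney = {w. snd w a = 1}"

text \<open>
The name of the Whitney box containing a given point of the half space.
\<close>

definition windex :: "real^'n \<Rightarrow> int \<times> ('n \<Rightarrow> int)" where
  "windex x = (let k = \<lfloor>log 2 (x$a)\<rfloor> in (k, \<lambda>i. \<lfloor>x$i / side k $ i\<rfloor>))"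

lemma side_pos: "side k $ i > 0" by (simp add: side_def)

lemma side_a: "side k $ a = 2 powr real_of_int k" using ab by (simp add: side_def)

lemma mem_wbox: "x \<in> wbox w \<longleftrightarrow> (\<forall>i. snd w i = \<lfloor>x$i / side (fst w) $ i\<rfloor>)"
proof -
  have "(corner w $ i \<le> x$i \<and> x$i < corner w $ i + side (fst w) $ i) \<longleftrightarrow> snd w i = \<lfloor>x$i / side (fst w) $ i\<rfloor>" for i
  proof -
    have "(snd w i = \<lfloor>x$i / side (fst w) $ i\<rfloor>) \<longleftrightarrow>
      real_of_int (snd w i) \<le> x$i / side (fst w) $ i \<and> x$i / side (fst w) $ i < real_of_int (snd w i) + 1"
      by (metis floor_eq_iff)
    also have "\<dots> \<longleftrightarrow> (corner w $ i \<le> x$i \<and> x$i < corner w $ i + side (fst w) $ i)"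
      using side_pos[of "fst w" i] by (simp add: corner_def field_simps)
    finally show ?thesis by blast
  qed
  then show ?thesis by (simp add: wbox_def hbox_def)
qed

lemma wbox_xa:
  assumes "w \<in> whitney" "x \<in> wbox w"
  shows "2 powr real_of_int (fst w) \<le> x$a" "x$a < 2 * 2 powr real_of_int (fst w)"
proof -
  have "corner w $ a \<le> x$a" "x$a < corner w $ a + side (fst w) $ a"
    using assms(2) by (auto simp: wbox_def hbox_def)
  then show "2 powr real_of_int (fst w) \<le> x$a" "x$a < 2 * 2 powr real_of_int (fst w)"
    using assms(1) side_a[of "fst w"] by (auto simp: corner_def whitney_def)
qed

lemma windex_eq:
  assumes w: "w \<in> whitney" and x: "x \<in> wbox w"
  shows "windex x = w"
proof -
  note xa = wbox_xa[OF w x]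
  have x0: "x$a > 0" using xa(1) by (rule less_le_trans[rotated]) simp
  have "2 powr real_of_int (fst w) \<le> x$a" "x$a < 2 powr (real_of_int (fst w) + 1)"
    using xa by (auto simp: powr_add)
  then have "real_of_int (fst w) \<le> log 2 (x$a)" "log 2 (x$a) < real_of_int (fst w) + 1"
    using x0 by (auto simp: le_log_iff log_less_iff)
  then have "\<lfloor>log 2 (x$a)\<rfloor> = fst w" by (simp add: floor_eq_iff)
  moreover have "(\<lambda>i. \<lfloor>x$i / side (fst w) $ i\<rfloor>) = snd w"
    using x unfolding mem_wbox by auto
  ultimately show ?thesis by (simp add: windex_def Let_def)
qed

lemma windex:
  assumes x: "x \<in> HS"
  shows "windex x \<in> whitney" "x \<in> wbox (windex x)"
proof -
  have x0: "x$a > 0" using x by (simp add: half_space_def)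
  define k where "k = \<lfloor>log 2 (x$a)\<rfloor>"
  have "real_of_int k \<le> log 2 (x$a)" "log 2 (x$a) < real_of_int k + 1"
    unfolding k_def by linarith+
  then have "2 powr real_of_int k \<le> x$a" "x$a < 2 powr (real_of_int k + 1)"
    using x0 by (auto simp: le_log_iff log_less_iff)
  then have "\<lfloor>x$a / side k $ a\<rfloor> = 1"
    unfolding side_a by (auto simp: floor_eq_iff field_simps powr_add)
  then show "windex x \<in> whitney" by (simp add: whitney_def windex_def Let_def k_def)
  show "x \<in> wbox (windex x)" unfolding mem_wbox by (simp add: windex_def Let_def)
qed

lemma disjoint_whitney: "disjoint_family_on wbox whitney"
  unfolding disjoint_family_on_def using windex_eq by blast

text \<open>
On a compact subset \<open>x$a\<close> is bounded away from 0 and from infinity, which leaves finitely many scales and,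
for each of them, finitely many positions.
\<close>

lemma compact_finite_whitney:
  assumes K: "compact K" "K \<subseteq> HS"
  obtains F where "finite F" "F \<subseteq> whitney" "K \<subseteq> (\<Union>w\<in>F. wbox w)"
proof -
  have "finite (windex ` K)"
  proof (cases "K = {}")
    case False
    have ca: "continuous_on K (\<lambda>x. x$a)" by (intro continuous_intros)
    obtain x0 where x0: "x0 \<in> K" "\<And>x. x \<in> K \<Longrightarrow> x0$a \<le> x$a"
      using continuous_attains_inf[OF K(1) False ca] by blast
    have pos: "x0$a > 0" using K(2) x0(1) by (auto simp: half_space_def)
    obtain R where R: "\<And>x. x \<in> K \<Longrightarrow> norm x \<le> R"
      using compact_imp_bounded[OF K(1)] bounded_iff by blast
    have comp: "\<bar>x$i\<bar> \<le> R" if "x \<in> K" for x i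
      using R[OF that] component_le_norm_cart[of x i] by linarith
    define k0 where "k0 = \<lfloor>log 2 (x0$a)\<rfloor>"
    define k1 where "k1 = \<lfloor>log 2 R\<rfloor>"
    define G where "G = (SIGMA k:{k0..k1}. PiE UNIV (\<lambda>i. {\<lfloor>- R / side k $ i\<rfloor>..\<lfloor>R / side k $ i\<rfloor>}))"
    have "finite G" unfolding G_def by (intro finite_SigmaI finite_PiE) auto
    moreover have "windex ` K \<subseteq> G"
    proof (rule image_subsetI)
      fix x assume x: "x \<in> K"
      have xa: "0 < x$a" "x0$a \<le> x$a" "x$a \<le> R" using x0(2)[OF x] pos comp[OF x, of a] by auto
      have "k0 \<le> \<lfloor>log 2 (x$a)\<rfloor>" "\<lfloor>log 2 (x$a)\<rfloor> \<le> k1"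
        unfolding k0_def k1_def using xa pos by (auto intro!: floor_mono)
      moreover have "\<lfloor>- R / side k $ i\<rfloor> \<le> \<lfloor>x$i / side k $ i\<rfloor> \<and> \<lfloor>x$i / side k $ i\<rfloor> \<le> \<lfloor>R / side k $ i\<rfloor>" for i k
        using comp[OF x, of i] side_pos[of k i] by (intro conjI floor_mono divide_right_mono) (auto simp: less_imp_le)
      ultimately show "windex x \<in> G" by (auto simp: windex_def Let_def G_def)
    qed
    ultimately show ?thesis by (rule finite_subset[rotated])
  qed simp
  moreover have "windex ` K \<subseteq> whitney" "K \<subseteq> (\<Union>w\<in>windex ` K. wbox w)"
    using K(2) windex by blast+
  ultimately show thesis using that by blast
qed

lemma vol_side: "vol (side k) = (2 powr real_of_int k) powr hdim"
proof -
  define r where "r = 2 powr real_of_int k"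
  have r: "r > 0" by (simp add: r_def)
  have "vol (side k) = side k $ b * (\<Prod>i\<in>UNIV - {b}. side k $ i)"
    unfolding vol_def by (rule prod.remove) auto
  also have "(\<Prod>i\<in>UNIV - {b}. side k $ i) = (\<Prod>i\<in>UNIV - {b}. r)"
    by (rule prod.cong) (auto simp: side_def r_def)
  also have "\<dots> = r ^ (CARD('n) - 1)" by (simp add: card_Diff_singleton)
  also have "\<dots> = r powr (real CARD('n) - 1)"
    using r card_ge_2 by (simp add: of_nat_diff flip: powr_realpow)
  also have "side k $ b = r powr (1 + s / 2)" by (simp add: side_def r_def)
  finally show ?thesis unfolding r_def[symmetric] hdim_def by (simp flip: powr_add add: add.commute)
qed

text \<open>
On the box \<open>r \<le> x$a\<close> for \<open>r = 2^k\<close>, so the weight is at least \<open>r powr s\<close>, which compensates for the longer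
side \<open>r powr (1 + s/2)\<close> in direction \<open>b\<close>.
\<close>

lemma grad_sq_whitney:
  assumes w: "w \<in> whitney" and x: "x \<in> wbox w"
  shows "grad_sq (side (fst w)) u x \<le> (2 powr real_of_int (fst w))\<^sup>2 * dens u x"
proof -
  define r where "r = 2 powr real_of_int (fst w)"
  have r: "r > 0" by (simp add: r_def)
  have xa: "r \<le> x$a" using wbox_xa[OF w x] by (simp add: r_def)
  have "(side (fst w) $ i)\<^sup>2 \<le> r\<^sup>2 * weight i x" for i
  proof (cases "i = b")
    case True
    have "(side (fst w) $ i)\<^sup>2 = (r powr (1 + s/2))\<^sup>2" using True by (simp add: side_def r_def)
    also have "\<dots> = r\<^sup>2 * r powr s" using r by (simp add: powr_add power_mult_distrib powr_power)
    also have "\<dots> \<le> r\<^sup>2 * (x$a) powr s" using xa r s_pos by (intro mult_left_mono powr_mono2) auto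
    finally show ?thesis using True xa r by (simp add: weight_def)
  qed (simp add: side_def r_def weight_def)
  then show ?thesis unfolding grad_sq_def dens_def sum_distrib_left r_def[symmetric]
    by (intro sum_mono) (auto simp: mult.assoc[symmetric] intro!: mult_right_mono)
qed

abbreviation wint :: "int \<times> ('n \<Rightarrow> int) \<Rightarrow> (real^'n \<Rightarrow> real) \<Rightarrow> real" where
  "wint w f \<equiv> (LINT x:wbox w|lborel. f x)"

lemma wbox_borel [measurable]: "wbox w \<in> sets borel" by (simp add: wbox_def)

lemma wbox_integrable: "continuous_on UNIV f \<Longrightarrow> set_integrable lborel (wbox w) (f :: real^'n \<Rightarrow> real)"
  by (simp add: wbox_def hbox_integrable)

lemma wint_dens_nonneg: "wint w (dens u) \<ge> 0"
  by (rule hbox_integral_nonneg) (rule dens_nonneg)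

text \<open>
The volume \<open>r powr hdim\<close> contributes \<open>r powr -1\<close>, since \<open>1/p - 1/2 = - 1/hdim\<close>, and this cancels the
factor \<open>r\<close> from the gradient. So the constant does not depend on the scale.
\<close>

lemma box_norm_whitney:
  assumes u: "u \<in> C1H" and w: "w \<in> whitney"
  shows "box_norm p 0 (corner w) (side (fst w)) u \<le> sqrt (wint w (dens u))"
proof -
  define r where "r = 2 powr real_of_int (fst w)"
  have r: "r > 0" by (simp add: r_def)
  have "grad_energy 0 (corner w) (side (fst w)) u = wint w (grad_sq (side (fst w)) u)"
    by (simp add: grad_energy_def wbox_def)
  also have "\<dots> \<le> wint w (\<lambda>x. r\<^sup>2 * dens u x)"
    using grad_sq_whitney[OF w] continuous_grad_sq[OF Cck1_D(1)[OF u]]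
    by (intro set_integral_mono wbox_integrable continuous_intros continuous_dens[OF u]) (auto simp: r_def)
  also have "\<dots> = r\<^sup>2 * wint w (dens u)" by simp
  finally have "sqrt (grad_energy 0 (corner w) (side (fst w)) u) \<le> r * sqrt (wint w (dens u))"
    using r by (metis real_sqrt_le_iff real_sqrt_mult real_sqrt_unique less_imp_le)
  then have "box_norm p 0 (corner w) (side (fst w)) u \<le> vol (side (fst w)) powr (1/p - 1/2) * (r * sqrt (wint w (dens u)))"
    unfolding box_norm_def by (rule mult_left_mono) simp
  also have "vol (side (fst w)) powr (1/p - 1/2) = r powr -1"
    unfolding vol_side hdim_inverse r_def[symmetric] powr_powr using hdim_gt_2 by simp
  also have "r powr -1 * (r * sqrt (wint w (dens u))) = sqrt (wint w (dens u))"
    using r by (simp add: powr_minus)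
  finally show ?thesis .
qed

text \<open>
The constant of \<open>poincare_sobolev_box\<close> at the critical exponent.
\<close>

definition Kp :: real where
  "Kp = 2 * sqrt (real CARD('n) * 2 ^ CARD('n) / 4) / (1 - 2 powr - sobolev_gain CARD('n) p)"

lemma Kp_pos: "Kp > 0"
proof -
  have "2 powr - sobolev_gain CARD('n) p < 2 powr 0"
    using subcritical by (intro powr_less_mono) auto
  then show ?thesis by (simp add: Kp_def)
qed

lemma poincare_C1H:
  assumes u: "u \<in> C1H" and l: "\<And>i. l$i > 0"
  shows "(LINT x:hbox c l|lborel. \<bar>u x - avg c l u\<bar> powr p) \<le> (Kp * box_norm p 0 c l u) powr p"
proof -
  obtain L where "\<And>i x. \<bar>partial_deriv i u x\<bar> \<le> L" using Cck1_bounded_partials[OF u] by blast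
  from poincare_sobolev_box[OF Cck1_D(1)[OF u] this p_gt_2 subcritical] l
  show ?thesis unfolding poincare_bound_def Kp_def by blast
qed

text \<open>
Functions of bounded energy are close in \<open>L\<^sup>p\<close> to their averages over the cells of a fine subdivision; this
is the source of compactness.
\<close>

lemma cell_averages_whitney:
  assumes u: "u \<in> C1H" and w: "w \<in> whitney" and n: "n > 0"
  shows "(\<Sum>m\<in>cell_index n. LINT x:hbox (cell (corner w) (side (fst w)) n m) (side (fst w) /\<^sub>R real n)|lborel.
           \<bar>u x - avg (cell (corner w) (side (fst w)) n m) (side (fst w) /\<^sub>R real n) u\<bar> powr p)
     \<le> (Kp * real n powr - sobolev_gain CARD('n) p * sqrt (wint w (dens u))) powr p"
proof -
  define c where "c = corner w"
  define l where "l = side (fst w)"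
  have l: "l$i > 0" for i by (simp add: l_def side_pos)
  have l': "(l /\<^sub>R real n)$i > 0" for i using l n by simp
  have bn0: "box_norm p 0 c l u \<ge> 0" for c l :: "real^'n"
    by (simp add: box_norm_def grad_energy_nonneg)
  have "(\<Sum>m\<in>cell_index n. LINT x:hbox (cell c l n m) (l /\<^sub>R real n)|lborel. \<bar>u x - avg (cell c l n m) (l /\<^sub>R real n) u\<bar> powr p)
     \<le> (\<Sum>m\<in>cell_index n. (Kp * box_norm p 0 (cell c l n m) (l /\<^sub>R real n) u) powr p)"
    by (intro sum_mono poincare_C1H u l')
  also have "\<dots> = Kp powr p * (\<Sum>m\<in>cell_index n. box_norm p 0 (cell c l n m) (l /\<^sub>R real n) u powr p)"
    using Kp_pos bn0 by (simp add: powr_mult sum_distrib_left)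
  also have "\<dots> \<le> Kp powr p * (real n powr - sobolev_gain CARD('n) p * box_norm p 0 c l u) powr p"
    using sum_box_norm_cells[OF Cck1_D(1)[OF u] l _ n, of p 0 c] p_gt_2 by (intro mult_left_mono) auto
  also have "\<dots> = (Kp * real n powr - sobolev_gain CARD('n) p * box_norm p 0 c l u) powr p"
    using Kp_pos bn0 by (simp add: powr_mult)
  also have "\<dots> \<le> (Kp * real n powr - sobolev_gain CARD('n) p * sqrt (wint w (dens u))) powr p"
    using box_norm_whitney[OF u w] Kp_pos bn0 p_pos unfolding c_def l_def
    by (intro powr_mono2 mult_left_mono) auto
  finally show ?thesis unfolding c_def l_def .
qed

end

section \<open>Hardy terms and the Sobolev inequality\<close>

text \<open>
Adding a small \<open>\<eta>\<close> to both bounds makes them positive, as \<open>powr_add_le_split\<close> requires.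
\<close>

lemma set_minkowski:
  fixes f g :: "'a \<Rightarrow> real"
  assumes p: "p \<ge> 1" and XY: "X \<ge> 0" "Y \<ge> 0"
    and int: "set_integrable M A (\<lambda>x. \<bar>f x\<bar> powr p)" "set_integrable M A (\<lambda>x. \<bar>g x\<bar> powr p)"
      "set_integrable M A (\<lambda>x. \<bar>f x + g x\<bar> powr p)"
    and f: "(LINT x:A|M. \<bar>f x\<bar> powr p) \<le> X powr p" and g: "(LINT x:A|M. \<bar>g x\<bar> powr p) \<le> Y powr p"
  shows "(LINT x:A|M. \<bar>f x + g x\<bar> powr p) \<le> (X + Y) powr p"
proof -
  have *: "(LINT x:A|M. \<bar>f x + g x\<bar> powr p) \<le> (X + Y + 2 * \<eta>) powr p" if \<eta>: "\<eta> > 0" for \<eta>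
  proof -
    define X' where "X' = X + \<eta>"
    define Y' where "Y' = Y + \<eta>"
    have XY': "X' > 0" "Y' > 0" using XY \<eta> by (auto simp: X'_def Y'_def)
    define \<alpha> where "\<alpha> = (X' + Y') powr (p - 1) * X' powr (1 - p)"
    define \<beta> where "\<beta> = (X' + Y') powr (p - 1) * Y' powr (1 - p)"
    have 1: "set_integrable M A (\<lambda>x. \<alpha> * \<bar>f x\<bar> powr p)" "set_integrable M A (\<lambda>x. \<beta> * \<bar>g x\<bar> powr p)"
      using int by auto
    have "(LINT x:A|M. \<bar>f x + g x\<bar> powr p) \<le> (LINT x:A|M. \<alpha> * \<bar>f x\<bar> powr p + \<beta> * \<bar>g x\<bar> powr p)"
    proof (rule set_integral_mono[OF int(3) set_integral_add(1)[OF 1]])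
      fix x
      have "\<bar>f x + g x\<bar> powr p \<le> (\<bar>f x\<bar> + \<bar>g x\<bar>) powr p" using p by (intro powr_mono2) auto
      also have "\<dots> \<le> \<alpha> * \<bar>f x\<bar> powr p + \<beta> * \<bar>g x\<bar> powr p"
        using powr_add_le_split[OF p, of "\<bar>f x\<bar>" "\<bar>g x\<bar>" X' Y'] XY'
        by (simp add: \<alpha>_def \<beta>_def algebra_simps)
      finally show "\<bar>f x + g x\<bar> powr p \<le> \<alpha> * \<bar>f x\<bar> powr p + \<beta> * \<bar>g x\<bar> powr p" .
    qed
    also have "\<dots> = \<alpha> * (LINT x:A|M. \<bar>f x\<bar> powr p) + \<beta> * (LINT x:A|M. \<bar>g x\<bar> powr p)"
      using set_integral_add(2)[OF 1] by simp
    also have "\<dots> \<le> \<alpha> * X' powr p + \<beta> * Y' powr p"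
    proof (intro add_mono mult_left_mono)
      show "(LINT x:A|M. \<bar>f x\<bar> powr p) \<le> X' powr p"
        using f by (rule order_trans) (use XY \<eta> p in \<open>auto simp: X'_def intro!: powr_mono2\<close>)
      show "(LINT x:A|M. \<bar>g x\<bar> powr p) \<le> Y' powr p"
        using g by (rule order_trans) (use XY \<eta> p in \<open>auto simp: Y'_def intro!: powr_mono2\<close>)
    qed (auto simp: \<alpha>_def \<beta>_def)
    also have "\<dots> = (X' + Y') powr p"
      using powr_split_identity[OF XY', of p] by (simp add: \<alpha>_def \<beta>_def algebra_simps)
    finally show ?thesis by (simp add: X'_def Y'_def algebra_simps)
  qed
  have "((\<lambda>\<eta>. (X + Y + 2 * \<eta>) powr p) \<longlongrightarrow> (X + Y + 2 * 0) powr p) (at_right 0)"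
  proof (intro tendsto_powr2 tendsto_add tendsto_mult_left tendsto_ident_at tendsto_const)
    show "\<forall>\<^sub>F \<eta> in at_right 0. 0 \<le> X + Y + 2 * \<eta>"
      using XY by (intro eventually_at_rightI[of 0 1]) auto
  qed (use p in auto)
  moreover have "\<forall>\<^sub>F \<eta> in at_right 0. (LINT x:A|M. \<bar>f x + g x\<bar> powr p) \<le> (X + Y + 2 * \<eta>) powr p"
    by (rule eventually_at_rightI[of 0 1]) (auto intro: *)
  ultimately show ?thesis using tendsto_lowerbound[where F="at_right (0::real)"] by fastforce
qed

lemma Ck1_diff:
  fixes f g :: "real^'n \<Rightarrow> real"
  assumes "Ck (Suc 0) f" "Ck (Suc 0) g"
  shows "partial_deriv i (\<lambda>x. f x - g x) = (\<lambda>x. partial_deriv i f x - partial_deriv i g x)"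
  using Ck1_lincomb(2)[OF assms, of i 1 "-1"] by simp

lemma Cck1_diff: "f \<in> Cck 1 W \<Longrightarrow> g \<in> Cck 1 W \<Longrightarrow> (\<lambda>x. f x - g x) \<in> Cck 1 W"
  using Cck1_lincomb[of f W g 1 "-1"] by simp

lemma integral_diag_affine:
  fixes f :: "real^'n \<Rightarrow> real" and t l :: "real^'n"
  assumes [measurable]: "f \<in> borel_measurable borel" and l: "\<And>i. l$i > 0"
  shows "(\<integral>x. f x \<partial>lborel) = vol l * (\<integral>x. f (\<chi> i. t$i + l$i * x$i) \<partial>lborel)"
proof -
  define c where "c j = l \<bullet> j" for j :: "real^'n"
  define T where "T x = t + (\<Sum>j\<in>Basis. (c j * (x \<bullet> j)) *\<^sub>R j)" for x
  have Bas: "(Basis :: (real^'n) set) = (\<lambda>i. axis i 1) ` UNIV"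
    by (auto simp: Basis_vec_def)
  have c: "c j \<noteq> 0" if "j \<in> Basis" for j
    using that l unfolding Bas c_def by (auto simp: inner_axis less_imp_neq[symmetric] dest: less_imp_neq)
  have T: "T x = (\<chi> i. t$i + l$i * x$i)" for x
  proof (rule vec_eq_iff[THEN iffD2], rule allI)
    fix i
    have b: "axis i 1 \<in> (Basis :: (real^'n) set)" unfolding Bas by blast
    have "T x $ i = T x \<bullet> axis i 1" by (simp add: inner_axis)
    also have "\<dots> = t \<bullet> axis i 1 + c (axis i 1) * (x \<bullet> axis i 1)"
      unfolding T_def inner_add_left inner_sum_left_Basis[OF b] ..
    finally show "T x $ i = (\<chi> i. t$i + l$i * x$i) $ i" by (simp add: inner_axis c_def)
  qed
  have P: "(\<Prod>j\<in>Basis. \<bar>c j\<bar>) = vol l"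
  proof -
    have "(\<Prod>j\<in>Basis. \<bar>c j\<bar>) = (\<Prod>i\<in>UNIV. \<bar>c (axis i 1)\<bar>)"
      unfolding Bas by (subst prod.reindex) (auto simp: inj_on_def axis_eq_axis)
    also have "\<dots> = vol l" unfolding vol_def using l by (simp add: c_def inner_axis less_imp_le)
    finally show ?thesis .
  qed
  have [measurable]: "T \<in> borel_measurable borel"
    unfolding T_def by measurable
  have v: "vol l > 0" using l by (rule vol_pos)
  have "(\<integral>x. f x \<partial>lborel) = (\<integral>x. f x \<partial>(density (distr lborel borel T) (\<lambda>_. (\<Prod>j\<in>Basis. \<bar>c j\<bar>))))"
    using lborel_affine_euclidean[where c=c and t=t, OF c] unfolding T_def[symmetric, abs_def] by simp
  also have "\<dots> = (\<integral>x. vol l * f x \<partial>(distr lborel borel T))"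
    unfolding P using v by (subst integral_density) (auto simp: less_imp_le)
  also have "\<dots> = (\<integral>x. vol l * f (T x) \<partial>lborel)" by (subst integral_distr) auto
  finally show ?thesis by (simp add: T)
qed

context degenerate_energy
begin

definition hdens :: "(real^'n \<Rightarrow> real) \<Rightarrow> real^'n \<Rightarrow> real" where
  "hdens u x = dens u x + (u x / x$a)\<^sup>2"

lemma continuous_hardy_term:
  assumes u: "u \<in> C1H" shows "continuous_on UNIV (\<lambda>x. u x / x$a)"
proof (rule continuous_on_UNIV_divide_support[OF Cck1_D(4)[OF u] closed_closure])
  show "x$a > 0" if "x \<in> supp u" for x
    using that Cck1_D(3)[OF u] by (auto simp: half_space_def)
  show "u x = 0" if "x \<notin> supp u" for x
    using zero_off_support(1)[OF that] .
qed

lemma continuous_hdens: "u \<in> C1H \<Longrightarrow> continuous_on UNIV (hdens u)"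
  unfolding hdens_def by (intro continuous_on_add continuous_on_power continuous_dens continuous_hardy_term)

lemma hdens_nonneg: "hdens u x \<ge> 0" by (simp add: hdens_def dens_nonneg)

lemma integrable_hdens: "u \<in> C1H \<Longrightarrow> integrable lborel (hdens u)"
  unfolding hdens_def by (intro Bochner_Integration.integrable_add integrable_dens hardy(1))

lemma integral_hdens:
  assumes u: "u \<in> C1H" shows "(\<integral>x. hdens u x \<partial>lborel) \<le> 5 * en u"
  unfolding hdens_def using Bochner_Integration.integral_add[OF integrable_dens[OF u] hardy(1)[OF u]] hardy_en[OF u]
  by (simp add: en_def)

lemma continuous_powr_p:
  fixes f :: "real^'n \<Rightarrow> real"
  assumes "continuous_on UNIV f" shows "continuous_on UNIV (\<lambda>x. \<bar>f x\<bar> powr p)"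
  using p_gt_2 by (intro continuous_on_powr' continuous_intros assms) auto

definition Cw :: real where "Cw = Kp + 2"

lemma Cw_pos: "Cw > 0" using Kp_pos by (simp add: Cw_def)

text \<open>
The deviation from the mean is bounded by the Poincare-Sobolev inequality, the mean by the Cauchy-Schwarz
inequality and the Hardy term, as \<open>x$a\<close> is comparable to the scale on the box.
\<close>

lemma wbox_mass:
  assumes u: "u \<in> C1H" and w: "w \<in> whitney"
  shows "wint w (\<lambda>x. \<bar>u x\<bar> powr p) \<le> (Cw * sqrt (wint w (hdens u))) powr p"
proof -
  define r where "r = 2 powr real_of_int (fst w)"
  have r: "r > 0" by (simp add: r_def)
  define A where "A = avg (corner w) (side (fst w)) u"
  define V where "V = vol (side (fst w))"
  define h where "h = wint w (hdens u)"
  define q where "q = wint w (\<lambda>x. (u x / x$a)\<^sup>2)"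
  have V: "V = r powr hdim" "V > 0" unfolding V_def vol_side r_def by auto
  note cu = Cck1_D(4)[OF u]
  have h: "0 \<le> h" unfolding h_def by (rule hbox_integral_nonneg) (rule hdens_nonneg)
  have dh: "wint w (dens u) \<le> h" unfolding h_def
    by (intro set_integral_mono wbox_integrable continuous_dens continuous_hdens u) (simp add: hdens_def)
  have q: "0 \<le> q" unfolding q_def by (rule hbox_integral_nonneg) simp
  have qh: "q \<le> h" unfolding h_def q_def
    by (intro set_integral_mono wbox_integrable continuous_on_power continuous_hardy_term continuous_hdens u)
       (simp add: hdens_def dens_nonneg)
  have 1: "wint w (\<lambda>x. \<bar>u x - A\<bar> powr p) \<le> (Kp * sqrt h) powr p"
  proof -
    have "wint w (\<lambda>x. \<bar>u x - A\<bar> powr p) \<le> (Kp * box_norm p 0 (corner w) (side (fst w)) u) powr p"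
      unfolding wbox_def A_def by (intro poincare_C1H u side_pos)
    also have "\<dots> \<le> (Kp * sqrt h) powr p"
      using box_norm_whitney[OF u w] dh Kp_pos p_pos
      by (intro powr_mono2 mult_left_mono mult_nonneg_nonneg) (auto simp: box_norm_def grad_energy_nonneg intro: order_trans)
    finally show ?thesis .
  qed
  have 2: "wint w (\<lambda>x. \<bar>A\<bar> powr p) \<le> (2 * sqrt h) powr p"
  proof -
    have "A\<^sup>2 * V\<^sup>2 = (wint w u)\<^sup>2" unfolding A_def avg_def V_def[symmetric] wbox_def using V by (simp add: power_divide)
    also have "\<dots> \<le> V * wint w (\<lambda>x. (u x)\<^sup>2)"
      unfolding V_def wbox_def by (rule hbox_cauchy_schwarz[OF cu]) (rule side_pos)
    also have "\<dots> \<le> V * wint w (\<lambda>x. (2 * r)\<^sup>2 * (u x / x$a)\<^sup>2)"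
    proof (intro mult_left_mono set_integral_mono wbox_integrable continuous_on_power continuous_on_mult_left continuous_hardy_term u cu)
      fix x assume "x \<in> wbox w"
      then have xa: "0 < x$a" "x$a < 2 * r" using wbox_xa[OF w, of x] r by (auto simp: r_def[symmetric])
      have "(u x)\<^sup>2 = (x$a)\<^sup>2 * (u x / x$a)\<^sup>2" using xa by (simp add: power_divide)
      also have "\<dots> \<le> (2 * r)\<^sup>2 * (u x / x$a)\<^sup>2" using xa by (intro mult_right_mono power_mono) auto
      finally show "(u x)\<^sup>2 \<le> (2 * r)\<^sup>2 * (u x / x$a)\<^sup>2" .
    qed (use V in simp)
    also have "\<dots> = V * ((2 * r)\<^sup>2 * q)" unfolding q_def by simp
    finally have "A\<^sup>2 * V \<le> (2 * r)\<^sup>2 * q" using V(2) by (simp add: power2_eq_square)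
    then have "A\<^sup>2 \<le> (2 * r)\<^sup>2 * q / V" using V(2) by (simp add: field_simps)
    then have "\<bar>A\<bar> \<le> sqrt ((2 * r)\<^sup>2 * q / V)" by (rule real_le_rsqrt[where x="\<bar>A\<bar>", simplified])
    also have "\<dots> = 2 * r * sqrt q / sqrt V" using r by (simp add: real_sqrt_mult real_sqrt_divide)
    finally have Ab: "\<bar>A\<bar> \<le> 2 * r * sqrt q / sqrt V" .
    have "wint w (\<lambda>x. \<bar>A\<bar> powr p) = \<bar>A\<bar> powr p * V"
      unfolding wbox_def V_def by (rule set_integral_hbox_const) (simp add: side_pos less_imp_le)
    also have "\<dots> = (\<bar>A\<bar> * V powr (1/p)) powr p" using V p_pos by (simp add: powr_mult powr_powr)
    also have "\<dots> \<le> ((2 * r * sqrt q / sqrt V) * V powr (1/p)) powr p"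
      using Ab p_pos by (intro powr_mono2 mult_right_mono) auto
    also have "(2 * r * sqrt q / sqrt V) * V powr (1/p) = 2 * sqrt q * (r * V powr (1/p - 1/2))"
      using V(2) by (simp add: powr_diff powr_half_sqrt)
    also have "r * V powr (1/p - 1/2) = 1"
      unfolding V(1) hdim_inverse powr_powr using hdim_gt_2 r by (simp add: powr_minus)
    also have "(2 * sqrt q * 1) powr p \<le> (2 * sqrt h) powr p" using qh q p_pos by (intro powr_mono2) auto
    finally show ?thesis .
  qed
  have "wint w (\<lambda>x. \<bar>(u x - A) + A\<bar> powr p) \<le> (Kp * sqrt h + 2 * sqrt h) powr p"
  proof (rule set_minkowski[OF _ _ _ _ _ _ 1 2])
    show "set_integrable lborel (wbox w) (\<lambda>x. \<bar>u x - A\<bar> powr p)"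
      "set_integrable lborel (wbox w) (\<lambda>x. \<bar>A\<bar> powr p)"
      "set_integrable lborel (wbox w) (\<lambda>x. \<bar>u x - A + A\<bar> powr p)"
      by (intro wbox_integrable continuous_powr_p continuous_intros cu)+
  qed (use p_gt_2 Kp_pos h in auto)
  then show ?thesis unfolding h_def[symmetric] by (simp add: Cw_def distrib_right)
qed

lemma wint_finite_sum:
  fixes f :: "real^'n \<Rightarrow> real"
  assumes F: "finite F" "F \<subseteq> whitney" and f: "integrable lborel f"
  shows "(LINT x:(\<Union>w\<in>F. wbox w)|lborel. f x) = (\<Sum>w\<in>F. wint w f)"
proof (rule set_integral_finite_disjoint_UN[OF F(1)])
  show "disjoint_family_on wbox F"
    using disjoint_whitney F(2) by (rule disjoint_family_on_mono[rotated])
  show "set_integrable lborel (wbox i) f" for i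
    using f integrable_mult_indicator[of "wbox i" lborel f] by (simp add: set_integrable_def)
qed auto

lemma wint_sum_le:
  fixes f :: "real^'n \<Rightarrow> real"
  assumes F: "finite F" "F \<subseteq> whitney" and f: "integrable lborel f" "\<And>x. f x \<ge> 0"
  shows "(\<Sum>w\<in>F. wint w f) \<le> (\<integral>x. f x \<partial>lborel)"
  unfolding wint_finite_sum[OF F f(1), symmetric]
  unfolding set_lebesgue_integral_def
proof (rule integral_mono)
  have "(\<Union>w\<in>F. wbox w) \<in> sets lborel" using F(1) by (intro sets.finite_UN) auto
  then show "integrable lborel (\<lambda>x. indicat_real (\<Union>w\<in>F. wbox w) x *\<^sub>R f x)"
    using f(1) by (rule integrable_mult_indicator)
  show "indicat_real (\<Union>w\<in>F. wbox w) x *\<^sub>R f x \<le> f x" for x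
    using f(2)[of x] by (simp add: indicator_def)
qed (rule f(1))

lemma wint_mass_le:
  assumes u: "u \<in> C1H" and w: "w \<in> whitney"
  shows "wint w (\<lambda>x. \<bar>u x\<bar> powr p) \<le> mass u"
  using wint_sum_le[of "{w}" "\<lambda>x. \<bar>u x\<bar> powr p"] w integrable_mass[OF u] by (simp add: mass_def)

lemma wint_mass_nonneg: "0 \<le> wint w (\<lambda>x. \<bar>u x\<bar> powr q)"
  by (rule hbox_integral_nonneg) simp

text \<open>
The reference box, of scale 1, with all sides equal to 1.
\<close>

definition w0 :: "int \<times> ('n \<Rightarrow> int)" where "w0 = (0, \<lambda>i. if i = a then 1 else 0)"

lemma w0_whitney: "w0 \<in> whitney" by (simp add: w0_def whitney_def)

text \<open>
On each box split off the power \<open>1 - 2/p\<close> of the mass and bound it by the largest mass of a box; the remaining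
power \<open>2/p\<close> is bounded by the energy on the box, and these energies add up.
\<close>

lemma mass_concentration:
  assumes u: "u \<in> C1H"
  shows "\<exists>w\<in>whitney. mass u \<le> 5 * Cw\<^sup>2 * (wint w (\<lambda>x. \<bar>u x\<bar> powr p)) powr (1 - 2/p) * en u"
proof -
  obtain F where F: "finite F" "F \<subseteq> whitney" and cov: "supp u \<subseteq> (\<Union>w\<in>F. wbox w)"
    using compact_finite_whitney[OF Cck1_D(2,3)[OF u]] by blast
  define m where "m w = wint w (\<lambda>x. \<bar>u x\<bar> powr p)" for w
  have m0: "m w \<ge> 0" for w unfolding m_def by (rule wint_mass_nonneg)
  have "mass u = (LINT x:(\<Union>w\<in>F. wbox w)|lborel. \<bar>u x\<bar> powr p)"
    unfolding mass_def set_lebesgue_integral_def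
  proof (rule Bochner_Integration.integral_cong[OF refl])
    fix x show "\<bar>u x\<bar> powr p = indicat_real (\<Union>w\<in>F. wbox w) x *\<^sub>R \<bar>u x\<bar> powr p"
    proof (cases "x \<in> (\<Union>w\<in>F. wbox w)")
      case False
      then have "u x = 0" using cov zero_off_support(1)[of x u] by blast
      then show ?thesis by simp
    qed simp
  qed
  then have sum: "mass u = (\<Sum>w\<in>F. m w)"
    unfolding m_def wint_finite_sum[OF F integrable_mass[OF u]] .
  show ?thesis
  proof (cases "F = {}")
    case True
    then have "mass u = 0" using sum by simp
    then show ?thesis using w0_whitney en_nonneg by (intro bexI[of _ w0]) auto
  next
    case False
    define M where "M = Max (m ` F)"
    have "M \<in> m ` F" unfolding M_def using F(1) False by (intro Max_in) auto
    then obtain v where v: "v \<in> F" "M = m v" by auto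
    have mM: "m w \<le> M" if "w \<in> F" for w unfolding M_def using F(1) that by (intro Max_ge) auto
    have "m w \<le> M powr (1 - 2/p) * (Cw\<^sup>2 * wint w (hdens u))" if w: "w \<in> F" for w
    proof -
      have h: "wint w (hdens u) \<ge> 0" by (rule hbox_integral_nonneg) (rule hdens_nonneg)
      have "m w = m w powr (1 - 2/p) * m w powr (2/p)"
        using m0[of w] by (cases "m w = 0") (auto simp flip: powr_add)
      also have "\<dots> \<le> M powr (1 - 2/p) * (Cw\<^sup>2 * wint w (hdens u))"
      proof (rule mult_mono)
        show "m w powr (1 - 2/p) \<le> M powr (1 - 2/p)" using m0[of w] mM[OF w] p_gt_2 by (intro powr_mono2) auto
        have "m w powr (2/p) \<le> ((Cw * sqrt (wint w (hdens u))) powr p) powr (2/p)"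
          using wbox_mass[OF u, of w] w F(2) m0[of w] p_pos unfolding m_def by (intro powr_mono2) auto
        also have "\<dots> = (Cw * sqrt (wint w (hdens u)))\<^sup>2"
          using p_pos h Cw_pos unfolding powr_powr by (simp flip: powr_numeral)
        also have "\<dots> = Cw\<^sup>2 * wint w (hdens u)" using h by (simp add: power_mult_distrib)
        finally show "m w powr (2/p) \<le> Cw\<^sup>2 * wint w (hdens u)" .
      qed auto
      finally show ?thesis .
    qed
    then have "mass u \<le> (\<Sum>w\<in>F. M powr (1 - 2/p) * (Cw\<^sup>2 * wint w (hdens u)))"
      unfolding sum by (rule sum_mono)
    also have "\<dots> = M powr (1 - 2/p) * Cw\<^sup>2 * (\<Sum>w\<in>F. wint w (hdens u))"
      by (simp add: sum_distrib_left mult.assoc)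
    also have "\<dots> \<le> M powr (1 - 2/p) * Cw\<^sup>2 * (5 * en u)"
      using wint_sum_le[OF F integrable_hdens[OF u] hdens_nonneg] integral_hdens[OF u]
      by (intro mult_left_mono) auto
    finally show ?thesis using v F(2) by (intro bexI[of _ v]) (auto simp: m_def mult_ac)
  qed
qed

lemma sobolev_inequality:
  assumes u: "u \<in> C1H"
  shows "mass u powr (2/p) \<le> 5 * Cw\<^sup>2 * en u"
proof (cases "mass u = 0")
  case True
  then show ?thesis using en_nonneg[of u] by simp
next
  case False
  then have m: "mass u > 0" using mass_nonneg[of u] by linarith
  obtain w where w: "w \<in> whitney" and le: "mass u \<le> 5 * Cw\<^sup>2 * (wint w (\<lambda>x. \<bar>u x\<bar> powr p)) powr (1 - 2/p) * en u"
    using mass_concentration[OF u] by blast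
  have "(wint w (\<lambda>x. \<bar>u x\<bar> powr p)) powr (1 - 2/p) \<le> mass u powr (1 - 2/p)"
    using wint_mass_le[OF u w] wint_mass_nonneg p_gt_2 by (intro powr_mono2) auto
  then have "5 * Cw\<^sup>2 * (wint w (\<lambda>x. \<bar>u x\<bar> powr p)) powr (1 - 2/p) * en u \<le> 5 * Cw\<^sup>2 * mass u powr (1 - 2/p) * en u"
    using en_nonneg by (intro mult_right_mono mult_left_mono) auto
  with le have "mass u \<le> mass u powr (1 - 2/p) * (5 * Cw\<^sup>2 * en u)" by (simp add: mult_ac)
  moreover have "mass u = mass u powr (1 - 2/p) * mass u powr (2/p)" using m by (simp flip: powr_add)
  ultimately have "mass u powr (1 - 2/p) * mass u powr (2/p) \<le> mass u powr (1 - 2/p) * (5 * Cw\<^sup>2 * en u)" by linarith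
  then show ?thesis using m by (simp add: mult_le_cancel_left_pos)
qed

lemma dens_convex_identity:
  assumes "f \<in> C1H" "g \<in> C1H"
  shows "dens (\<lambda>x. (1 - t) * f x + t * g x) x = (1 - t) * dens f x + t * dens g x - t * (1 - t) * dens (\<lambda>x. f x - g x) x"
  unfolding dens_def Ck1_lincomb(2)[OF Cck1_D(1)[OF assms(1)] Cck1_D(1)[OF assms(2)]]
    Ck1_diff[OF Cck1_D(1)[OF assms(1)] Cck1_D(1)[OF assms(2)]] sum_distrib_left sum.distrib[symmetric] sum_subtractf[symmetric]
  by (rule sum.cong) (auto simp: power2_eq_square algebra_simps)

text \<open>
The parallelogram identity in the form suited to convex combinations; \<open>t = 1/2\<close> controls the distance of two
near minimisers, small \<open>t\<close> gives the first variation.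
\<close>

lemma en_convex_identity:
  assumes fg: "f \<in> C1H" "g \<in> C1H"
  shows "en (\<lambda>x. (1 - t) * f x + t * g x) = (1 - t) * en f + t * en g - t * (1 - t) * en (\<lambda>x. f x - g x)"
proof -
  note i = integrable_dens[OF fg(1)] integrable_dens[OF fg(2)] integrable_dens[OF Cck1_diff[OF fg]]
  show ?thesis unfolding en_def dens_convex_identity[OF fg]
    by (subst Bochner_Integration.integral_diff Bochner_Integration.integral_add; (intro Bochner_Integration.integrable_add integrable_mult_right i)?)+ simp
qed

section \<open>Scaling symmetry\<close>

text \<open>
The affine map \<open>T\<close> takes the reference box to the given one, and \<open>\<gamma> = hdim / p\<close> is the power that preserves the
mass; it preserves the energy too because \<open>2 \<gamma> + 2 = hdim\<close>.
\<close>

lemma rescale_to_w0: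
  assumes u: "u \<in> C1H" and w: "w \<in> whitney"
  obtains v where "v \<in> C1H" "en v = en u" "mass v = mass u"
    "wint w0 (\<lambda>x. \<bar>v x\<bar> powr p) = wint w (\<lambda>x. \<bar>u x\<bar> powr p)"
proof -
  define r where "r = 2 powr real_of_int (fst w)"
  define l where "l = side (fst w)"
  \<comment> \<open>In direction \<open>a\<close> the dilation alone takes the reference box to \<open>w\<close>, as both have position 1.\<close>
  define t where "t = (\<chi> i. if i = a then 0 else corner w $ i)"
  define T where "T x = (\<chi> i. t$i + l$i * x$i)" for x :: "real^'n"
  define \<gamma> where "\<gamma> = hdim / p"
  define v where "v x = r powr \<gamma> * u (T x)" for x
  have r: "r > 0" by (simp add: r_def)
  have l: "l$i > 0" for i by (simp add: l_def side_pos)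
  have la: "l$a = r" by (simp add: l_def side_a r_def)
  have Ta: "(T x)$a = r * x$a" for x by (simp add: T_def t_def la)
  have vl: "vol l = r powr hdim" by (simp add: l_def vol_side r_def)
  define L where "L h = (\<chi> i. l$i * h$i)" for h :: "real^'n"
  have "linear L" by (rule linearI) (auto simp: L_def vec_eq_iff algebra_simps)
  then have bL: "bounded_linear L" by (rule linear_conv_bounded_linear[THEN iffD1])
  have T_eq: "T x = t + L x" for x by (simp add: T_def L_def vec_eq_iff)
  have DT: "(T has_derivative L) (at x)" for x
    unfolding T_eq[abs_def] using bounded_linear_imp_has_derivative[OF bL]
    by (auto intro!: derivative_eq_intros)
  have cT: "continuous_on UNIV T" using DT by (meson has_derivative_continuous continuous_at_imp_continuous_on)
  define D where "D x h = r powr \<gamma> * (\<Sum>i\<in>UNIV. (L h)$i * partial_deriv i u (T x))" for x h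
  have Dv: "(v has_derivative D x) (at x)" for x
    unfolding v_def[abs_def] D_def
    by (intro has_derivative_mult_right has_derivative_compose[OF DT Cck1_D(6)[OF u]])
  have Lax: "(L (axis i 1))$j = (axis i 1 :: real^'n)$j * l$j" for i j by (simp add: L_def)
  have Dax: "D x (axis i 1) = r powr \<gamma> * (l$i * partial_deriv i u (T x))" for x i
    unfolding D_def Lax mult.assoc sum_axis ..
  have cD: "continuous_on UNIV (\<lambda>x. D x (axis i 1))" for i
    unfolding Dax by (intro continuous_on_mult_left continuous_on_compose2[OF Cck1_D(5)[OF u] cT]) auto
  have Ckv: "Ck (Suc 0) v" and pv: "partial_deriv i v = (\<lambda>x. r powr \<gamma> * (l$i * partial_deriv i u (T x)))" for i
    using Ck1I(1)[OF Dv cD] Ck1I(2)[OF Dv cD] unfolding Dax by blast+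
  define K where "K = supp u"
  define T' where "T' y = (\<chi> i. (y$i - t$i) / l$i)" for y :: "real^'n"
  have TT': "T' (T x) = x" "T (T' y) = y" for x y
    using l less_imp_neq[OF l] by (auto simp: T_def T'_def vec_eq_iff less_imp_neq[symmetric])
  have vC: "v \<in> C1H"
  proof (rule Cck1_I[OF Ckv])
    have "continuous_on UNIV T'"
      unfolding T'_def using less_imp_neq[OF l]
      by (intro continuous_on_vec_lambda continuous_intros) auto
    then show "compact (T' ` K)"
      using Cck1_D(2)[OF u] unfolding K_def by (meson compact_continuous_image continuous_on_subset subset_UNIV)
    show "T' ` K \<subseteq> HS"
    proof (rule image_subsetI)
      fix y assume "y \<in> K"
      then have "y$a > 0" using Cck1_D(3)[OF u] by (auto simp: K_def half_space_def)
      moreover have "y$a = r * (T' y)$a" using Ta[of "T' y"] by (simp add: TT')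
      ultimately show "T' y \<in> HS" using r by (simp add: half_space_def zero_less_mult_iff)
    qed
    show "v x = 0" if "x \<notin> T' ` K" for x
    proof -
      have "T x \<notin> K" using that TT'(1) by (metis imageI)
      then show ?thesis using zero_off_support(1)[of "T x" u] unfolding K_def v_def by simp
    qed
  qed
  have rp: "(r powr \<gamma>) powr p = vol l" unfolding vl powr_powr \<gamma>_def using p_pos by simp
  have cov: "(\<integral>x. f x \<partial>lborel) = vol l * (\<integral>x. f (T x) \<partial>lborel)" if "f \<in> borel_measurable borel" for f :: "real^'n \<Rightarrow> real"
    unfolding T_def by (rule integral_diag_affine[OF that l])
  have vp: "\<bar>v x\<bar> powr p = vol l * \<bar>u (T x)\<bar> powr p" for x
    unfolding v_def abs_mult using rp by (simp add: powr_mult)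
  have mu: "(\<lambda>x. \<bar>u x\<bar> powr p) \<in> borel_measurable borel"
    using continuous_mass[OF u] by (rule borel_measurable_continuous_onI)
  have mass: "mass v = mass u"
    unfolding mass_def vp using cov[OF mu] by simp
  have dens: "dens v x = vol l * dens u (T x)" for x
  proof -
    have wl: "weight i x * (l$i)\<^sup>2 = r\<^sup>2 * weight i (T x)" for i
    proof (cases "i = b")
      case True
      have "max 0 (r * x$a) = r * max 0 (x$a)" using r by (simp add: max_def zero_le_mult_iff)
      then have "weight i (T x) = r powr s * max 0 (x$a) powr s"
        using True r by (simp add: weight_def Ta powr_mult)
      moreover have "(l$i)\<^sup>2 = r\<^sup>2 * r powr s"
        using True r by (simp add: l_def side_def r_def[symmetric] powr_add power_mult_distrib powr_power)
      ultimately show ?thesis using True by (simp add: weight_def)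
    qed (simp add: weight_def l_def side_def r_def)
    have "dens v x = (\<Sum>i\<in>UNIV. (r powr \<gamma>)\<^sup>2 * (weight i x * (l$i)\<^sup>2) * (partial_deriv i u (T x))\<^sup>2)"
      unfolding dens_def pv by (simp add: power_mult_distrib mult_ac)
    also have "\<dots> = (r powr \<gamma>)\<^sup>2 * r\<^sup>2 * dens u (T x)"
      unfolding wl dens_def sum_distrib_left by (simp add: mult_ac)
    also have "(r powr \<gamma>)\<^sup>2 * r\<^sup>2 = r powr (2 * \<gamma> + 2)"
      using r by (simp add: powr_add powr_power mult.commute)
    also have "2 * \<gamma> + 2 = hdim"
    proof -
      have "2 * \<gamma> + 2 - hdim = 2 * hdim * (1/p - 1/2) + 2" by (simp add: \<gamma>_def algebra_simps)
      also have "\<dots> = 0" unfolding hdim_inverse using hdim_gt_2 by simp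
      finally show ?thesis by simp
    qed
    finally show ?thesis unfolding vl .
  qed
  have en: "en v = en u"
    unfolding en_def dens
    using cov[of "dens u"] borel_measurable_continuous_onI[OF continuous_dens[OF u]] by simp
  have ww: "x \<in> wbox w0 \<longleftrightarrow> T x \<in> wbox w" for x
  proof -
    have "(corner w0 $ i \<le> x$i \<and> x$i < corner w0 $ i + side (fst w0) $ i) \<longleftrightarrow>
      (corner w $ i \<le> (T x)$i \<and> (T x)$i < corner w $ i + l $ i)" for i
    proof -
      have s0: "side (fst w0) $ i = 1" by (simp add: side_def w0_def)
      show ?thesis
      proof (cases "i = a")
        case True
        have "corner w $ a = r" using w by (simp add: corner_def whitney_def side_a r_def)
        moreover have "corner w0 $ a = 1" by (simp add: corner_def w0_def side_def)
        ultimately show ?thesis using True r s0 Ta[of x] la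
          by (auto simp: field_simps)
      next
        case False
        have "corner w0 $ i = 0" using False by (simp add: corner_def w0_def)
        then show ?thesis using False s0 l[of i] by (auto simp: T_def t_def zero_le_mult_iff)
      qed
    qed
    then show ?thesis unfolding wbox_def hbox_def l_def by simp
  qed
  have "wint w0 (\<lambda>x. \<bar>v x\<bar> powr p) = wint w (\<lambda>x. \<bar>u x\<bar> powr p)"
  proof -
    have m: "(\<lambda>x. indicat_real (wbox w) x * \<bar>u x\<bar> powr p) \<in> borel_measurable borel"
      using mu by measurable
    have "wint w0 (\<lambda>x. \<bar>v x\<bar> powr p) = (\<integral>x. vol l * (indicat_real (wbox w) (T x) * \<bar>u (T x)\<bar> powr p) \<partial>lborel)"
      unfolding set_lebesgue_integral_def vp
      by (rule Bochner_Integration.integral_cong) (auto simp: indicator_def ww)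
    also have "\<dots> = wint w (\<lambda>x. \<bar>u x\<bar> powr p)"
      using cov[OF m] by (simp add: set_lebesgue_integral_def)
    finally show ?thesis .
  qed
  then show thesis using that vC en mass by blast
qed

section \<open>Energy minimisation in convex hulls of tails\<close>

text \<open>
The convex hull, generated by combinations of two functions at a time, so that properties stable under such
combinations follow by induction.
\<close>

inductive_set chull :: "(real^'n \<Rightarrow> real) set \<Rightarrow> (real^'n \<Rightarrow> real) set" for U where
  base: "f \<in> U \<Longrightarrow> f \<in> chull U"
| step: "f \<in> chull U \<Longrightarrow> g \<in> chull U \<Longrightarrow> 0 \<le> t \<Longrightarrow> t \<le> 1 \<Longrightarrow> (\<lambda>x. (1 - t) * f x + t * g x) \<in> chull U"

lemma chull_mono: "U \<subseteq> V \<Longrightarrow> f \<in> chull U \<Longrightarrow> f \<in> chull V"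
  by (rotate_tac, induction rule: chull.induct) (auto intro: chull.intros)

lemma chull_C1H: "U \<subseteq> C1H \<Longrightarrow> f \<in> chull U \<Longrightarrow> f \<in> C1H"
proof (rotate_tac, induction rule: chull.induct)
  case (step f g t)
  then show ?case by (blast intro: Cck1_lincomb)
qed blast

text \<open>
Let \<open>D n\<close> be the infimum of the energy over the convex hull of the tail from \<open>n\<close> on. These infima increase
to \<open>d\<close>. If \<open>v k\<close> almost attains \<open>D (N k)\<close>, then the midpoint of \<open>v j\<close> and \<open>v k\<close> has energy at least \<open>D (N k)\<close>
as well, and the parallelogram identity shows that \<open>v j - v k\<close> has small energy. In the same way, moving
from \<open>v k\<close> towards \<open>um m\<close> by the fraction \<open>t = 2^-k\<close> cannot decrease the energy by more than \<open>4^-k = t\<^sup>2\<close>;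
dividing by \<open>t\<close> gives the fourth property. It states that the energy of \<open>um m\<close> splits almost additively into
those of \<open>v k\<close> and of \<open>um m - v k\<close>.
\<close>

lemma tail_minimization:
  fixes um :: "nat \<Rightarrow> real^'n \<Rightarrow> real"
  assumes um: "\<And>m. um m \<in> C1H" and bd: "\<And>m. en (um m) \<le> C"
  obtains v :: "nat \<Rightarrow> real^'n \<Rightarrow> real" and N :: "nat \<Rightarrow> nat" and d :: real where
    "\<And>k. v k \<in> chull (um ` {N k..})" "\<And>k. N k \<ge> k"
    "\<And>j k. j \<ge> k \<Longrightarrow> en (\<lambda>x. v j x - v k x) \<le> 6 / 4^k"
    "\<And>k m. m \<ge> N k \<Longrightarrow> (1 - 1 / 2^k) * en (\<lambda>x. v k x - um m x) \<le> en (um m) - en (v k) + 1 / 2^k"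
    "(\<lambda>k. en (v k)) \<longlonglongrightarrow> d" "\<And>k m. m \<ge> N k \<Longrightarrow> d - 1 / 4^k \<le> en (um m)"
proof -
  define H where "H n = chull (um ` {n..})" for n
  define D where "D n = Inf (en ` H n)" for n
  have HC: "f \<in> C1H" if "f \<in> H n" for f n
    using chull_C1H[of "um ` {n..}" f] that um unfolding H_def by blast
  have Hm: "um m \<in> H n" if "m \<ge> n" for m n using that by (auto simp: H_def intro: chull.base)
  have Hne: "en ` H n \<noteq> {}" for n using Hm[of n n] by blast
  have Hbd: "bdd_below (en ` H n)" for n by (rule bdd_belowI[of _ 0]) (auto simp: en_nonneg)
  have Hmono: "H j \<subseteq> H k" if "k \<le> j" for j k
  proof
    fix f assume "f \<in> H j"
    moreover have "um ` {j..} \<subseteq> um ` {k..}" using that by auto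
    ultimately show "f \<in> H k" unfolding H_def using chull_mono by blast
  qed
  have D_le: "D n \<le> en f" if "f \<in> H n" for f n
    unfolding D_def using that Hbd by (intro cInf_lower) auto
  have "incseq D"
    unfolding incseq_def D_def using Hmono Hne Hbd by (intro allI impI cInf_superset_mono) (auto intro: image_mono)
  moreover have DC: "D n \<le> C" for n using D_le[OF Hm[of n n]] bd[of n] by simp
  ultimately obtain d where d: "D \<longlonglongrightarrow> d" "\<And>n. D n \<le> d"
    using incseq_convergent[of D C] by blast
  have "\<exists>n0. \<forall>n\<ge>n0. d - D n \<le> 1 / 4^k" for k :: nat
  proof -
    have "\<forall>\<^sub>F n in sequentially. dist (D n) d < 1 / 4^k"
      by (rule tendstoD[OF d(1)]) simp
    then obtain n0 where n0: "\<And>n. n \<ge> n0 \<Longrightarrow> dist (D n) d < 1 / 4^k"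
      unfolding eventually_sequentially by blast
    have "d - D n \<le> 1/4^k" if "n \<ge> n0" for n
      using n0[OF that] by (simp add: dist_real_def)
    then show ?thesis by blast
  qed
  then obtain pick where pick: "\<And>k n. n \<ge> pick k \<Longrightarrow> d - D n \<le> 1 / 4^k" by metis
  \<comment> \<open>The sum makes \<open>N\<close> monotone, the summand \<open>k\<close> makes it unbounded.\<close>
  define N where "N k = k + (\<Sum>i\<le>k. pick i)" for k :: nat
  have Nk: "N k \<ge> k" for k by (simp add: N_def)
  have Np: "N k \<ge> pick k" for k
    unfolding N_def using member_le_sum[of k "{..k}" pick] by simp
  have Nm: "N k \<le> N j" if "k \<le> j" for j k
    unfolding N_def using that by (intro add_mono sum_mono2) auto
  have "\<exists>f\<in>H (N k). en f < D (N k) + 1 / 4^k" for k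
    using cInf_lessD[OF Hne, of "N k" "D (N k) + 1/4^k"] by (auto simp: D_def)
  then obtain v where v: "\<And>k. v k \<in> H (N k)" "\<And>k. en (v k) < D (N k) + 1 / 4^k" by metis
  have p1: "en (\<lambda>x. v j x - v k x) \<le> 6 / 4^k" if "j \<ge> k" for j k
  proof -
    have vj: "v j \<in> H (N k)" using v(1)[of j] Hmono[OF Nm[OF that]] by blast
    have "(\<lambda>x. (1 - 1/2) * v j x + 1/2 * v k x) \<in> H (N k)"
      using vj v(1)[of k] unfolding H_def by (intro chull.step) auto
    from D_le[OF this] have "D (N k) \<le> (1 - 1/2) * en (v j) + 1/2 * en (v k) - 1/2 * (1 - 1/2) * en (\<lambda>x. v j x - v k x)"
      unfolding en_convex_identity[OF HC[OF v(1)] HC[OF v(1)]] .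
    then have "en (\<lambda>x. v j x - v k x) \<le> 2 * en (v j) + 2 * en (v k) - 4 * D (N k)" by simp
    moreover have "en (v j) \<le> d + 1/4^k"
    proof -
      have "1 / 4^j \<le> (1::real) / 4^k" using that by (intro divide_left_mono power_increasing) auto
      then show ?thesis using v(2)[of j] d(2)[of "N j"] by linarith
    qed
    moreover have "d - D (N k) \<le> 1 / 4^k" by (rule pick[OF Np])
    ultimately have "en (\<lambda>x. v j x - v k x) \<le> 6 * (1 / 4^k)" using v(2)[of k] by linarith
    then show ?thesis by simp
  qed
  have p2: "(1 - 1 / 2^k) * en (\<lambda>x. v k x - um m x) \<le> en (um m) - en (v k) + 1 / 2^k" if m: "m \<ge> N k" for k m
  proof -
    define t where "t = (1 / 2^k :: real)"
    have t: "0 < t" "t \<le> 1" by (auto simp: t_def)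
    have t2: "1 / 4^k = t * t" by (simp add: t_def flip: power_mult_distrib)
    have "(\<lambda>x. (1 - t) * v k x + t * um m x) \<in> H (N k)"
      using v(1)[of k] Hm[OF m] t unfolding H_def by (intro chull.step) auto
    from D_le[OF this] have "D (N k) \<le> (1 - t) * en (v k) + t * en (um m) - t * (1 - t) * en (\<lambda>x. v k x - um m x)"
      unfolding en_convex_identity[OF HC[OF v(1)] um] .
    then have "t * ((1 - t) * en (\<lambda>x. v k x - um m x)) \<le> t * (en (um m) - en (v k) + t)"
      using v(2)[of k] unfolding t2 by (simp add: algebra_simps)
    then show ?thesis using t(1) unfolding t_def[symmetric] by (simp add: mult_le_cancel_left_pos)
  qed
  have p3: "(\<lambda>k. en (v k)) \<longlonglongrightarrow> d"
  proof (rule tendsto_sandwich)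
    have "(\<lambda>k. 1 / (4::real)^k) \<longlonglongrightarrow> 0"
      using LIMSEQ_power_zero[of "1/4::real"] by (simp add: power_divide)
    then show "(\<lambda>k. d - 1 / 4^k) \<longlonglongrightarrow> d" "(\<lambda>k. d + 1 / 4^k) \<longlonglongrightarrow> d"
      using tendsto_diff[OF tendsto_const[of d]] tendsto_add[OF tendsto_const[of d]] by fastforce+
    show "\<forall>\<^sub>F k in sequentially. d - 1 / 4^k \<le> en (v k)"
    proof (rule always_eventually, rule allI)
      fix k show "d - 1 / 4^k \<le> en (v k)" using pick[OF Np, of k] D_le[OF v(1)[of k]] by linarith
    qed
    show "\<forall>\<^sub>F k in sequentially. en (v k) \<le> d + 1 / 4^k"
    proof (rule always_eventually, rule allI)
      fix k show "en (v k) \<le> d + 1 / 4^k" using v(2)[of k] d(2)[of "N k"] by linarith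
    qed
  qed
  have p4: "d - 1 / 4^k \<le> en (um m)" if "m \<ge> N k" for k m
    using D_le[OF Hm[OF that]] pick[OF Np, of k] by linarith
  show thesis using that[of v N d] v(1) Nk p1 p2 p3 p4 unfolding H_def by blast
qed

end

section \<open>Completeness of square-integrable functions\<close>

text \<open>
The weights \<open>2^k\<close> keep the sum of \<open>2^k (f (k+1) - f k)\<^sup>2\<close> integrable; where it is finite, the increments
decay geometrically. The estimate for the limit is Fatou's lemma.
\<close>

lemma L2_limit:
  fixes f :: "nat \<Rightarrow> 'a \<Rightarrow> real"
  assumes [measurable]: "\<And>k. f k \<in> borel_measurable M"
    and C: "C \<ge> 0" and cauchy: "\<And>j k. j \<ge> k \<Longrightarrow> (\<integral>\<^sup>+x. ennreal ((f j x - f k x)\<^sup>2) \<partial>M) \<le> ennreal (C / 4^k)"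
  obtains g where "g \<in> borel_measurable M" "AE x in M. (\<lambda>k. f k x) \<longlonglongrightarrow> g x"
    "\<And>k. (\<integral>\<^sup>+x. ennreal ((g x - f k x)\<^sup>2) \<partial>M) \<le> ennreal (C / 4^k)"
proof -
  define g where "g x = lim (\<lambda>k. f k x)" for x
  have g[measurable]: "g \<in> borel_measurable M" unfolding g_def by measurable
  define S where "S x = (\<Sum>k. ennreal (2^k * (f (Suc k) x - f k x)\<^sup>2))" for x
  have [measurable]: "S \<in> borel_measurable M" unfolding S_def by measurable
  have "(\<integral>\<^sup>+x. S x \<partial>M) = (\<Sum>k. \<integral>\<^sup>+x. ennreal (2^k * (f (Suc k) x - f k x)\<^sup>2) \<partial>M)"
    unfolding S_def by (rule nn_integral_suminf) measurable
  also have "\<dots> \<le> (\<Sum>k. ennreal (C * (1/2)^k))"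
  proof (rule suminf_le)
    fix k
    have "(\<integral>\<^sup>+x. ennreal (2^k * (f (Suc k) x - f k x)\<^sup>2) \<partial>M) = ennreal (2^k) * (\<integral>\<^sup>+x. ennreal ((f (Suc k) x - f k x)\<^sup>2) \<partial>M)"
      by (subst nn_integral_cmult[symmetric]) (auto simp: ennreal_mult)
    also have "\<dots> \<le> ennreal (2^k) * ennreal (C / 4^k)" by (intro mult_left_mono cauchy) auto
    also have "\<dots> = ennreal (C * (1/2)^k)"
    proof -
      have "(2::real)^k * (C / 4^k) = C * (1/2)^k"
        by (simp add: field_simps flip: power_mult_distrib)
      then show ?thesis using C by (simp flip: ennreal_mult)
    qed
    finally show "(\<integral>\<^sup>+x. ennreal (2^k * (f (Suc k) x - f k x)\<^sup>2) \<partial>M) \<le> ennreal (C * (1/2)^k)" .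
  qed auto
  also have "\<dots> < \<infinity>"
  proof -
    have "summable (\<lambda>k. C * (1/2)^k)" by (intro summable_mult summable_geometric) auto
    then have "(\<Sum>k. ennreal (C * (1/2)^k)) = ennreal (\<Sum>k. C * (1/2)^k)"
      using C by (intro suminf_ennreal2) auto
    then show ?thesis by simp
  qed
  finally have "AE x in M. S x \<noteq> \<infinity>" by (intro nn_integral_PInf_AE) auto
  then have lim: "AE x in M. (\<lambda>k. f k x) \<longlonglongrightarrow> g x"
  proof (rule AE_mp, intro AE_I2 impI)
    fix x assume "S x \<noteq> \<infinity>"
    then obtain B where B: "S x = ennreal B" "B \<ge> 0" by (cases "S x") auto
    have bd: "2^k * (f (Suc k) x - f k x)\<^sup>2 \<le> B" for k
    proof -
      have "ennreal (2^k * (f (Suc k) x - f k x)\<^sup>2) = (\<Sum>k\<in>{k}. ennreal (2^k * (f (Suc k) x - f k x)\<^sup>2))" by simp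
      also have "\<dots> \<le> S x" unfolding S_def by (rule sum_le_suminf) auto
      finally show ?thesis using B by (simp add: ennreal_le_iff)
    qed
    have "summable (\<lambda>k. f (Suc k) x - f k x)"
    proof (rule summable_comparison_test')
      show "summable (\<lambda>k. sqrt B * (sqrt (1/2))^k)"
        by (intro summable_mult summable_geometric) (auto simp: real_sqrt_divide)
      fix k :: nat
      have "(f (Suc k) x - f k x)\<^sup>2 \<le> B * (1/2)^k"
        using bd[of k] by (simp add: field_simps power_one_over)
      then have "\<bar>f (Suc k) x - f k x\<bar> \<le> sqrt (B * (1/2)^k)"
        by (rule real_le_rsqrt[where x="\<bar>f (Suc k) x - f k x\<bar>", simplified])
      then show "norm (f (Suc k) x - f k x) \<le> sqrt B * (sqrt (1/2))^k"
        by (simp add: real_sqrt_mult real_sqrt_power)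
    qed
    then have "convergent (\<lambda>k. f k x - f 0 x)"
      using sum_lessThan_telescope[of "\<lambda>k. f k x"] by (simp add: summable_iff_convergent)
    from convergent_add[OF this convergent_const[of "f 0 x"]]
    have "convergent (\<lambda>k. f k x)" by simp
    then show "(\<lambda>k. f k x) \<longlonglongrightarrow> g x" unfolding g_def by (simp add: convergent_LIMSEQ_iff)
  qed
  have "(\<integral>\<^sup>+x. ennreal ((g x - f k x)\<^sup>2) \<partial>M) \<le> ennreal (C / 4^k)" for k
  proof -
    have "(\<integral>\<^sup>+x. ennreal ((g x - f k x)\<^sup>2) \<partial>M) = (\<integral>\<^sup>+x. liminf (\<lambda>j. ennreal ((f j x - f k x)\<^sup>2)) \<partial>M)"
    proof (rule nn_integral_cong_AE, rule AE_mp[OF lim], intro AE_I2 impI)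
      fix x assume "(\<lambda>k. f k x) \<longlonglongrightarrow> g x"
      then have "(\<lambda>j. ennreal ((f j x - f k x)\<^sup>2)) \<longlonglongrightarrow> ennreal ((g x - f k x)\<^sup>2)"
        by (intro tendsto_ennrealI tendsto_intros)
      then show "ennreal ((g x - f k x)\<^sup>2) = liminf (\<lambda>j. ennreal ((f j x - f k x)\<^sup>2))"
        by (intro lim_imp_Liminf[symmetric]) auto
    qed
    also have "\<dots> \<le> liminf (\<lambda>j. \<integral>\<^sup>+x. ennreal ((f j x - f k x)\<^sup>2) \<partial>M)"
      by (rule nn_integral_liminf) measurable
    also have "\<dots> \<le> ennreal (C / 4^k)"
      by (rule Liminf_le) (auto simp: eventually_sequentially intro!: exI[of _ k] cauchy)
    finally show ?thesis .
  qed
  with g lim show thesis by (rule that)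
qed

section \<open>Smooth bump functions\<close>

lemma Ck_Suc_D: "Ck (Suc k) f \<Longrightarrow> Ck k f"
proof (induction k arbitrary: f)
  case 0
  then show ?case by (simp add: Ck.simps differentiable_imp_continuous_on)
next
  case (Suc k)
  then show ?case unfolding Ck.simps(2)[of "Suc k"] Ck.simps(2)[of k] by blast
qed

lemma Ck_differentiable: "Ck (Suc k) f \<Longrightarrow> f differentiable (at x)"
  by (simp add: Ck.simps(2) differentiable_on_def)

lemma has_derivative_frechet: "f differentiable (at x) \<Longrightarrow> (f has_derivative frechet_derivative f (at x)) (at x)"
  by (simp add: frechet_derivative_works)

lemma Ck_const [simp]: "Ck k (\<lambda>_. c)"
proof (induction k arbitrary: c)
  case (Suc k)
  have "partial_deriv i (\<lambda>_. c) = (\<lambda>_. 0)" for i :: 'a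
    using partial_deriv_eq[OF has_derivative_const] by blast
  then show ?case using Suc by (simp add: Ck.simps(2))
qed simp

lemma Ck_add: "Ck k f \<Longrightarrow> Ck k g \<Longrightarrow> Ck k (\<lambda>x. f x + g x)"
proof (induction k arbitrary: f g)
  case 0
  then show ?case by (simp add: continuous_on_add)
next
  case (Suc k)
  have "partial_deriv i (\<lambda>x. f x + g x) x = partial_deriv i f x + partial_deriv i g x" for i x
    using partial_deriv_eq[OF has_derivative_add[OF has_derivative_frechet has_derivative_frechet, OF Ck_differentiable[OF Suc.prems(1)] Ck_differentiable[OF Suc.prems(2)]]]
    by (simp add: partial_deriv_def)
  then have "partial_deriv i (\<lambda>x. f x + g x) = (\<lambda>x. partial_deriv i f x + partial_deriv i g x)" for i by blast
  then show ?case using Suc by (simp add: Ck.simps(2) differentiable_on_add)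
qed

lemma Ck_mult: "Ck k f \<Longrightarrow> Ck k g \<Longrightarrow> Ck k (\<lambda>x. f x * g x)"
proof (induction k arbitrary: f g)
  case 0
  then show ?case by (simp add: continuous_on_mult)
next
  case (Suc k)
  have "partial_deriv i (\<lambda>x. f x * g x) x = f x * partial_deriv i g x + partial_deriv i f x * g x" for i x
    using partial_deriv_eq[OF has_derivative_mult[OF has_derivative_frechet has_derivative_frechet, OF Ck_differentiable[OF Suc.prems(1)] Ck_differentiable[OF Suc.prems(2)]]]
    by (simp add: partial_deriv_def)
  then have "partial_deriv i (\<lambda>x. f x * g x) = (\<lambda>x. f x * partial_deriv i g x + partial_deriv i f x * g x)" for i by blast
  moreover have "Ck k (\<lambda>x. f x * partial_deriv i g x + partial_deriv i f x * g x)" for i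
    using Suc.prems Ck_Suc_D[OF Suc.prems(1)] Ck_Suc_D[OF Suc.prems(2)]
    by (intro Ck_add Suc.IH) (auto simp: Ck.simps(2))
  moreover have "(\<lambda>x. f x * g x) differentiable_on UNIV"
    using Suc.prems by (simp add: Ck.simps(2) differentiable_on_mult)
  ultimately show ?case by (simp add: Ck.simps(2))
qed

lemma Ck_prod: "finite I \<Longrightarrow> (\<And>i. i \<in> I \<Longrightarrow> Ck k (f i)) \<Longrightarrow> Ck k (\<lambda>x. \<Prod>i\<in>I. f i x)"
  by (induction I rule: finite_induct) (auto intro: Ck_mult)

text \<open>
The functions \<open>q(1/t) exp(-1/t)\<close>, extended by 0, form a class closed under differentiation, so all of them
are smooth.
\<close>

definition flat :: "real poly \<Rightarrow> real \<Rightarrow> real" where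
  "flat q t = (if t > 0 then poly q (1/t) * exp (- (1/t)) else 0)"

definition flat_deriv :: "real poly \<Rightarrow> real poly" where
  "flat_deriv q = [:0,0,1:] * (q - pderiv q)"

lemma poly_div_exp_tendsto_0: "((\<lambda>y. poly q y * exp (- y)) \<longlongrightarrow> (0::real)) at_top"
proof -
  have "((\<lambda>y. \<Sum>i\<le>degree q. coeff q i * (y ^ i / exp y)) \<longlongrightarrow> (\<Sum>i\<le>degree q. coeff q i * 0)) at_top"
    by (intro tendsto_intros tendsto_power_div_exp_0)
  then show ?thesis by (simp add: poly_altdef sum_distrib_right exp_minus divide_inverse mult.assoc)
qed

lemma flat_has_derivative: "(flat q has_field_derivative flat (flat_deriv q) t) (at t)"
proof (cases t "0::real" rule: linorder_cases)
  case less
  have "((\<lambda>_. 0) has_field_derivative 0) (at t)" by simp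
  then have "(flat q has_field_derivative 0) (at t)"
    by (rule has_field_derivative_transform_within_open[of _ _ _ "{..<0}"]) (use less in \<open>auto simp: flat_def\<close>)
  then show ?thesis using less by (simp add: flat_def)
next
  case greater
  have "((\<lambda>t. poly q (1/t) * exp (- (1/t))) has_field_derivative
      poly (pderiv q) (1/t) * (- 1 / t\<^sup>2) * exp (- (1/t)) + poly q (1/t) * (exp (- (1/t)) * (1 / t\<^sup>2))) (at t)"
    using greater by (auto intro!: derivative_eq_intros DERIV_chain2[OF poly_DERIV] simp: power2_eq_square field_simps)
  moreover have "poly (pderiv q) (1/t) * (- 1 / t\<^sup>2) * exp (- (1/t)) + poly q (1/t) * (exp (- (1/t)) * (1 / t\<^sup>2)) = flat (flat_deriv q) t"
    using greater by (simp add: flat_def flat_deriv_def power2_eq_square field_simps)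
  ultimately have "((\<lambda>t. poly q (1/t) * exp (- (1/t))) has_field_derivative flat (flat_deriv q) t) (at t)" by simp
  then show ?thesis
    by (rule has_field_derivative_transform_within_open[of _ _ _ "{0<..}"]) (use greater in \<open>auto simp: flat_def\<close>)
next
  case equal
  have R: "((\<lambda>h. flat q h / h) \<longlongrightarrow> 0) (at_right 0)"
  proof -
    have "((\<lambda>h. poly (pCons 0 q) (inverse h) * exp (- inverse h)) \<longlongrightarrow> 0) (at_right (0::real))"
      by (rule filterlim_compose[OF poly_div_exp_tendsto_0 filterlim_inverse_at_top_right])
    moreover have "\<forall>\<^sub>F h in at_right 0. poly (pCons 0 q) (inverse h) * exp (- inverse h) = flat q h / h"
      by (rule eventually_at_rightI[of 0 1]) (auto simp: flat_def field_simps)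
    ultimately show ?thesis by (rule Lim_transform_eventually)
  qed
  have L: "((\<lambda>h. flat q h / h) \<longlongrightarrow> 0) (at_left 0)"
  proof (rule Lim_transform_eventually[OF tendsto_const])
    show "\<forall>\<^sub>F h in at_left 0. 0 = flat q h / h"
      by (rule eventually_at_leftI[of "-1"]) (auto simp: flat_def)
  qed
  have "((\<lambda>h. flat q h / h) \<longlongrightarrow> 0) (at 0)"
    using L R by (simp add: filterlim_split_at_real)
  then show ?thesis using equal by (simp add: has_field_derivative_iff flat_def)
qed

lemma Ck_flat_component:
  fixes i :: "'n::finite"
  shows "Ck k (\<lambda>x::real^'n. flat q (\<alpha> * x$i + \<beta>))"
proof (induction k arbitrary: q)
  case 0
  have "continuous_on UNIV (flat q)"
    using flat_has_derivative by (meson DERIV_isCont continuous_at_imp_continuous_on)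
  then show ?case by (auto intro!: continuous_on_compose2[of UNIV "flat q"] continuous_intros)
next
  case (Suc k)
  have D: "((\<lambda>x::real^'n. flat q (\<alpha> * x$i + \<beta>)) has_derivative (\<lambda>h. flat (flat_deriv q) (\<alpha> * x$i + \<beta>) * (\<alpha> * h$i))) (at x)" for x
  proof -
    have "((\<lambda>x::real^'n. \<alpha> * x$i + \<beta>) has_derivative (\<lambda>h. \<alpha> * h$i)) (at x)"
      using bounded_linear_imp_has_derivative[OF bounded_linear_vec_nth[of i], of "at x"]
      by (auto intro!: derivative_eq_intros)
    from has_derivative_compose[OF this flat_has_derivative[unfolded has_field_derivative_def]] show ?thesis .
  qed
  have "partial_deriv j (\<lambda>x::real^'n. flat q (\<alpha> * x$i + \<beta>)) = (\<lambda>x. flat (flat_deriv q) (\<alpha> * x$i + \<beta>) * (\<alpha> * axis j 1 $ i))" for j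
    using partial_deriv_eq[OF D] by blast
  moreover have "(\<lambda>x::real^'n. flat q (\<alpha> * x$i + \<beta>)) differentiable_on UNIV"
    using D by (auto simp: differentiable_on_def differentiable_def)
  ultimately show ?case using Suc.IH by (simp add: Ck.simps(2) Ck_mult)
qed

text \<open>
The factors vanish off the open box. Scaling the argument by \<open>n + 1\<close> lets the product tend to the indicator
of the box, since \<open>exp(-1/(n t))\<close> tends to 1.
\<close>

definition bump :: "real^'n \<Rightarrow> real^'n \<Rightarrow> nat \<Rightarrow> real^'n \<Rightarrow> real" where
  "bump c d n x = (\<Prod>i\<in>UNIV. flat 1 (real (Suc n) * x$i + - real (Suc n) * c$i) * flat 1 (- real (Suc n) * x$i + real (Suc n) * d$i))"

lemma flat1: "flat 1 t = (if t > 0 then exp (- (1/t)) else 0)" by (simp add: flat_def)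

lemma flat1_bounds: "0 \<le> flat 1 t" "flat 1 t \<le> 1" by (auto simp: flat1)

lemma bump_bounds: "0 \<le> bump c d n x" "bump c d n x \<le> 1"
  unfolding bump_def by (auto intro!: prod_nonneg prod_le_1 mult_nonneg_nonneg mult_le_one flat1_bounds)

lemma bump_pos_iff: "bump c d n x \<noteq> 0 \<longleftrightarrow> x \<in> box c d"
proof -
  have 1: "real (Suc n) * y + - real (Suc n) * z > 0 \<longleftrightarrow> z < y" for y z :: real
    by (simp add: algebra_simps del: of_nat_Suc)
  have 2: "- real (Suc n) * y + real (Suc n) * z > 0 \<longleftrightarrow> y < z" for y z :: real
    by (simp add: algebra_simps del: of_nat_Suc)
  show ?thesis
    unfolding bump_def flat1 1 2 mem_box_cart by auto
qed

lemma bump_test_function: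
  assumes "cbox c d \<subseteq> W"
  shows "bump c d n \<in> test_functions W"
proof -
  have "Ck k (bump c d n)" for k
    unfolding bump_def[abs_def] by (intro Ck_prod Ck_mult Ck_flat_component) simp
  moreover have "supp (bump c d n) \<subseteq> cbox c d"
    unfolding bump_pos_iff by (intro closure_minimal) (auto simp: box_subset_cbox)
  moreover from this have "compact (supp (bump c d n))"
    by (meson bounded_cbox bounded_subset closed_closure compact_eq_bounded_closed)
  ultimately show ?thesis using assms unfolding test_functions_def Cck_def by blast
qed

lemma bump_tendsto: "(\<lambda>n. bump c d n x) \<longlonglongrightarrow> indicator (box c d) x"
proof (cases "x \<in> box c d")
  case True
  have lim: "(\<lambda>n. flat 1 (real (Suc n) * t)) \<longlonglongrightarrow> 1" if "t > 0" for t
  proof -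
    have "(\<lambda>n. exp (- (inverse (real (Suc n)) * (1/t)))) \<longlonglongrightarrow> exp (- (0 * (1/t)))"
      by (intro tendsto_intros LIMSEQ_inverse_real_of_nat)
    moreover have "exp (- (inverse (real (Suc n)) * (1/t))) = flat 1 (real (Suc n) * t)" for n
      using that by (simp add: flat1 field_simps add_pos_nonneg)
    ultimately show ?thesis by simp
  qed
  have "(\<lambda>n. \<Prod>i\<in>UNIV. flat 1 (real (Suc n) * (x$i - c$i)) * flat 1 (real (Suc n) * (d$i - x$i))) \<longlonglongrightarrow> (\<Prod>i\<in>(UNIV::'a set). 1 * 1)"
    using True by (intro tendsto_prod tendsto_mult lim) (auto simp: mem_box_cart)
  moreover have "bump c d n x = (\<Prod>i\<in>UNIV. flat 1 (real (Suc n) * (x$i - c$i)) * flat 1 (real (Suc n) * (d$i - x$i)))" for n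
    unfolding bump_def by (simp add: algebra_simps)
  ultimately show ?thesis using True by simp
next
  case False
  then have "bump c d n x = 0" for n using bump_pos_iff by blast
  then show ?thesis using False by simp
qed

section \<open>Uniqueness of weak derivatives\<close>

text \<open>
The positive and the negative part are densities of measures that agree on the open boxes, a generator of the
Borel sets stable under intersections.
\<close>

lemma AE_zero_of_box_integrals:
  fixes f :: "real^'n \<Rightarrow> real"
  assumes f: "integrable lebesgue f" and box: "\<And>c d. (LINT x:box c d|lebesgue. f x) = 0"
  shows "AE x in lebesgue. f x = 0"
proof -
  have "f \<in> borel_measurable (completion lborel)" using f by (rule borel_measurable_integrable)
  then obtain g where g[measurable]: "g \<in> borel_measurable lborel" and fg: "AE x in lborel. f x = g x"
    using completion_ex_borel_measurable_real by blast
  have fg': "AE x in lebesgue. f x = g x" using fg by (rule AE_completion)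
  have "integrable lebesgue g"
    by (rule integrable_cong_AE_imp[OF f _ fg'])
       (use g in \<open>simp add: measurable_completion\<close>)
  then have gi: "integrable lborel g" by (simp add: integrable_completion)
  have gbox: "(LINT x:box c d|lborel. g x) = 0" for c d
  proof -
    have "(LINT x:box c d|lborel. g x) = (LINT x:box c d|lebesgue. g x)"
      unfolding set_lebesgue_integral_def by (subst integral_completion) auto
    also have "\<dots> = (LINT x:box c d|lebesgue. f x)"
      unfolding set_lebesgue_integral_def
    proof (rule integral_cong_AE)
      have "g \<in> borel_measurable lebesgue" "f \<in> borel_measurable lebesgue"
        using g f by (auto intro: measurable_completion)
      then show "(\<lambda>x. indicat_real (box c d) x *\<^sub>R g x) \<in> borel_measurable lebesgue"
        "(\<lambda>x. indicat_real (box c d) x *\<^sub>R f x) \<in> borel_measurable lebesgue"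
        by (auto intro!: borel_measurable_times borel_measurable_indicator)
      show "AE x in lebesgue. indicat_real (box c d) x *\<^sub>R g x = indicat_real (box c d) x *\<^sub>R f x"
        using fg' by eventually_elim simp
    qed
    finally show ?thesis using box by simp
  qed
  define \<mu> where "\<mu> = density lborel (\<lambda>x. ennreal (g x))"
  define \<nu> where "\<nu> = density lborel (\<lambda>x. ennreal (- g x))"
  have eq: "emeasure \<mu> X = emeasure \<nu> X" "emeasure \<mu> X \<noteq> \<infinity>" if X: "X = box c d" for X c d
  proof -
    define h where "h x = indicat_real X x * g x" for x
    have [measurable]: "X \<in> sets borel" using X by simp
    have h: "integrable lborel h"
      using integrable_mult_indicator[of X lborel g] gi unfolding h_def by simp
    have e: "emeasure \<mu> X = (\<integral>\<^sup>+x. ennreal (h x) \<partial>lborel)" "emeasure \<nu> X = (\<integral>\<^sup>+x. ennreal (- h x) \<partial>lborel)"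
      unfolding \<mu>_def \<nu>_def h_def
      by (subst emeasure_density; (auto intro!: nn_integral_cong simp: indicator_def)?)+
    have fin: "(\<integral>\<^sup>+x. ennreal (h x) \<partial>lborel) \<noteq> \<infinity>" "(\<integral>\<^sup>+x. ennreal (- h x) \<partial>lborel) \<noteq> \<infinity>"
      using h real_integrable_def by blast+
    have "0 = (\<integral>x. h x \<partial>lborel)" using gbox[of c d] X by (simp add: set_lebesgue_integral_def h_def)
    also have "\<dots> = enn2real (\<integral>\<^sup>+x. ennreal (h x) \<partial>lborel) - enn2real (\<integral>\<^sup>+x. ennreal (- h x) \<partial>lborel)"
      by (rule real_lebesgue_integral_def[OF h])
    finally have "enn2real (\<integral>\<^sup>+x. ennreal (h x) \<partial>lborel) = enn2real (\<integral>\<^sup>+x. ennreal (- h x) \<partial>lborel)" by simp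
    then show "emeasure \<mu> X = emeasure \<nu> X" "emeasure \<mu> X \<noteq> \<infinity>" unfolding e using fin
      by (metis ennreal_enn2real infinity_ennreal_def less_top)+
  qed
  have "\<mu> = \<nu>"
  proof (rule measure_eqI_generator_eq)
    let ?E = "range (\<lambda>(a, b). box a b :: (real^'n) set)"
    show "Int_stable ?E" by (auto simp: Int_stable_def box_Int_box)
    show "?E \<subseteq> Pow UNIV" "sets \<mu> = sigma_sets UNIV ?E" "sets \<nu> = sigma_sets UNIV ?E"
      by (simp_all add: borel_eq_box \<mu>_def \<nu>_def)
    let ?A = "\<lambda>n::nat. box (- (real n *\<^sub>R One)) (real n *\<^sub>R One) :: (real^'n) set"
    show "range ?A \<subseteq> ?E" by auto
    show "(\<Union>i. ?A i) = UNIV" unfolding UN_box_eq_UNIV by auto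
    show "emeasure \<mu> (?A i) \<noteq> \<infinity>" for i using eq(2)[OF refl] .
    show "emeasure \<mu> X = emeasure \<nu> X" if "X \<in> ?E" for X using that eq(1) by auto
  qed
  then have "AE x in lborel. ennreal (g x) = ennreal (- g x)"
    unfolding \<mu>_def \<nu>_def by (subst sigma_finite_measure.density_unique_iff[OF sigma_finite_lborel, symmetric]) auto
  with fg have "AE x in lborel. f x = 0"
  proof eventually_elim
    case (elim x)
    then show ?case
      by (cases "g x" "0::real" rule: linorder_cases) (auto simp: ennreal_neg ennreal_eq_0_iff)
  qed
  then show ?thesis by (rule AE_completion)
qed

lemma integrable_on_compact_mult:
  fixes g \<psi> :: "real^'n \<Rightarrow> real"
  assumes g: "locally_integrable_on W g" and \<psi>: "continuous_on UNIV \<psi>"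
    and K: "compact K" "K \<subseteq> W" "\<And>x. x \<notin> K \<Longrightarrow> \<psi> x = 0"
  shows "integrable lebesgue (\<lambda>x. g x * \<psi> x)"
proof -
  have Kl: "K \<in> sets lebesgue" using K(1) by (simp add: compact_imp_closed)
  have "integrable (lebesgue_on K) g" using g K unfolding locally_integrable_on_def by blast
  then have i: "integrable lebesgue (\<lambda>x. indicat_real K x *\<^sub>R g x)"
    using Kl by (subst (asm) integrable_restrict_space) auto
  have "compact (\<psi> ` K)" using \<psi> K(1) by (meson compact_continuous_image continuous_on_subset subset_UNIV)
  then obtain B where B: "\<And>x. x \<in> K \<Longrightarrow> \<bar>\<psi> x\<bar> \<le> B"
    using compact_imp_bounded bounded_iff by (metis image_eqI real_norm_def)
  have [measurable]: "\<psi> \<in> borel_measurable lebesgue"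
    using borel_measurable_continuous_onI[OF \<psi>] by (intro measurable_completion) simp
  have eq: "g x * \<psi> x = (indicat_real K x *\<^sub>R g x) * \<psi> x" for x
    using K(3)[of x] by (cases "x \<in> K") auto
  show ?thesis
  proof (rule Bochner_Integration.integrable_bound[OF integrable_mult_right[OF i, of "\<bar>B\<bar>"]])
    have "(\<lambda>x. (indicat_real K x *\<^sub>R g x) * \<psi> x) \<in> borel_measurable lebesgue"
      using borel_measurable_integrable[OF i] by measurable
    moreover have "(\<lambda>x. g x * \<psi> x) = (\<lambda>x. (indicat_real K x *\<^sub>R g x) * \<psi> x)"
      by (rule ext) (rule eq)
    ultimately show "(\<lambda>x. g x * \<psi> x) \<in> borel_measurable lebesgue" by (simp only:)
    show "AE x in lebesgue. norm (g x * \<psi> x) \<le> norm (\<bar>B\<bar> * (indicat_real K x *\<^sub>R g x))"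
    proof (rule AE_I2)
      fix x show "norm (g x * \<psi> x) \<le> norm (\<bar>B\<bar> * (indicat_real K x *\<^sub>R g x))"
      proof (cases "x \<in> K")
        case True
        have "\<bar>\<psi> x\<bar> \<le> \<bar>B\<bar>" using B[OF True] by linarith
        from mult_right_mono[OF this, of "\<bar>g x\<bar>"] True show ?thesis by (simp add: abs_mult mult.commute)
      next
        case False
        then show ?thesis using K(3)[OF False] by simp
      qed
    qed
  qed
qed

lemma integral_lebesgue_on_support:
  fixes f :: "real^'n \<Rightarrow> real"
  assumes "W \<in> sets lebesgue" "\<And>x. x \<notin> W \<Longrightarrow> f x = 0"
  shows "(\<integral>x. f x \<partial>lebesgue_on W) = (\<integral>x. f x \<partial>lebesgue)"
proof -
  have "(\<integral>x. f x \<partial>lebesgue_on W) = (\<integral>x. indicat_real W x *\<^sub>R f x \<partial>lebesgue)"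
    by (rule integral_restrict_space) (simp add: assms(1))
  also have "\<dots> = (\<integral>x. f x \<partial>lebesgue)"
  proof (rule Bochner_Integration.integral_cong[OF refl])
    show "indicat_real W x *\<^sub>R f x = f x" for x
      using assms(2)[of x] by (cases "x \<in> W") simp_all
  qed
  finally show ?thesis .
qed

lemma test_functions_C1: "\<phi> \<in> test_functions W \<Longrightarrow> \<phi> \<in> Cck 1 W"
  unfolding test_functions_def by (rule INT_D[OF _ UNIV_I])

text \<open>
Testing with bump functions shows that the integral over every box in \<open>W\<close> vanishes.
\<close>

lemma fundamental_lemma:
  fixes h :: "real^'n \<Rightarrow> real"
  assumes h: "locally_integrable_on W h" and W: "open W"
    and z: "\<And>\<phi>. \<phi> \<in> test_functions W \<Longrightarrow> (\<integral>x. h x * \<phi> x \<partial>lebesgue_on W) = 0"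
  shows "AE x in lebesgue_on W. h x = 0"
proof -
  have Wl: "W \<in> sets lebesgue" using borel_open[OF W] by (intro sets_completionI_sets) (simp only: sets_lborel)
  have box0: "(LINT x:box c d|lebesgue. h x) = 0" if cd: "cbox c d \<subseteq> W" for c d
  proof -
    have "integrable (lebesgue_on (cbox c d)) h"
      using h[unfolded locally_integrable_on_def, rule_format, OF compact_cbox cd] .
    then have i: "integrable lebesgue (\<lambda>x. indicat_real (cbox c d) x *\<^sub>R h x)"
      by (subst (asm) integrable_restrict_space) auto
    define s where "s n x = (indicat_real (cbox c d) x *\<^sub>R h x) * bump c d n x" for n x
    have bm: "bump c d n \<in> borel_measurable lebesgue" for n
    proof -
      have "continuous_on UNIV (bump c d n)"
        using Cck1_D(4)[OF test_functions_C1[OF bump_test_function[OF cd]]] .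
      then show ?thesis using borel_measurable_continuous_onI by (intro measurable_completion) simp
    qed
    have "(\<lambda>n. \<integral>x. s n x \<partial>lebesgue) \<longlonglongrightarrow> (\<integral>x. (indicat_real (cbox c d) x *\<^sub>R h x) * indicat_real (box c d) x \<partial>lebesgue)"
    proof (rule integral_dominated_convergence[where w="\<lambda>x. norm (indicat_real (cbox c d) x *\<^sub>R h x)"])
      show "(\<lambda>x. (indicat_real (cbox c d) x *\<^sub>R h x) * indicat_real (box c d) x) \<in> borel_measurable lebesgue"
        using borel_measurable_integrable[OF i] by (intro borel_measurable_times borel_measurable_indicator) auto
      show "s n \<in> borel_measurable lebesgue" for n
        unfolding s_def using borel_measurable_integrable[OF i] bm by (intro borel_measurable_times)
      show "integrable lebesgue (\<lambda>x. norm (indicat_real (cbox c d) x *\<^sub>R h x))" using i by (rule integrable_norm)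
      show "AE x in lebesgue. (\<lambda>n. s n x) \<longlonglongrightarrow> (indicat_real (cbox c d) x *\<^sub>R h x) * indicat_real (box c d) x"
        unfolding s_def by (intro AE_I2 tendsto_mult_left bump_tendsto)
      show "AE x in lebesgue. norm (s n x) \<le> norm (indicat_real (cbox c d) x *\<^sub>R h x)" for n
      proof (rule AE_I2)
        fix x
        have "\<bar>indicat_real (cbox c d) x *\<^sub>R h x\<bar> * \<bar>bump c d n x\<bar> \<le> \<bar>indicat_real (cbox c d) x *\<^sub>R h x\<bar> * 1"
          using bump_bounds[of c d n x] by (intro mult_left_mono) auto
        then show "norm (s n x) \<le> norm (indicat_real (cbox c d) x *\<^sub>R h x)" by (simp add: s_def abs_mult)
      qed
    qed
    moreover have "(\<integral>x. s n x \<partial>lebesgue) = 0" for n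
    proof -
      have sb: "s n x = h x * bump c d n x" for x
        using bump_pos_iff[of c d n x] box_subset_cbox[of c d] by (cases "x \<in> cbox c d") (auto simp: s_def)
      have "(\<integral>x. h x * bump c d n x \<partial>lebesgue_on W) = (\<integral>x. h x * bump c d n x \<partial>lebesgue)"
      proof (rule integral_lebesgue_on_support[OF Wl])
        fix x assume "x \<notin> W"
        then have "x \<notin> box c d" using cd box_subset_cbox[of c d] by blast
        then show "h x * bump c d n x = 0" using bump_pos_iff[of c d n x] by simp
      qed
      then show ?thesis unfolding sb using z[OF bump_test_function[OF cd]] by simp
    qed
    moreover have "(\<lambda>x. (indicat_real (cbox c d) x *\<^sub>R h x) * indicat_real (box c d) x) = (\<lambda>x. indicat_real (box c d) x *\<^sub>R h x)"
      using box_subset_cbox[of c d] by (auto simp: indicator_def fun_eq_iff)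
    ultimately show ?thesis
      unfolding set_lebesgue_integral_def by (simp add: LIMSEQ_const_iff)
  qed
  have cb: "AE x in lebesgue. x \<in> cbox c d \<longrightarrow> h x = 0" if cd: "cbox c d \<subseteq> W" for c d
  proof -
    have "integrable (lebesgue_on (cbox c d)) h"
      using h[unfolded locally_integrable_on_def, rule_format, OF compact_cbox cd] .
    then have i: "integrable lebesgue (\<lambda>x. indicat_real (cbox c d) x *\<^sub>R h x)"
      by (subst (asm) integrable_restrict_space) auto
    have nf: "AE x in lebesgue. x \<notin> cbox c d - box c d"
    proof (rule AE_not_in)
      have "negligible (cbox c d - box c d)" by (rule negligible_frontier_interval)
      then show "cbox c d - box c d \<in> null_sets lebesgue" by (simp add: negligible_iff_null_sets)
    qed
    have i2: "integrable lebesgue (\<lambda>x. indicat_real (box c d) x * h x)"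
    proof -
      have "integrable lebesgue (\<lambda>x. indicat_real (box c d) x *\<^sub>R (indicat_real (cbox c d) x *\<^sub>R h x))"
        by (rule integrable_mult_indicator[OF _ i]) simp
      moreover have "(\<lambda>x. indicat_real (box c d) x *\<^sub>R (indicat_real (cbox c d) x *\<^sub>R h x)) = (\<lambda>x. indicat_real (box c d) x * h x)"
        using box_subset_cbox[of c d] by (auto simp: indicator_def fun_eq_iff)
      ultimately show ?thesis by simp
    qed
    have "AE x in lebesgue. indicat_real (box c d) x * h x = 0"
    proof (rule AE_zero_of_box_integrals[OF i2])
      fix c' d'
      obtain c'' d'' where b: "box c' d' \<inter> box c d = box c'' d''" by (rule that[OF box_Int_box])
      have "(LINT x:box c' d'|lebesgue. indicat_real (box c d) x * h x) = (LINT x:box c'' d''|lebesgue. h x)"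
        unfolding set_lebesgue_integral_def b[symmetric]
        by (rule Bochner_Integration.integral_cong) (auto simp: indicator_def)
      also have "\<dots> = 0"
      proof (cases "box c'' d'' = {}")
        case True
        then show ?thesis by (simp add: set_lebesgue_integral_def)
      next
        case False
        then have ne: "box c d \<noteq> {}" using b by blast
        have "closure (box c'' d'') \<subseteq> closure (box c d)" using b by (intro closure_mono) blast
        then have "cbox c'' d'' \<subseteq> cbox c d" unfolding closure_box[OF False] closure_box[OF ne] .
        then show ?thesis using cd by (intro box0) blast
      qed
      finally show "(LINT x:box c' d'|lebesgue. indicat_real (box c d) x * h x) = 0" .
    qed
    with nf show ?thesis by eventually_elim auto
  qed
  obtain \<D> where D: "countable \<D>" "\<D> \<subseteq> Pow W" "\<And>X. X \<in> \<D> \<Longrightarrow> \<exists>a b. X = cbox a b" "\<Union>\<D> = W"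
    using open_countable_Union_open_cbox[OF W] by blast
  have "AE x in lebesgue. \<forall>X\<in>\<D>. x \<in> X \<longrightarrow> h x = 0"
  proof (subst AE_ball_countable[OF D(1)], rule ballI)
    fix X assume X: "X \<in> \<D>"
    then obtain c d where "X = cbox c d" using D(3) by blast
    moreover have "X \<subseteq> W" using X D(2) by blast
    ultimately show "AE x in lebesgue. x \<in> X \<longrightarrow> h x = 0" using cb by simp
  qed
  then have "AE x in lebesgue. x \<in> W \<longrightarrow> h x = 0"
    unfolding D(4)[symmetric] by eventually_elim blast
  then show ?thesis using Wl by (subst AE_restrict_space_iff) auto
qed

lemma locally_integrable_diff:
  "locally_integrable_on W f \<Longrightarrow> locally_integrable_on W g \<Longrightarrow> locally_integrable_on W (\<lambda>x. f x - g x)"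
  unfolding locally_integrable_on_def by (intro allI impI Bochner_Integration.integrable_diff) simp_all

lemma integrable_test:
  assumes "locally_integrable_on W g" "\<phi> \<in> Cck 1 W"
  shows "integrable lebesgue (\<lambda>x. g x * \<phi> x)" "integrable lebesgue (\<lambda>x. g x * partial_deriv i \<phi> x)"
proof -
  note D = Cck1_D[OF assms(2)]
  show "integrable lebesgue (\<lambda>x. g x * \<phi> x)"
    by (rule integrable_on_compact_mult[OF assms(1) D(4) D(2,3)]) (rule zero_off_support(1))
  show "integrable lebesgue (\<lambda>x. g x * partial_deriv i \<phi> x)"
    by (rule integrable_on_compact_mult[OF assms(1) D(5) D(2,3)]) (rule zero_off_support(2))
qed

lemma integral_test_eq:
  assumes W: "open W" and \<phi>: "\<phi> \<in> Cck 1 W"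
  shows "(\<integral>x. g x * \<phi> x \<partial>lebesgue_on W) = (\<integral>x. g x * \<phi> x \<partial>lebesgue)"
    "(\<integral>x. g x * partial_deriv i \<phi> x \<partial>lebesgue_on W) = (\<integral>x. g x * partial_deriv i \<phi> x \<partial>lebesgue)"
proof -
  have z: "\<phi> x = 0" "partial_deriv i \<phi> x = 0" if "x \<notin> W" for x
    using that Cck1_D(3)[OF \<phi>] zero_off_support[of x \<phi>] by blast+
  show "(\<integral>x. g x * \<phi> x \<partial>lebesgue_on W) = (\<integral>x. g x * \<phi> x \<partial>lebesgue)"
    "(\<integral>x. g x * partial_deriv i \<phi> x \<partial>lebesgue_on W) = (\<integral>x. g x * partial_deriv i \<phi> x \<partial>lebesgue)"
    using W by (auto intro!: integral_lebesgue_on_support simp: z)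
qed

lemma has_weak_partial_unique:
  assumes W: "open W" and g: "has_weak_partial W i u g" and g': "has_weak_partial W i u g'"
  shows "AE x in lebesgue_on W. g x = g' x"
proof -
  have l: "locally_integrable_on W g" "locally_integrable_on W g'"
    using g g' unfolding has_weak_partial_def by blast+
  have "AE x in lebesgue_on W. g x - g' x = 0"
  proof (rule fundamental_lemma[OF locally_integrable_diff[OF l] W])
    fix \<phi> assume \<phi>: "\<phi> \<in> test_functions W"
    note C = test_functions_C1[OF \<phi>]
    have "- (\<integral>x. g x * \<phi> x \<partial>lebesgue_on W) = - (\<integral>x. g' x * \<phi> x \<partial>lebesgue_on W)"
      using g g' \<phi> unfolding has_weak_partial_def by (fast elim: trans[OF sym])
    then have "(\<integral>x. g x * \<phi> x \<partial>lebesgue_on W) = (\<integral>x. g' x * \<phi> x \<partial>lebesgue_on W)" by linarith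
    then have "(\<integral>x. g x * \<phi> x \<partial>lebesgue) = (\<integral>x. g' x * \<phi> x \<partial>lebesgue)"
      unfolding integral_test_eq(1)[OF W C] .
    then show "(\<integral>x. (g x - g' x) * \<phi> x \<partial>lebesgue_on W) = 0"
      unfolding integral_test_eq(1)[OF W C]
      unfolding left_diff_distrib
      using Bochner_Integration.integral_diff[OF integrable_test(1)[OF l(1) C] integrable_test(1)[OF l(2) C]] by simp
  qed
  then show ?thesis by eventually_elim simp
qed

text \<open>
The constant \<open>weak_partial\<close> is an arbitrary choice among all weak derivatives, hence only determined up to a
null set.
\<close>

lemma weak_partial_AE:
  assumes "open W" "has_weak_partial W i u g"
  shows "AE x in lebesgue_on W. weak_partial W i u x = g x"
  by (rule has_weak_partial_unique[OF assms(1) _ assms(2)])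
     (use assms(2) in \<open>simp add: weak_partial_def someI\<close>)

lemma has_weak_partial_diff:
  assumes W: "open W" and u: "has_weak_partial W i u g" and v: "has_weak_partial W i v h"
  shows "has_weak_partial W i (\<lambda>x. u x - v x) (\<lambda>x. g x - h x)"
proof -
  have l: "locally_integrable_on W u" "locally_integrable_on W g" "locally_integrable_on W v" "locally_integrable_on W h"
    using u v unfolding has_weak_partial_def by blast+
  have "(\<integral>x. (u x - v x) * partial_deriv i \<phi> x \<partial>lebesgue_on W) = - (\<integral>x. (g x - h x) * \<phi> x \<partial>lebesgue_on W)"
    if \<phi>: "\<phi> \<in> test_functions W" for \<phi>
  proof -
    note C = test_functions_C1[OF \<phi>]
    have "(\<integral>x. u x * partial_deriv i \<phi> x \<partial>lebesgue) = - (\<integral>x. g x * \<phi> x \<partial>lebesgue)"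
      "(\<integral>x. v x * partial_deriv i \<phi> x \<partial>lebesgue) = - (\<integral>x. h x * \<phi> x \<partial>lebesgue)"
      using u v \<phi> unfolding has_weak_partial_def integral_test_eq[OF W C, symmetric] by blast+
    then show ?thesis
      unfolding integral_test_eq[OF W C]
      unfolding left_diff_distrib
      using Bochner_Integration.integral_diff[OF integrable_test(2)[OF l(1) C] integrable_test(2)[OF l(3) C], of i i]
        Bochner_Integration.integral_diff[OF integrable_test(1)[OF l(2) C] integrable_test(1)[OF l(4) C]] by simp
  qed
  then show ?thesis unfolding has_weak_partial_def using locally_integrable_diff[OF l(1,3)] locally_integrable_diff[OF l(2,4)] by blast
qed

lemma locally_integrable_continuous:
  fixes f :: "real^'n \<Rightarrow> real"
  assumes "continuous_on UNIV f" shows "locally_integrable_on W f"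
  unfolding locally_integrable_on_def
proof (intro allI impI)
  fix K :: "(real^'n) set" assume K: "compact K" "K \<subseteq> W"
  have "set_integrable lborel K f"
    using K(1) by (intro continuous_set_integrable[OF assms]) (auto simp: compact_imp_closed compact_imp_bounded)
  then have i: "integrable lborel (\<lambda>x. indicat_real K x *\<^sub>R f x)" by (simp only: set_integrable_def)
  have "integrable lebesgue (\<lambda>x. indicat_real K x *\<^sub>R f x)"
    using integrable_completion[OF borel_measurable_integrable[OF i]] i by blast
  then show "integrable (lebesgue_on K) f"
    using K(1) by (subst integrable_restrict_space) (auto simp: compact_imp_closed)
qed

lemma C1_product_partial:
  fixes u \<phi> :: "real^'n \<Rightarrow> real"
  assumes u: "Ck (Suc 0) u" and \<phi>: "Ck (Suc 0) \<phi>"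
  shows "Ck (Suc 0) (\<lambda>x. u x * \<phi> x)"
    "partial_deriv i (\<lambda>x. u x * \<phi> x) = (\<lambda>x. u x * partial_deriv i \<phi> x + partial_deriv i u x * \<phi> x)"
proof -
  show "Ck (Suc 0) (\<lambda>x. u x * \<phi> x)" using assms by (rule Ck_mult)
  have "partial_deriv i (\<lambda>x. u x * \<phi> x) x = u x * partial_deriv i \<phi> x + partial_deriv i u x * \<phi> x" for x
    using partial_deriv_eq[OF has_derivative_mult[OF has_derivative_frechet has_derivative_frechet, OF Ck_differentiable[OF u] Ck_differentiable[OF \<phi>]]]
    by (simp add: partial_deriv_def)
  then show "partial_deriv i (\<lambda>x. u x * \<phi> x) = (\<lambda>x. u x * partial_deriv i \<phi> x + partial_deriv i u x * \<phi> x)" by blast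
qed

lemma integration_by_parts:
  fixes u \<phi> :: "real^'n \<Rightarrow> real"
  assumes u: "Ck (Suc 0) u" and \<phi>: "\<phi> \<in> Cck 1 W"
  shows "(\<integral>x. u x * partial_deriv i \<phi> x \<partial>lborel) = - (\<integral>x. partial_deriv i u x * \<phi> x \<partial>lborel)"
proof -
  define K where "K = closure {x. \<phi> x \<noteq> 0}"
  note pr = C1_product_partial[OF u Cck1_D(1)[OF \<phi>]]
  have z: "\<phi> x = 0" "partial_deriv i \<phi> x = 0" if "x \<notin> K" for x
    using that zero_off_support[of x \<phi>] unfolding K_def by blast+
  have "(\<lambda>x. u x * \<phi> x) \<in> Cck 1 UNIV"
    using Cck1_D(2)[OF \<phi>] by (intro Cck1_I[OF pr(1), of K]) (auto simp: K_def[symmetric] z)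
  from integral_partial_deriv_zero[OF this, of i]
  have "(\<integral>x. u x * partial_deriv i \<phi> x + partial_deriv i u x * \<phi> x \<partial>lborel) = 0" unfolding pr(2) .
  moreover have "integrable lborel (\<lambda>x. u x * partial_deriv i \<phi> x)" "integrable lborel (\<lambda>x. partial_deriv i u x * \<phi> x)"
  proof -
    have K: "compact K" using Cck1_D(2)[OF \<phi>] by (simp only: K_def)
    show "integrable lborel (\<lambda>x. u x * partial_deriv i \<phi> x)"
      by (rule compact_support_integrable[OF _ K], intro continuous_on_mult Ck_imp_continuous[OF u] Cck1_D(5)[OF \<phi>])
         (simp add: z)
    show "integrable lborel (\<lambda>x. partial_deriv i u x * \<phi> x)"
      by (rule compact_support_integrable[OF _ K], intro continuous_on_mult Ck1_partial_continuous[OF u] Cck1_D(4)[OF \<phi>])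
         (simp add: z)
  qed
  ultimately show ?thesis by simp
qed

lemma integral_lebesgue_lborel:
  fixes f :: "real^'n \<Rightarrow> real"
  assumes "f \<in> borel_measurable borel"
  shows "(\<integral>x. f x \<partial>lebesgue) = (\<integral>x. f x \<partial>lborel)"
  using assms by (intro integral_completion) simp

lemma C1_has_weak_partial:
  assumes W: "open W" and u: "Ck (Suc 0) u"
  shows "has_weak_partial W i u (partial_deriv i u)"
  unfolding has_weak_partial_def
proof (intro conjI ballI)
  show "locally_integrable_on W u" "locally_integrable_on W (partial_deriv i u)"
    by (intro locally_integrable_continuous Ck_imp_continuous[OF u] Ck1_partial_continuous[OF u])+
  fix \<phi> assume "\<phi> \<in> test_functions W"
  then have C: "\<phi> \<in> Cck 1 W" by (rule test_functions_C1)
  have m: "(\<lambda>x. u x * partial_deriv i \<phi> x) \<in> borel_measurable borel" "(\<lambda>x. partial_deriv i u x * \<phi> x) \<in> borel_measurable borel"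
    by (intro borel_measurable_continuous_onI continuous_on_mult Ck_imp_continuous[OF u] Ck1_partial_continuous[OF u] Cck1_D[OF C])+
  show "(\<integral>x. u x * partial_deriv i \<phi> x \<partial>lebesgue_on W) = - (\<integral>x. partial_deriv i u x * \<phi> x \<partial>lebesgue_on W)"
    unfolding integral_test_eq[OF W C] integral_lebesgue_lborel[OF m(1)] integral_lebesgue_lborel[OF m(2)]
    by (rule integration_by_parts[OF u C])
qed

text \<open>
On a compact set the weight \<open>\<rho>\<close> is bounded below by some \<open>m > 0\<close>. With \<open>t = 2^-k\<close> the inequality
\<open>y \<le> t + y\<^sup>2/t\<close> turns the bound \<open>C/4^k\<close> for the squares into a multiple of \<open>2^-k\<close>.
\<close>

lemma local_L1_convergence:
  fixes f :: "real^'n \<Rightarrow> real" and F :: "nat \<Rightarrow> real^'n \<Rightarrow> real"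
  assumes f[measurable]: "f \<in> borel_measurable borel" and F: "\<And>k. continuous_on UNIV (F k)"
    and \<rho>m[measurable]: "\<rho> \<in> borel_measurable borel" and \<rho>: "continuous_on W \<rho>" "\<And>x. x \<in> W \<Longrightarrow> \<rho> x > 0" "\<And>x. \<rho> x \<ge> 0"
    and C: "C \<ge> 0" "\<And>k. (\<integral>\<^sup>+x. ennreal (\<rho> x * (f x - F k x)\<^sup>2) \<partial>lborel) \<le> ennreal (C / 4^k)"
    and K: "compact K" "K \<subseteq> W"
  shows "set_integrable lborel K f" "(\<lambda>k. LINT x:K|lborel. \<bar>f x - F k x\<bar>) \<longlonglongrightarrow> 0"
proof -
  have [measurable]: "F k \<in> borel_measurable borel" for k using F by (rule borel_measurable_continuous_onI)
  have [measurable]: "K \<in> sets borel" using K(1) by (simp add: compact_imp_closed)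
  obtain m where m: "m > 0" "\<And>x. x \<in> K \<Longrightarrow> m \<le> \<rho> x"
  proof (cases "K = {}")
    case False
    obtain x0 where "x0 \<in> K" "\<And>x. x \<in> K \<Longrightarrow> \<rho> x0 \<le> \<rho> x"
      using continuous_attains_inf[OF K(1) False continuous_on_subset[OF \<rho>(1) K(2)]] by blast
    then show thesis using that[of "\<rho> x0"] \<rho>(2) K(2) by blast
  qed (use that[of 1] in auto)
  define V where "V = measure lborel K"
  have Kfin: "emeasure lborel K < \<infinity>" using K(1) by (intro emeasure_bounded_finite compact_imp_bounded)
  then have eK: "emeasure lborel K = ennreal V" unfolding V_def by (intro emeasure_eq_ennreal_measure) auto
  have V: "V \<ge> 0" by (simp add: V_def)
  have est: "(\<integral>\<^sup>+x. ennreal (indicat_real K x * \<bar>f x - F k x\<bar>) \<partial>lborel) \<le> ennreal ((V + C / m) / 2^k)" for k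
  proof -
    define t where "t = (1 / 2^k :: real)"
    have t: "t > 0" and t2: "1 / 4^k = t * t" by (auto simp: t_def simp flip: power_mult_distrib)
    have "(\<integral>\<^sup>+x. ennreal (indicat_real K x * \<bar>f x - F k x\<bar>) \<partial>lborel)
      \<le> (\<integral>\<^sup>+x. ennreal t * indicator K x + ennreal (1 / (t * m)) * ennreal (\<rho> x * (f x - F k x)\<^sup>2) \<partial>lborel)"
    proof (rule nn_integral_mono)
      fix x
      have "indicat_real K x * \<bar>f x - F k x\<bar> \<le> t * indicat_real K x + 1 / (t * m) * (\<rho> x * (f x - F k x)\<^sup>2)"
      proof (cases "x \<in> K")
        case True
        define y where "y = \<bar>f x - F k x\<bar>"
        have y0: "y \<ge> 0" by (simp add: y_def)
        have "y \<le> t + y\<^sup>2 / t"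
        proof (cases "y \<le> t")
          case True
          then show ?thesis using t by (simp add: add_increasing2)
        next
          case False
          then have "y * t \<le> y * y" using y0 by (intro mult_left_mono) auto
          then have "y \<le> y\<^sup>2 / t" using t by (simp add: pos_le_divide_eq power2_eq_square)
          then show ?thesis using t by linarith
        qed
        also have "y\<^sup>2 / t = 1 / (t * m) * (m * y\<^sup>2)" using m(1) t by simp
        also have "\<dots> \<le> 1 / (t * m) * (\<rho> x * y\<^sup>2)"
          using m True t by (intro mult_left_mono mult_right_mono) auto
        finally show ?thesis using True by (simp add: y_def)
      qed (use \<rho>(3)[of x] m(1) t in auto)
      then have "ennreal (indicat_real K x * \<bar>f x - F k x\<bar>) \<le> ennreal (t * indicat_real K x + 1 / (t * m) * (\<rho> x * (f x - F k x)\<^sup>2))"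
        by (rule ennreal_leI)
      also have "\<dots> = ennreal t * indicator K x + ennreal (1 / (t * m)) * ennreal (\<rho> x * (f x - F k x)\<^sup>2)"
      proof -
        have "ennreal (1 / (t * m) * (\<rho> x * (f x - F k x)\<^sup>2)) = ennreal (1 / (t * m)) * ennreal (\<rho> x * (f x - F k x)\<^sup>2)"
          using t m(1) by (intro ennreal_mult') simp
        moreover have "ennreal (t * indicat_real K x) = ennreal t * indicator K x"
          by (cases "x \<in> K") auto
        ultimately show ?thesis using t m(1) \<rho>(3)[of x] by (subst ennreal_plus) auto
      qed
      finally show "ennreal (indicat_real K x * \<bar>f x - F k x\<bar>) \<le> ennreal t * indicator K x + ennreal (1 / (t * m)) * ennreal (\<rho> x * (f x - F k x)\<^sup>2)" .
    qed
    also have "\<dots> = ennreal t * emeasure lborel K + ennreal (1 / (t * m)) * (\<integral>\<^sup>+x. ennreal (\<rho> x * (f x - F k x)\<^sup>2) \<partial>lborel)"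
      by (subst nn_integral_add) (auto simp: nn_integral_cmult nn_integral_cmult_indicator)
    also have "\<dots> \<le> ennreal t * ennreal V + ennreal (1 / (t * m)) * ennreal (C / 4^k)"
      unfolding eK by (intro add_left_mono mult_left_mono C(2)) auto
    also have "\<dots> = ennreal (t * V + 1 / (t * m) * (C / 4^k))"
    proof -
      have "ennreal (1 / (t * m) * (C / 4^k)) = ennreal (1 / (t * m)) * ennreal (C / 4^k)"
        using t m(1) by (intro ennreal_mult') simp
      moreover have "ennreal (t * V) = ennreal t * ennreal V" using t by (intro ennreal_mult') simp
      ultimately show ?thesis using t V m(1) C(1) by (subst ennreal_plus) auto
    qed
    also have "t * V + 1 / (t * m) * (C / 4^k) = (V + C / m) / 2^k"
    proof -
      have "1 / (t * m) * (C / 4^k) = 1 / (t * m) * (C * (t * t))" unfolding t2[symmetric] by simp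
      also have "\<dots> = t * (C / m)" using t m(1) by simp
      finally show ?thesis by (simp add: t_def add_divide_distrib)
    qed
    finally show ?thesis .
  qed
  have i: "set_integrable lborel K (\<lambda>x. f x - F k x)" for k
    unfolding set_integrable_def
  proof (rule integrableI_bounded)
    have "(\<integral>\<^sup>+x. ennreal (norm (indicat_real K x *\<^sub>R (f x - F k x))) \<partial>lborel) = (\<integral>\<^sup>+x. ennreal (indicat_real K x * \<bar>f x - F k x\<bar>) \<partial>lborel)"
      by (intro nn_integral_cong) (simp add: abs_mult)
    also have "\<dots> < \<infinity>" using est[of k] by (rule le_less_trans) simp
    finally show "(\<integral>\<^sup>+x. ennreal (norm (indicat_real K x *\<^sub>R (f x - F k x))) \<partial>lborel) < \<infinity>" .
  qed measurable
  have iF: "set_integrable lborel K (F k)" for k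
    using K(1) by (intro continuous_set_integrable[OF F]) (auto simp: compact_imp_bounded)
  show "set_integrable lborel K f"
    using set_integral_add(1)[OF i[of 0] iF[of 0]] by simp
  have le: "(LINT x:K|lborel. \<bar>f x - F k x\<bar>) \<le> (V + C / m) / 2^k" for k
  proof -
    have "ennreal (LINT x:K|lborel. \<bar>f x - F k x\<bar>) = (\<integral>\<^sup>+x. ennreal (indicat_real K x * \<bar>f x - F k x\<bar>) \<partial>lborel)"
      using set_integrable_abs[OF i[of k]] unfolding set_lebesgue_integral_def set_integrable_def
      by (subst nn_integral_eq_integral) auto
    then have "ennreal (LINT x:K|lborel. \<bar>f x - F k x\<bar>) \<le> ennreal ((V + C / m) / 2^k)" using est[of k] by (simp only:)
    then show ?thesis using V C(1) m(1) by (subst (asm) ennreal_le_iff) auto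
  qed
  show "(\<lambda>k. LINT x:K|lborel. \<bar>f x - F k x\<bar>) \<longlonglongrightarrow> 0"
  proof (rule tendsto_sandwich[OF _ _ tendsto_const])
    show "\<forall>\<^sub>F k in sequentially. 0 \<le> (LINT x:K|lborel. \<bar>f x - F k x\<bar>)"
      by (intro always_eventually allI hbox_integral_nonneg) simp
    show "\<forall>\<^sub>F k in sequentially. (LINT x:K|lborel. \<bar>f x - F k x\<bar>) \<le> (V + C / m) / 2^k"
      using le by (intro always_eventually allI)
    have "(\<lambda>k. (V + C / m) * (1 / 2)^k) \<longlonglongrightarrow> (V + C / m) * 0"
      by (intro tendsto_mult_left LIMSEQ_power_zero) simp
    then show "(\<lambda>k. (V + C / m) / 2^k) \<longlonglongrightarrow> 0" by (simp add: power_divide)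
  qed
qed

context degenerate_energy
begin

section \<open>The optimal constant and minimising sequences\<close>

definition S :: real where "S = sobolev_const a b s"

lemma mass_pos:
  assumes u: "u \<in> C1H" and nz: "u \<noteq> (\<lambda>_. 0)"
  shows "mass u > 0"
proof (rule ccontr)
  assume "\<not> mass u > 0"
  then have "mass u = 0" using mass_nonneg[of u] by linarith
  then have "AE x in lborel. \<bar>u x\<bar> powr p = 0"
    unfolding mass_def using integrable_mass[OF u] by (subst (asm) integral_nonneg_eq_0_iff_AE) auto
  then have ae: "AE x in lborel. \<not> (u x \<noteq> 0)" by eventually_elim simp
  have op: "open {x. u x \<noteq> 0}"
    by (intro open_Collect_neq Cck1_D(4)[OF u] continuous_on_const)
  then have "{x. u x \<noteq> 0} \<in> null_sets lborel"
    using ae by (subst AE_iff_null_sets) auto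
  then have "negligible {x. u x \<noteq> 0}"
    unfolding negligible_iff_null_sets by (rule null_sets_completionI)
  moreover have "{x. u x \<noteq> 0} \<noteq> {}" using nz by auto
  ultimately show False using open_not_negligible[OF op] by blast
qed

lemma exists_C1H_nonzero: "\<exists>u\<in>C1H. u \<noteq> (\<lambda>_. 0)"
proof -
  define c d :: "real^'n" where "c = (\<chi> i. 1)" and "d = (\<chi> i. 3)"
  have sub: "cbox c d \<subseteq> HS" by (auto simp: mem_box_cart half_space_def c_def dest!: spec[of _ a])
  have "(\<chi> i. 2) \<in> box c d" by (simp add: mem_box_cart c_def d_def)
  then have "bump c d 0 (\<chi> i. 2) \<noteq> 0" using bump_pos_iff by blast
  then have "bump c d 0 \<noteq> (\<lambda>_. 0)" by (metis (mono_tags))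
  then show ?thesis using test_functions_C1[OF bump_test_function[OF sub]] by blast
qed

lemma quotient_bdd_below: "bdd_below ((\<lambda>u. sobolev_quotient a b s (\<lambda>i. partial_deriv i u) u) ` (C1H - {\<lambda>_. 0}))"
proof (rule bdd_belowI[of _ 0])
  fix y assume "y \<in> (\<lambda>u. sobolev_quotient a b s (\<lambda>i. partial_deriv i u) u) ` (C1H - {\<lambda>_. 0})"
  then obtain u where "u \<in> C1H" "y = sobolev_quotient a b s (\<lambda>i. partial_deriv i u) u" by blast
  then show "0 \<le> y" using quotient_C1H[of u] en_nonneg[of u] by simp
qed

lemma S_pos: "S > 0"
proof -
  have "1 / (5 * Cw\<^sup>2) \<le> S"
    unfolding S_def sobolev_const_def
  proof (rule cINF_greatest)
    show "C1H - {\<lambda>_. 0} \<noteq> {}" using exists_C1H_nonzero by blast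
    fix u assume "u \<in> C1H - {\<lambda>_. 0}"
    then have u: "u \<in> C1H" "u \<noteq> (\<lambda>_. 0)" by auto
    have "mass u powr (2/p) > 0" using mass_pos[OF u] by simp
    then show "1 / (5 * Cw\<^sup>2) \<le> sobolev_quotient a b s (\<lambda>i. partial_deriv i u) u"
      unfolding quotient_C1H[OF u(1)] using sobolev_inequality[OF u(1)] Cw_pos by (simp add: field_simps)
  qed
  moreover have "1 / (5 * Cw\<^sup>2) > 0" using Cw_pos by simp
  ultimately show ?thesis by linarith
qed

lemma S_le:
  assumes u: "u \<in> C1H"
  shows "S * mass u powr (2/p) \<le> en u"
proof (cases "u = (\<lambda>_. 0)")
  case True
  have "mass u = 0" unfolding mass_def True by simp
  then show ?thesis using en_nonneg[of u] by simp
next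
  case False
  have "S \<le> en u / mass u powr (2/p)"
    unfolding S_def sobolev_const_def quotient_C1H[OF u, symmetric]
    using u False by (intro cINF_lower quotient_bdd_below) auto
  then show ?thesis using mass_pos[OF u False] by (simp add: field_simps)
qed

lemma scale_C1H:
  assumes u: "u \<in> C1H"
  shows "(\<lambda>x. t * u x) \<in> C1H" "en (\<lambda>x. t * u x) = t\<^sup>2 * en u" "mass (\<lambda>x. t * u x) = \<bar>t\<bar> powr p * mass u"
proof -
  show "(\<lambda>x. t * u x) \<in> C1H" using Cck1_lincomb[OF u u, of t 0] by simp
  have pd: "partial_deriv i (\<lambda>x. t * u x) = (\<lambda>x. t * partial_deriv i u x)" for i
    using Ck1_lincomb(2)[OF Cck1_D(1)[OF u] Cck1_D(1)[OF u], of i t 0] by simp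
  have d: "dens (\<lambda>x. t * u x) x = t\<^sup>2 * dens u x" for x
    unfolding dens_def pd by (simp add: sum_distrib_left power_mult_distrib mult_ac)
  show "en (\<lambda>x. t * u x) = t\<^sup>2 * en u" unfolding en_def d by simp
  show "mass (\<lambda>x. t * u x) = \<bar>t\<bar> powr p * mass u" unfolding mass_def by (simp add: abs_mult powr_mult)
qed

text \<open>
The mass that \<open>mass_concentration\<close> guarantees on one box for a function of mass 1 and energy at most \<open>S + 1\<close>.
\<close>

definition kappa :: real where
  "kappa = (1 / (5 * Cw\<^sup>2 * (S + 1))) powr (1 / (1 - 2/p))"

lemma kappa_pos: "kappa > 0"
  using S_pos Cw_pos by (simp add: kappa_def)

lemma near_minimiser:
  assumes e: "0 < \<epsilon>" "\<epsilon> \<le> 1"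
  shows "\<exists>u\<in>C1H. mass u = 1 \<and> en u \<le> S + \<epsilon> \<and> kappa \<le> wint w0 (\<lambda>x. \<bar>u x\<bar> powr p)"
proof -
  have "Inf ((\<lambda>u. sobolev_quotient a b s (\<lambda>i. partial_deriv i u) u) ` (C1H - {\<lambda>_. 0})) < S + \<epsilon>"
    using e unfolding S_def sobolev_const_def by simp
  then obtain u0 where u0: "u0 \<in> C1H" "u0 \<noteq> (\<lambda>_. 0)" and q: "sobolev_quotient a b s (\<lambda>i. partial_deriv i u0) u0 < S + \<epsilon>"
    using cInf_lessD[of "(\<lambda>u. sobolev_quotient a b s (\<lambda>i. partial_deriv i u) u) ` (C1H - {\<lambda>_. 0})"] exists_C1H_nonzero by blast
  have m: "mass u0 > 0" by (rule mass_pos[OF u0])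
  \<comment> \<open>Normalises the mass to 1.\<close>
  define t where "t = mass u0 powr (- (1/p))"
  have t: "t > 0" using m by (simp add: t_def)
  define u1 where "u1 x = t * u0 x" for x
  have u1: "u1 \<in> C1H" "en u1 = t\<^sup>2 * en u0" "mass u1 = t powr p * mass u0"
    using scale_C1H[OF u0(1), of t] t unfolding u1_def[abs_def] by auto
  have "t powr p = mass u0 powr -1" unfolding t_def powr_powr using p_pos by simp
  then have m1: "mass u1 = 1" using u1(3) m by (simp add: powr_minus)
  have "t\<^sup>2 = mass u0 powr (- (2/p))" unfolding t_def using m by (simp add: powr_power)
  then have "en u1 = sobolev_quotient a b s (\<lambda>i. partial_deriv i u0) u0"
    unfolding quotient_C1H[OF u0(1)] u1(2) by (simp add: powr_minus field_simps)
  then have e1: "en u1 \<le> S + \<epsilon>" using q by simp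
  obtain w where w: "w \<in> whitney" and le: "mass u1 \<le> 5 * Cw\<^sup>2 * (wint w (\<lambda>x. \<bar>u1 x\<bar> powr p)) powr (1 - 2/p) * en u1"
    using mass_concentration[OF u1(1)] by blast
  define y where "y = wint w (\<lambda>x. \<bar>u1 x\<bar> powr p)"
  have y0: "y \<ge> 0" unfolding y_def by (rule wint_mass_nonneg)
  have "1 \<le> 5 * Cw\<^sup>2 * y powr (1 - 2/p) * (S + 1)"
  proof -
    have "5 * Cw\<^sup>2 * y powr (1 - 2/p) * en u1 \<le> 5 * Cw\<^sup>2 * y powr (1 - 2/p) * (S + 1)"
      using e1 e by (intro mult_left_mono) auto
    then show ?thesis using le m1 unfolding y_def by linarith
  qed
  then have "1 / (5 * Cw\<^sup>2 * (S + 1)) \<le> y powr (1 - 2/p)"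
  proof -
    have pos: "0 < 5 * Cw\<^sup>2 * (S + 1)" using S_pos Cw_pos by simp
    assume "1 \<le> 5 * Cw\<^sup>2 * y powr (1 - 2/p) * (S + 1)"
    then show ?thesis unfolding pos_divide_le_eq[OF pos] by (simp only: mult_ac)
  qed
  then have "kappa \<le> (y powr (1 - 2/p)) powr (1 / (1 - 2/p))"
    unfolding kappa_def using S_pos p_gt_2 by (intro powr_mono2) auto
  also have "\<dots> = y" unfolding powr_powr using p_gt_2 y0 by simp
  finally have ky: "kappa \<le> y" .
  obtain u where "u \<in> C1H" "en u = en u1" "mass u = mass u1" "wint w0 (\<lambda>x. \<bar>u x\<bar> powr p) = y"
    using rescale_to_w0[OF u1(1) w] unfolding y_def by blast
  then show ?thesis using ky m1 e1 by (intro bexI[of _ u]) auto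
qed

section \<open>Local compactness\<close>

lemma en_diff_le:
  assumes "f \<in> C1H" "g \<in> C1H"
  shows "en (\<lambda>x. f x - g x) \<le> 2 * en f + 2 * en g"
  using en_convex_identity[OF assms, of "1/2"] en_nonneg[of "\<lambda>x. (1 - 1/2) * f x + 1/2 * g x"] by simp

lemma powr_add_le_2:
  fixes x y :: real assumes "x \<ge> 0" "y \<ge> 0"
  shows "(x + y) powr p \<le> 2 powr p * (x powr p + y powr p)"
proof -
  have "(x + y) powr p \<le> (1 + 1) powr (p - 1) * (x powr p * 1 powr (1 - p) + y powr p * 1 powr (1 - p))"
    using assms p_gt_2 by (intro powr_add_le_split) auto
  also have "\<dots> \<le> 2 powr p * (x powr p + y powr p)"
    by (auto intro!: mult_mono powr_mono)
  finally show ?thesis .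
qed

lemma wbox_mass_via_averages:
  assumes z: "z \<in> C1H" and w: "w \<in> whitney" and n: "n > 0" and eta: "0 \<le> \<eta>"
    and av: "\<And>m. m \<in> cell_index n \<Longrightarrow> \<bar>avg (cell (corner w) (side (fst w)) n m) (side (fst w) /\<^sub>R real n) z\<bar> \<le> \<eta>"
  shows "wint w (\<lambda>x. \<bar>z x\<bar> powr p) \<le>
    2 powr p * ((Kp * real n powr - sobolev_gain CARD('n) p * sqrt (en z)) powr p + vol (side (fst w)) * \<eta> powr p)"
proof -
  define c where "c = cell (corner w) (side (fst w)) n"
  define l where "l = side (fst w) /\<^sub>R real n"
  have l: "l$i > 0" for i using n by (simp add: l_def side_pos)
  define A where "A m = avg (c m) l z" for m
  note cz = Cck1_D(4)[OF z]
  have one: "(LINT x:hbox (c m) l|lborel. \<bar>z x\<bar> powr p) \<le> 2 powr p * ((LINT x:hbox (c m) l|lborel. \<bar>z x - A m\<bar> powr p) + \<eta> powr p * vol l)"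
    if m: "m \<in> cell_index n" for m
  proof -
    have int: "set_integrable lborel (hbox (c m) l) (\<lambda>x. \<bar>z x - A m\<bar> powr p)" "set_integrable lborel (hbox (c m) l) (\<lambda>x. \<eta> powr p)"
      by (intro hbox_integrable continuous_powr_p continuous_intros cz)+
    have "(LINT x:hbox (c m) l|lborel. \<bar>z x\<bar> powr p) \<le> (LINT x:hbox (c m) l|lborel. 2 powr p * (\<bar>z x - A m\<bar> powr p + \<eta> powr p))"
    proof (intro set_integral_mono set_integrable_mult_right set_integral_add(1) int hbox_integrable continuous_powr_p cz)
      fix x
      have "\<bar>z x\<bar> powr p \<le> (\<bar>z x - A m\<bar> + \<eta>) powr p"
        using av[OF m] p_pos unfolding A_def c_def l_def by (intro powr_mono2) auto
      also have "\<dots> \<le> 2 powr p * (\<bar>z x - A m\<bar> powr p + \<eta> powr p)" using eta by (intro powr_add_le_2) auto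
      finally show "\<bar>z x\<bar> powr p \<le> 2 powr p * (\<bar>z x - A m\<bar> powr p + \<eta> powr p)" .
    qed
    also have "\<dots> = 2 powr p * ((LINT x:hbox (c m) l|lborel. \<bar>z x - A m\<bar> powr p) + \<eta> powr p * vol l)"
      using set_integral_add(2)[OF int] l by (simp add: set_integral_hbox_const less_imp_le)
    finally show ?thesis .
  qed
  have "wint w (\<lambda>x. \<bar>z x\<bar> powr p) = (\<Sum>m\<in>cell_index n. LINT x:hbox (c m) l|lborel. \<bar>z x\<bar> powr p)"
    unfolding wbox_def c_def l_def by (intro set_integral_cells n side_pos continuous_powr_p cz)
  also have "\<dots> \<le> (\<Sum>m\<in>cell_index n. 2 powr p * ((LINT x:hbox (c m) l|lborel. \<bar>z x - A m\<bar> powr p) + \<eta> powr p * vol l))"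
    by (rule sum_mono[OF one])
  also have "\<dots> = 2 powr p * ((\<Sum>m\<in>cell_index n. LINT x:hbox (c m) l|lborel. \<bar>z x - A m\<bar> powr p) + vol (side (fst w)) * \<eta> powr p)"
  proof -
    have "real n ^ CARD('n) * vol l = vol (side (fst w))" unfolding l_def vol_scale using n by simp
    then have "real n ^ CARD('n) * (\<eta> powr p * vol l) = vol (side (fst w)) * \<eta> powr p"
      by (metis mult.assoc mult.commute)
    then show ?thesis by (simp add: sum_distrib_left[symmetric] sum.distrib card_cell_index)
  qed
  also have "\<dots> \<le> 2 powr p * ((Kp * real n powr - sobolev_gain CARD('n) p * sqrt (en z)) powr p + vol (side (fst w)) * \<eta> powr p)"
  proof (intro mult_left_mono add_right_mono)
    have "wint w (dens z) \<le> en z"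
      using wint_sum_le[of "{w}" "dens z"] w integrable_dens[OF z] dens_nonneg by (simp add: en_def)
    then have "(Kp * real n powr - sobolev_gain CARD('n) p * sqrt (wint w (dens z))) powr p
       \<le> (Kp * real n powr - sobolev_gain CARD('n) p * sqrt (en z)) powr p"
      using Kp_pos p_pos wint_dens_nonneg by (intro powr_mono2 mult_left_mono mult_nonneg_nonneg) auto
    with cell_averages_whitney[OF z w n]
    show "(\<Sum>m\<in>cell_index n. LINT x:hbox (c m) l|lborel. \<bar>z x - A m\<bar> powr p)
      \<le> (Kp * real n powr - sobolev_gain CARD('n) p * sqrt (en z)) powr p"
      unfolding A_def c_def l_def by linarith
  qed auto
  finally show ?thesis .
qed

text \<open>
There are countably many cells of all subdivisions of all Whitney boxes, and the averages over each of them are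
bounded along the sequence, so they converge along a common subsequence. The difference of two late members then
has small averages over the cells of a fine subdivision, and \<open>wbox_mass_via_averages\<close> applies to it. The
integrals are divided by the volume plus 1 to make the bound uniform: \<open>\<bar>y\<bar> \<le> 1 + \<bar>y\<bar> powr p\<close>.
\<close>

lemma local_cauchy_subsequence:
  fixes um :: "nat \<Rightarrow> real^'n \<Rightarrow> real"
  assumes um: "\<And>m. um m \<in> C1H" and mass: "\<And>m. mass (um m) = 1" and en: "\<And>m. en (um m) \<le> C"
  obtains k :: "nat \<Rightarrow> nat" where "strict_mono k"
    "\<And>w \<epsilon>. w \<in> whitney \<Longrightarrow> \<epsilon> > 0 \<Longrightarrow> \<exists>M. \<forall>m\<ge>M. \<forall>m'\<ge>M. wint w (\<lambda>x. \<bar>um (k m) x - um (k m') x\<bar> powr p) \<le> \<epsilon>"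
proof -
  define cc where "cc = (\<lambda>(w, n, m). cell (corner w) (side (fst w)) n m)"
  define ll where "ll = (\<lambda>(w :: int \<times> ('n \<Rightarrow> int), n :: nat, m :: 'n \<Rightarrow> nat). side (fst w) /\<^sub>R real n)"
  define f where "f j i = (LINT x:hbox (cc i) (ll i)|lborel. um j x) / (vol (ll i) + 1)" for j i
  have ll0: "(ll i)$j \<ge> 0" for i j unfolding ll_def by (cases i) (simp add: side_pos less_imp_le)
  have vl0: "vol (ll i) \<ge> 0" for i unfolding vol_def using ll0 by (intro prod_nonneg) auto
  have bound: "norm (f j i) \<le> 1" for j i
  proof -
    have b1: "\<bar>y\<bar> \<le> 1 + \<bar>y\<bar> powr p" for y :: real
    proof (cases "\<bar>y\<bar> \<le> 1")
      case False
      then have "\<bar>y\<bar> powr 1 \<le> \<bar>y\<bar> powr p" using p_gt_2 by (intro powr_mono) auto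
      then show ?thesis using False by simp
    qed (simp add: add_increasing2)
    note cu = Cck1_D(4)[OF um[of j]]
    have int: "set_integrable lborel (hbox (cc i) (ll i)) (um j)" "set_integrable lborel (hbox (cc i) (ll i)) (\<lambda>x. 1::real)"
      "set_integrable lborel (hbox (cc i) (ll i)) (\<lambda>x. \<bar>um j x\<bar> powr p)" "set_integrable lborel (hbox (cc i) (ll i)) (\<lambda>x. \<bar>um j x\<bar>)"
      by (intro hbox_integrable continuous_powr_p continuous_intros cu)+
    have "\<bar>LINT x:hbox (cc i) (ll i)|lborel. um j x\<bar> \<le> (LINT x:hbox (cc i) (ll i)|lborel. \<bar>um j x\<bar>)"
      unfolding set_lebesgue_integral_def
      using integral_norm_bound[of lborel "\<lambda>x. indicat_real (hbox (cc i) (ll i)) x *\<^sub>R um j x"] by (simp add: abs_mult)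
    also have "\<dots> \<le> (LINT x:hbox (cc i) (ll i)|lborel. 1 + \<bar>um j x\<bar> powr p)"
      by (intro set_integral_mono int(4) set_integral_add(1)[OF int(2,3)] b1)
    also have "\<dots> = vol (ll i) + (LINT x:hbox (cc i) (ll i)|lborel. \<bar>um j x\<bar> powr p)"
      using set_integral_add(2)[OF int(2,3)] ll0 by (simp add: set_integral_hbox_const)
    also have "(LINT x:hbox (cc i) (ll i)|lborel. \<bar>um j x\<bar> powr p) \<le> mass (um j)"
      unfolding mass_def set_lebesgue_integral_def
      using int(3) integrable_mass[OF um[of j]] unfolding set_integrable_def
      by (intro integral_mono) (auto simp: indicator_def)
    finally show ?thesis using mass[of j] vl0[of i] by (simp add: f_def)
  qed
  obtain k where k: "strict_mono k" and conv: "\<And>i. \<exists>l. (\<lambda>j. f (k j) i) \<longlonglongrightarrow> l"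
    using function_convergent_subsequence[of "UNIV :: ((int \<times> ('n \<Rightarrow> int)) \<times> nat \<times> ('n \<Rightarrow> nat)) set" f 1] bound by auto
  define \<delta> where "\<delta> = sobolev_gain CARD('n) p"
  have \<delta>: "\<delta> > 0" unfolding \<delta>_def by (rule subcritical)
  have "\<exists>M. \<forall>m\<ge>M. \<forall>m'\<ge>M. wint w (\<lambda>x. \<bar>um (k m) x - um (k m') x\<bar> powr p) \<le> \<epsilon>"
    if w: "w \<in> whitney" and e: "\<epsilon> > 0" for w \<epsilon>
  proof -
    define V where "V = vol (side (fst w))"
    have V: "V > 0" unfolding V_def by (rule vol_pos) (rule side_pos)
    have C: "C \<ge> 0" using en[of 0] en_nonneg[of "um 0"] by linarith
    \<comment> \<open>Half of \<open>\<epsilon>\<close> is for the deviation from the averages, half for the averages; \<open>2 powr p\<close> is the constant of \<open>wbox_mass_via_averages\<close>.\<close>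
    define e2 where "e2 = \<epsilon> / (2 * 2 powr p)"
    have e2: "e2 > 0" using e by (simp add: e2_def)
    have "(\<lambda>n. (Kp * real n powr - \<delta> * sqrt (4 * C)) powr p) \<longlonglongrightarrow> (Kp * 0 * sqrt (4 * C)) powr p"
    proof (intro tendsto_powr2 tendsto_mult tendsto_const tendsto_neg_powr filterlim_real_sequentially)
      show "\<forall>\<^sub>F n in sequentially. 0 \<le> Kp * real n powr - \<delta> * sqrt (4 * C)"
        using Kp_pos C by (intro always_eventually) auto
    qed (use \<delta> p_pos in auto)
    then have "\<forall>\<^sub>F n in sequentially. (Kp * real n powr - \<delta> * sqrt (4 * C)) powr p < e2"
      using e2 p_pos by (intro order_tendstoD(2)) auto
    then have "\<forall>\<^sub>F n in sequentially. (Kp * real n powr - \<delta> * sqrt (4 * C)) powr p < e2 \<and> n > 0"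
      using eventually_gt_at_top[of 0] by eventually_elim auto
    then obtain n where n: "n > 0" "(Kp * real n powr - \<delta> * sqrt (4 * C)) powr p < e2"
      by (auto simp: eventually_sequentially)
    define \<eta> where "\<eta> = (e2 / V) powr (1/p)"
    have \<eta>: "\<eta> > 0" "V * \<eta> powr p = e2"
      using e2 V p_pos by (simp_all add: \<eta>_def powr_powr)
    define i where "i m = (w, n, m)" for m :: "'n \<Rightarrow> nat"
    have "\<exists>M. \<forall>j\<ge>M. \<forall>j'\<ge>M. \<bar>avg (cc (i m)) (ll (i m)) (um (k j)) - avg (cc (i m)) (ll (i m)) (um (k j'))\<bar> \<le> \<eta>" for m
    proof -
      have vp: "vol (ll (i m)) > 0" unfolding ll_def i_def using n side_pos by (intro vol_pos) simp
      define r where "r = (vol (ll (i m)) + 1) / vol (ll (i m))"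
      have r: "r > 0" using vp by (simp add: r_def)
      have av: "avg (cc (i m)) (ll (i m)) (um (k j)) = r * f (k j) (i m)" for j
        using vp by (simp add: avg_def f_def r_def)
      have "Cauchy (\<lambda>j. f (k j) (i m))" using conv[of "i m"] LIMSEQ_imp_Cauchy by blast
      then obtain M where M: "\<And>j j'. j \<ge> M \<Longrightarrow> j' \<ge> M \<Longrightarrow> dist (f (k j) (i m)) (f (k j') (i m)) < \<eta> / r"
        using \<eta>(1) r unfolding Cauchy_def by (metis divide_pos_pos)
      have "\<bar>avg (cc (i m)) (ll (i m)) (um (k j)) - avg (cc (i m)) (ll (i m)) (um (k j'))\<bar> \<le> \<eta>" if "j \<ge> M" "j' \<ge> M" for j j'
      proof -
        have "\<bar>r * f (k j) (i m) - r * f (k j') (i m)\<bar> = r * \<bar>f (k j) (i m) - f (k j') (i m)\<bar>"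
          using r by (simp add: abs_mult flip: right_diff_distrib)
        also have "\<dots> \<le> r * (\<eta> / r)" using M[OF that] r by (intro mult_left_mono) (auto simp: dist_real_def)
        finally show ?thesis unfolding av using r by simp
      qed
      then show ?thesis by blast
    qed
    then obtain Mf where Mf: "\<And>m j j'. j \<ge> Mf m \<Longrightarrow> j' \<ge> Mf m \<Longrightarrow>
        \<bar>avg (cc (i m)) (ll (i m)) (um (k j)) - avg (cc (i m)) (ll (i m)) (um (k j'))\<bar> \<le> \<eta>" by metis
    define M where "M = Max (Mf ` cell_index n)"
    have MM: "Mf m \<le> M" if "m \<in> cell_index n" for m unfolding M_def using that by (intro Max_ge) auto
    have "wint w (\<lambda>x. \<bar>um (k j) x - um (k j') x\<bar> powr p) \<le> \<epsilon>" if j: "j \<ge> M" "j' \<ge> M" for j j'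
    proof -
      define z where "z x = um (k j) x - um (k j') x" for x
      have z: "z \<in> C1H" unfolding z_def[abs_def] by (intro Cck1_diff um)
      have ez: "en z \<le> 4 * C"
        using en_diff_le[OF um[of "k j"] um[of "k j'"]] en[of "k j"] en[of "k j'"] unfolding z_def[abs_def] by linarith
      have "wint w (\<lambda>x. \<bar>z x\<bar> powr p) \<le> 2 powr p * ((Kp * real n powr - \<delta> * sqrt (en z)) powr p + V * \<eta> powr p)"
        unfolding \<delta>_def V_def
      proof (rule wbox_mass_via_averages[OF z w n(1)])
        fix m :: "'n \<Rightarrow> nat" assume m: "m \<in> cell_index n"
        have "avg (cc (i m)) (ll (i m)) z = avg (cc (i m)) (ll (i m)) (um (k j)) - avg (cc (i m)) (ll (i m)) (um (k j'))"
          unfolding avg_def z_def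
          using set_integral_diff(2)[OF hbox_integrable[OF Cck1_D(4)[OF um[of "k j"]]] hbox_integrable[OF Cck1_D(4)[OF um[of "k j'"]]]]
          by (simp add: diff_divide_distrib)
        then have "\<bar>avg (cc (i m)) (ll (i m)) z\<bar> \<le> \<eta>"
          using Mf[of m j j'] MM[OF m] j by simp
        then show "\<bar>avg (cell (corner w) (side (fst w)) n m) (side (fst w) /\<^sub>R real n) z\<bar> \<le> \<eta>"
          by (simp add: cc_def ll_def i_def)
      qed (use \<eta> in simp)
      also have "\<dots> \<le> 2 powr p * (e2 + e2)"
      proof (intro mult_left_mono add_mono)
        have "(Kp * real n powr - \<delta> * sqrt (en z)) powr p \<le> (Kp * real n powr - \<delta> * sqrt (4 * C)) powr p"
          using ez Kp_pos p_pos en_nonneg[of z] by (intro powr_mono2 mult_left_mono mult_nonneg_nonneg) auto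
        then show "(Kp * real n powr - \<delta> * sqrt (en z)) powr p \<le> e2" using n(2) by linarith
        show "V * \<eta> powr p \<le> e2" using \<eta>(2) by simp
      qed simp
      also have "\<dots> = \<epsilon>" by (simp add: e2_def)
      finally show ?thesis unfolding z_def .
    qed
    then show ?thesis by blast
  qed
  with k show thesis by (rule that)
qed

end

section \<open>The limit of an energy-Cauchy sequence\<close>

lemma fatou_bound:
  fixes f :: "'a \<Rightarrow> real" and F :: "nat \<Rightarrow> 'a \<Rightarrow> real"
  assumes F: "\<And>k. integrable M (F k)" "\<And>k x. F k x \<ge> 0" "\<And>k. (\<integral>x. F k x \<partial>M) \<le> B k"
    and f: "f \<in> borel_measurable M" "\<And>x. f x \<ge> 0"
    and lim: "AE x in M. (\<lambda>k. F k x) \<longlonglongrightarrow> f x" "B \<longlonglongrightarrow> B0"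
  shows "integrable M f" "(\<integral>x. f x \<partial>M) \<le> B0"
proof -
  have [measurable]: "F k \<in> borel_measurable M" for k using F(1) by (rule borel_measurable_integrable)
  have B0: "B k \<ge> 0" for k
  proof -
    have "0 \<le> (\<integral>x. F k x \<partial>M)" by (intro integral_nonneg_AE AE_I2 F(2))
    then show ?thesis using F(3)[of k] by linarith
  qed
  then have B0': "B0 \<ge> 0" using lim(2) by (intro LIMSEQ_le_const) auto
  have "(\<integral>\<^sup>+x. ennreal (f x) \<partial>M) = (\<integral>\<^sup>+x. liminf (\<lambda>k. ennreal (F k x)) \<partial>M)"
  proof (rule nn_integral_cong_AE, rule AE_mp[OF lim(1)], intro AE_I2 impI)
    fix x assume "(\<lambda>k. F k x) \<longlonglongrightarrow> f x"
    then have "(\<lambda>k. ennreal (F k x)) \<longlonglongrightarrow> ennreal (f x)" by (rule tendsto_ennrealI)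
    then show "ennreal (f x) = liminf (\<lambda>k. ennreal (F k x))"
      by (intro lim_imp_Liminf[symmetric]) auto
  qed
  also have "\<dots> \<le> liminf (\<lambda>k. \<integral>\<^sup>+x. ennreal (F k x) \<partial>M)"
    by (rule nn_integral_liminf) measurable
  also have "\<dots> \<le> liminf (\<lambda>k. ennreal (B k))"
  proof (intro Liminf_mono always_eventually allI)
    fix k
    have "(\<integral>\<^sup>+x. ennreal (F k x) \<partial>M) = ennreal (\<integral>x. F k x \<partial>M)"
      using F(1,2) by (intro nn_integral_eq_integral) auto
    also have "\<dots> \<le> ennreal (B k)" using F(3) by (rule ennreal_leI)
    finally show "(\<integral>\<^sup>+x. ennreal (F k x) \<partial>M) \<le> ennreal (B k)" .
  qed
  also have "\<dots> = ennreal B0"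
    by (intro lim_imp_Liminf tendsto_ennrealI lim(2)) simp
  finally have le: "(\<integral>\<^sup>+x. ennreal (f x) \<partial>M) \<le> ennreal B0" .
  show i: "integrable M f"
    using f le by (intro integrableI_nonneg) (auto intro: le_less_trans)
  have "ennreal (\<integral>x. f x \<partial>M) \<le> ennreal B0"
    using le nn_integral_eq_integral[OF i] f(2) by simp
  then show "(\<integral>x. f x \<partial>M) \<le> B0" using B0' by (subst (asm) ennreal_le_iff) auto
qed

lemma L1_limit_against_continuous:
  fixes f \<psi> :: "real^'n \<Rightarrow> real" and F :: "nat \<Rightarrow> real^'n \<Rightarrow> real"
  assumes f: "set_integrable lborel K f" and F: "\<And>k. continuous_on UNIV (F k)"
    and lim: "(\<lambda>k. LINT x:K|lborel. \<bar>f x - F k x\<bar>) \<longlonglongrightarrow> 0"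
    and K: "compact K" and \<psi>: "continuous_on UNIV \<psi>" "\<And>x. x \<notin> K \<Longrightarrow> \<psi> x = 0"
  shows "(\<lambda>k. \<integral>x. F k x * \<psi> x \<partial>lborel) \<longlonglongrightarrow> (\<integral>x. f x * \<psi> x \<partial>lborel)"
proof -
  have "compact (\<psi> ` K)" using \<psi>(1) K by (meson compact_continuous_image continuous_on_subset subset_UNIV)
  then obtain B where B: "\<And>x. x \<in> K \<Longrightarrow> \<bar>\<psi> x\<bar> \<le> B"
    using compact_imp_bounded bounded_iff by (metis image_eqI real_norm_def)
  have [measurable]: "\<psi> \<in> borel_measurable borel" using \<psi>(1) by (rule borel_measurable_continuous_onI)
  have Kb: "K \<in> sets borel" "bounded K" using K by (simp_all add: compact_imp_closed compact_imp_bounded)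
  have iF: "set_integrable lborel K (F k)" for k by (rule continuous_set_integrable[OF F Kb])
  have prod: "integrable lborel (\<lambda>x. h x * \<psi> x)" "\<bar>\<integral>x. h x * \<psi> x \<partial>lborel\<bar> \<le> \<bar>B\<bar> * (LINT x:K|lborel. \<bar>h x\<bar>)"
    if h: "set_integrable lborel K h" for h :: "real^'n \<Rightarrow> real"
  proof -
    have i: "integrable lborel (\<lambda>x. \<bar>B\<bar> * \<bar>indicat_real K x * h x\<bar>)"
      using h unfolding set_integrable_def by simp
    have eq: "h x * \<psi> x = (indicat_real K x * h x) * \<psi> x" for x
      using \<psi>(2)[of x] by (cases "x \<in> K") auto
    have le: "\<bar>h x * \<psi> x\<bar> \<le> \<bar>B\<bar> * \<bar>indicat_real K x * h x\<bar>" for x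
    proof (cases "x \<in> K")
      case True
      have "\<bar>\<psi> x\<bar> \<le> \<bar>B\<bar>" using B[OF True] by linarith
      from mult_right_mono[OF this, of "\<bar>h x\<bar>"] True show ?thesis by (simp add: abs_mult mult.commute)
    next
      case False
      then show ?thesis using \<psi>(2)[OF False] by simp
    qed
    have "(\<lambda>x. (indicat_real K x * h x) * \<psi> x) \<in> borel_measurable lborel"
    proof (rule borel_measurable_times)
      show "(\<lambda>x. indicat_real K x * h x) \<in> borel_measurable lborel"
        using borel_measurable_integrable[OF h[unfolded set_integrable_def]] by simp
    qed simp
    then have m: "(\<lambda>x. h x * \<psi> x) \<in> borel_measurable lborel" by (subst eq)
    show j: "integrable lborel (\<lambda>x. h x * \<psi> x)"
      by (rule Bochner_Integration.integrable_bound[OF i m]) (use le in simp)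
    have "\<bar>\<integral>x. h x * \<psi> x \<partial>lborel\<bar> \<le> (\<integral>x. \<bar>h x * \<psi> x\<bar> \<partial>lborel)"
      by (rule integral_abs_bound)
    also have "\<dots> \<le> (\<integral>x. \<bar>B\<bar> * \<bar>indicat_real K x * h x\<bar> \<partial>lborel)"
      by (intro integral_mono integrable_abs j i le)
    also have "\<dots> = \<bar>B\<bar> * (LINT x:K|lborel. \<bar>h x\<bar>)"
      by (simp add: set_lebesgue_integral_def abs_mult)
    finally show "\<bar>\<integral>x. h x * \<psi> x \<partial>lborel\<bar> \<le> \<bar>B\<bar> * (LINT x:K|lborel. \<bar>h x\<bar>)" .
  qed
  show ?thesis
  proof (rule LIM_zero_cancel, rule Lim_null_comparison)
    show "\<forall>\<^sub>F k in sequentially. norm ((\<integral>x. F k x * \<psi> x \<partial>lborel) - (\<integral>x. f x * \<psi> x \<partial>lborel)) \<le> \<bar>B\<bar> * (LINT x:K|lborel. \<bar>f x - F k x\<bar>)"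
    proof (intro always_eventually allI)
      fix k
      have "(\<integral>x. f x * \<psi> x \<partial>lborel) - (\<integral>x. F k x * \<psi> x \<partial>lborel) = (\<integral>x. (f x - F k x) * \<psi> x \<partial>lborel)"
        unfolding left_diff_distrib using prod(1)[OF f] prod(1)[OF iF] by simp
      then show "norm ((\<integral>x. F k x * \<psi> x \<partial>lborel) - (\<integral>x. f x * \<psi> x \<partial>lborel)) \<le> \<bar>B\<bar> * (LINT x:K|lborel. \<bar>f x - F k x\<bar>)"
        using prod(2)[OF set_integral_diff(1)[OF f iF[of k]]] by (simp add: abs_minus_commute)
    qed
    show "(\<lambda>k. \<bar>B\<bar> * (LINT x:K|lborel. \<bar>f x - F k x\<bar>)) \<longlonglongrightarrow> 0"
      using tendsto_mult_left[OF lim, of "\<bar>B\<bar>"] by simp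
  qed
qed

lemma locally_integrable_lborel:
  fixes f :: "real^'n \<Rightarrow> real"
  assumes "\<And>K. compact K \<Longrightarrow> K \<subseteq> W \<Longrightarrow> set_integrable lborel K f"
  shows "locally_integrable_on W f"
  unfolding locally_integrable_on_def
proof (intro allI impI)
  fix K :: "(real^'n) set" assume K: "compact K" "K \<subseteq> W"
  have i: "integrable lborel (\<lambda>x. indicat_real K x *\<^sub>R f x)"
    using assms[OF K] by (simp only: set_integrable_def)
  have "integrable lebesgue (\<lambda>x. indicat_real K x *\<^sub>R f x)"
    using integrable_completion[OF borel_measurable_integrable[OF i]] i by blast
  then show "integrable (lebesgue_on K) f"
    using K(1) by (subst integrable_restrict_space) (auto simp: compact_imp_closed)
qed

text \<open>
This compares the energies of two functions when the energy of their difference is known.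
\<close>

lemma square_perturbation:
  fixes x y \<eta> :: real assumes "\<eta> > 0"
  shows "x\<^sup>2 \<le> (1 + \<eta>) * y\<^sup>2 + (1 + 1 / \<eta>) * (x - y)\<^sup>2"
proof -
  have "0 \<le> (\<eta> * y - (x - y))\<^sup>2 / \<eta>" using assms by simp
  also have "\<dots> = \<eta> * y\<^sup>2 + (x - y)\<^sup>2 / \<eta> - 2 * y * (x - y)"
    using assms by (simp add: power2_eq_square field_simps)
  finally have "2 * y * (x - y) \<le> \<eta> * y\<^sup>2 + (x - y)\<^sup>2 / \<eta>" by linarith
  moreover have "x\<^sup>2 = y\<^sup>2 + 2 * y * (x - y) + (x - y)\<^sup>2" by (simp add: power2_eq_square algebra_simps)
  moreover have "(1 + \<eta>) * y\<^sup>2 + (1 + 1 / \<eta>) * (x - y)\<^sup>2 = y\<^sup>2 + \<eta> * y\<^sup>2 + ((x - y)\<^sup>2 + (x - y)\<^sup>2 / \<eta>)"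
    by (simp add: distrib_right)
  ultimately show ?thesis by linarith
qed

context degenerate_energy
begin

definition wsq :: "('n \<Rightarrow> real^'n \<Rightarrow> real) \<Rightarrow> real^'n \<Rightarrow> real" where
  "wsq g x = (\<Sum>i\<in>UNIV. weight i x * (g i x)\<^sup>2)"

lemma wsq_nonneg: "wsq g x \<ge> 0"
  unfolding wsq_def by (intro sum_nonneg mult_nonneg_nonneg weight_nonneg) auto

lemma weight_measurable [measurable]: "weight i \<in> borel_measurable borel"
  using continuous_weight by (rule borel_measurable_continuous_onI)

lemma wsq_measurable [measurable (raw)]:
  assumes [measurable]: "\<And>i. g i \<in> borel_measurable borel"
  shows "wsq g \<in> borel_measurable borel"
  unfolding wsq_def by measurable

lemma wsq_partial: "wsq (\<lambda>i. partial_deriv i v) = dens v"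
  by (simp add: wsq_def[abs_def] dens_def[abs_def])

text \<open>
Identifies the energy built from the arbitrary choice \<open>weak_partial\<close>. Its measurability comes from the
completeness of Lebesgue measure, as it agrees almost everywhere with a Borel function.
\<close>

lemma weak_energy:
  assumes g: "\<And>i. has_weak_partial HS i u (g i)" and gm: "\<And>i. g i \<in> borel_measurable borel"
    and g0: "\<And>i x. x \<notin> HS \<Longrightarrow> g i x = 0" and int: "integrable lborel (wsq g)"
  shows "integrable (lebesgue_on HS) (energy_density a b s (\<lambda>i. weak_partial HS i u))"
    "energy a b s (\<lambda>i. weak_partial HS i u) = (\<integral>x. wsq g x \<partial>lborel)"
proof -
  define E where "E = energy_density a b s (\<lambda>i. weak_partial HS i u)"
  have HSl: "HS \<in> sets lebesgue" using HS_borel by (intro sets_completionI_sets) (simp only: sets_lborel)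
  have "AE x in lebesgue_on HS. weak_partial HS i u x = g i x" for i
    by (rule weak_partial_AE[OF open_HS g])
  then have "AE x in lebesgue_on HS. \<forall>i\<in>UNIV. weak_partial HS i u x = g i x"
    by (subst AE_finite_all) auto
  then have "AE x in lebesgue. x \<in> HS \<longrightarrow> (\<forall>i\<in>UNIV. weak_partial HS i u x = g i x)"
    using HSl by (subst (asm) AE_restrict_space_iff) auto
  then have ae: "AE x in lebesgue. wsq g x = indicat_real HS x *\<^sub>R E x"
  proof eventually_elim
    case (elim x)
    show ?case
    proof (cases "x \<in> HS")
      case True
      then show ?thesis using elim by (simp add: E_def energy_density_eq wsq_def)
    next
      case False
      then show ?thesis using g0[OF False] by (simp add: wsq_def)
    qed
  qed
  have wm: "wsq g \<in> borel_measurable borel" by (rule wsq_measurable[OF gm])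
  then have wl: "wsq g \<in> borel_measurable lebesgue" by (intro measurable_completion) simp
  have il: "integrable lebesgue (wsq g)"
    using int wm by (subst integrable_completion) auto
  have em: "(\<lambda>x. indicat_real HS x *\<^sub>R E x) \<in> borel_measurable lebesgue"
    by (rule borel_measurable_AE[OF wl ae])
  have ie: "integrable lebesgue (\<lambda>x. indicat_real HS x *\<^sub>R E x)"
    by (rule integrable_cong_AE_imp[OF il em ae])
  then show "integrable (lebesgue_on HS) (energy_density a b s (\<lambda>i. weak_partial HS i u))"
    unfolding E_def[symmetric] using HSl by (subst integrable_restrict_space) auto
  have "energy a b s (\<lambda>i. weak_partial HS i u) = (\<integral>x. indicat_real HS x *\<^sub>R E x \<partial>lebesgue)"
    unfolding energy_def E_def by (rule integral_restrict_space) (use HSl in simp)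
  also have "\<dots> = (\<integral>x. wsq g x \<partial>lebesgue)"
    using ae by (intro integral_cong_AE em wl) (auto elim: eventually_mono)
  also have "\<dots> = (\<integral>x. wsq g x \<partial>lborel)" by (rule integral_lebesgue_lborel[OF wm])
  finally show "energy a b s (\<lambda>i. weak_partial HS i u) = (\<integral>x. wsq g x \<partial>lborel)" .
qed

text \<open>
The quotients \<open>v k / x$a\<close> are Cauchy in \<open>L\<^sup>2\<close> by Hardy's inequality, and so are the derivatives times the
square roots of the weights. Multiplying the limits back gives \<open>u\<close> and \<open>g\<close>. Since \<open>x$a\<close> and the weights are
bounded below on compact subsets of the half space, the convergence is locally in \<open>L\<^sup>1\<close>, and integration
by parts passes to the limit. The cut-off at the half space fixes values on a set where all \<open>v k\<close> vanish.
\<close>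

lemma limit_function:
  fixes v :: "nat \<Rightarrow> real^'n \<Rightarrow> real"
  assumes v: "\<And>k. v k \<in> C1H" and C: "C \<ge> 0" and cauchy: "\<And>j k. j \<ge> k \<Longrightarrow> en (\<lambda>x. v j x - v k x) \<le> C / 4^k"
  obtains u :: "real^'n \<Rightarrow> real" and g :: "'n \<Rightarrow> real^'n \<Rightarrow> real" where
    "u \<in> borel_measurable borel" "\<And>i. g i \<in> borel_measurable borel"
    "\<And>x. x \<notin> HS \<Longrightarrow> u x = 0" "\<And>i x. x \<notin> HS \<Longrightarrow> g i x = 0"
    "AE x in lborel. (\<lambda>k. v k x) \<longlonglongrightarrow> u x" "\<And>i. has_weak_partial HS i u (g i)"
    "integrable lborel (wsq g)"
    "\<And>k. integrable lborel (wsq (\<lambda>i x. g i x - partial_deriv i (v k) x))"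
    "\<And>k. (\<integral>x. wsq (\<lambda>i x. g i x - partial_deriv i (v k) x) x \<partial>lborel) \<le> real CARD('n) * (4 * C) / 4^k"
proof -
  note cv = Cck1_D(4)[OF v] and cp = Cck1_D(5)[OF v]
  have [measurable]: "v k \<in> borel_measurable borel" "partial_deriv i (v k) \<in> borel_measurable borel" for i k
    using cv cp by (auto intro: borel_measurable_continuous_onI)
  \<comment> \<open>The factor 4 is the constant in Hardy's inequality.\<close>
  have C4: "4 * C \<ge> 0" using C by simp
  have sub: "(\<integral>\<^sup>+x. ennreal (F x) \<partial>lborel) \<le> ennreal (4 * C / 4^k)"
    if F: "integrable lborel F" "\<And>x. F x \<ge> 0" and le: "(\<integral>x. F x \<partial>lborel) \<le> 4 * C / 4^k" for F :: "real^'n \<Rightarrow> real" and k :: nat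
    using nn_integral_eq_integral[OF F(1)] F(2) le by (simp add: ennreal_leI)
  define q where "q k x = v k x / x$a" for k x
  have cq: "continuous_on UNIV (q k)" for k unfolding q_def[abs_def] by (rule continuous_hardy_term[OF v])
  have [measurable]: "q k \<in> borel_measurable borel" for k using cq by (rule borel_measurable_continuous_onI)
  have qC: "(\<integral>\<^sup>+x. ennreal ((q j x - q k x)\<^sup>2) \<partial>lborel) \<le> ennreal (4 * C / 4^k)" if "j \<ge> k" for j k
  proof (rule sub)
    have d: "(\<lambda>x. v j x - v k x) \<in> C1H" by (intro Cck1_diff v)
    have eq: "(q j x - q k x)\<^sup>2 = ((v j x - v k x) / x$a)\<^sup>2" for x by (simp add: q_def diff_divide_distrib)
    show "integrable lborel (\<lambda>x. (q j x - q k x)\<^sup>2)" unfolding eq by (rule hardy(1)[OF d])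
    show "(\<integral>x. (q j x - q k x)\<^sup>2 \<partial>lborel) \<le> 4 * C / 4^k"
      unfolding eq using hardy_en[OF d] cauchy[OF that] by simp
  qed simp
  have qm: "q k \<in> borel_measurable lborel" for k by simp
  obtain q0 where q0: "q0 \<in> borel_measurable lborel" "AE x in lborel. (\<lambda>k. q k x) \<longlonglongrightarrow> q0 x"
    "\<And>k. (\<integral>\<^sup>+x. ennreal ((q0 x - q k x)\<^sup>2) \<partial>lborel) \<le> ennreal (4 * C / 4^k)"
    using L2_limit[of q lborel "4 * C", OF qm C4 qC] by blast
  define r where "r i k x = sqrt (weight i x) * partial_deriv i (v k) x" for i k x
  have rm: "r i k \<in> borel_measurable lborel" for i k unfolding r_def[abs_def] by measurable
  have rC: "(\<integral>\<^sup>+x. ennreal ((r i j x - r i k x)\<^sup>2) \<partial>lborel) \<le> ennreal (4 * C / 4^k)" if "j \<ge> k" for i j k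
  proof (rule sub)
    have d: "(\<lambda>x. v j x - v k x) \<in> C1H" by (intro Cck1_diff v)
    have pd: "partial_deriv i (\<lambda>x. v j x - v k x) = (\<lambda>x. partial_deriv i (v j) x - partial_deriv i (v k) x)"
      by (rule Ck1_diff[OF Cck1_D(1)[OF v] Cck1_D(1)[OF v]])
    have eq: "(r i j x - r i k x)\<^sup>2 = weight i x * (partial_deriv i (\<lambda>x. v j x - v k x) x)\<^sup>2" for x
      unfolding pd r_def right_diff_distrib[symmetric] power_mult_distrib using weight_nonneg by simp
    have le: "(r i j x - r i k x)\<^sup>2 \<le> dens (\<lambda>x. v j x - v k x) x" for x
      unfolding eq dens_def by (rule member_le_sum) (auto intro: mult_nonneg_nonneg weight_nonneg)
    show int: "integrable lborel (\<lambda>x. (r i j x - r i k x)\<^sup>2)"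
      by (rule Bochner_Integration.integrable_bound[OF integrable_dens[OF d]])
         (use rm le dens_nonneg in auto)
    have "(\<integral>x. (r i j x - r i k x)\<^sup>2 \<partial>lborel) \<le> en (\<lambda>x. v j x - v k x)"
      unfolding en_def by (rule integral_mono[OF int integrable_dens[OF d] le])
    also have "\<dots> \<le> 4 * C / 4^k" using C by (intro order_trans[OF cauchy[OF that]]) (simp add: divide_right_mono)
    finally show "(\<integral>x. (r i j x - r i k x)\<^sup>2 \<partial>lborel) \<le> 4 * C / 4^k" .
  qed simp
  have "\<exists>r0. r0 \<in> borel_measurable lborel \<and> (\<forall>k. (\<integral>\<^sup>+x. ennreal ((r0 x - r i k x)\<^sup>2) \<partial>lborel) \<le> ennreal (4 * C / 4^k))" for i
    by (rule L2_limit[of "r i" lborel "4 * C", OF rm C4 rC]) (assumption | rule exI conjI allI)+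
  from choice[OF allI[OF this]] obtain r0 where r0': "\<forall>i. r0 i \<in> borel_measurable lborel \<and>
    (\<forall>k. (\<integral>\<^sup>+x. ennreal ((r0 i x - r i k x)\<^sup>2) \<partial>lborel) \<le> ennreal (4 * C / 4^k))" by (rule exE)
  have r0: "r0 i \<in> borel_measurable lborel"
    "(\<integral>\<^sup>+x. ennreal ((r0 i x - r i k x)\<^sup>2) \<partial>lborel) \<le> ennreal (4 * C / 4^k)" for i k
    using r0' by simp_all
  define u where "u x = indicat_real HS x * (x$a * q0 x)" for x
  define g where "g i x = indicat_real HS x * (r0 i x / sqrt (weight i x))" for i x
  have am: "(\<lambda>x::real^'n. x$a) \<in> borel_measurable borel"
    by (intro borel_measurable_continuous_onI continuous_intros)
  have um: "u \<in> borel_measurable borel"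
    unfolding u_def[abs_def] using q0(1) am by simp
  have gm: "g i \<in> borel_measurable borel" for i
    unfolding g_def[abs_def] using r0(1)[of i] by simp
  have u0: "u x = 0" and g0: "g i x = 0" if "x \<notin> HS" for x i using that by (simp_all add: u_def g_def)
  have lim: "AE x in lborel. (\<lambda>k. v k x) \<longlonglongrightarrow> u x"
    using q0(2)
  proof eventually_elim
    case (elim x)
    show ?case
    proof (cases "x \<in> HS")
      case True
      then have xa: "x$a > 0" by (simp add: half_space_def)
      have "(\<lambda>k. x$a * q k x) \<longlonglongrightarrow> x$a * q0 x" by (intro tendsto_mult_left elim)
      then show ?thesis using xa True by (simp add: q_def u_def)
    next
      case False
      then show ?thesis using C1H_off_HS(1)[OF v False] u0[OF False] by simp
    qed
  qed
  have ub: "(\<integral>\<^sup>+x. ennreal ((1 / (x$a)\<^sup>2) * (u x - v k x)\<^sup>2) \<partial>lborel) \<le> ennreal (4 * C / 4^k)" for k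
  proof (rule order_trans[OF nn_integral_mono q0(3)[of k]])
    fix x
    have "(1 / (x$a)\<^sup>2) * (u x - v k x)\<^sup>2 \<le> (q0 x - q k x)\<^sup>2"
    proof (cases "x \<in> HS")
      case True
      then have xa: "x$a > 0" by (simp add: half_space_def)
      have "u x - v k x = x$a * (q0 x - q k x)" using True xa by (simp add: u_def q_def right_diff_distrib)
      then show ?thesis using xa by (simp add: power_mult_distrib)
    next
      case False
      then show ?thesis using C1H_off_HS(1)[OF v False] u0[OF False] by simp
    qed
    then show "ennreal ((1 / (x$a)\<^sup>2) * (u x - v k x)\<^sup>2) \<le> ennreal ((q0 x - q k x)\<^sup>2)" by (rule ennreal_leI)
  qed
  have gb: "(\<integral>\<^sup>+x. ennreal (weight i x * (g i x - partial_deriv i (v k) x)\<^sup>2) \<partial>lborel) \<le> ennreal (4 * C / 4^k)" for i k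
  proof (rule order_trans[OF nn_integral_mono r0(2)[of i k]])
    fix x
    have "weight i x * (g i x - partial_deriv i (v k) x)\<^sup>2 \<le> (r0 i x - r i k x)\<^sup>2"
    proof (cases "x \<in> HS")
      case True
      have wp: "sqrt (weight i x) > 0" using weight_pos[OF True, of i] by simp
      have "r0 i x - r i k x = sqrt (weight i x) * (g i x - partial_deriv i (v k) x)"
        using True wp by (simp add: g_def r_def right_diff_distrib)
      then show ?thesis using weight_nonneg[of i x] by (simp add: power_mult_distrib)
    next
      case False
      then show ?thesis using C1H_off_HS(2)[OF v False] g0[OF False] by simp
    qed
    then show "ennreal (weight i x * (g i x - partial_deriv i (v k) x)\<^sup>2) \<le> ennreal ((r0 i x - r i k x)\<^sup>2)" by (rule ennreal_leI)
  qed
  have rho: "continuous_on HS (\<lambda>x. 1 / (x$a)\<^sup>2)" "\<And>x. x \<in> HS \<Longrightarrow> 0 < 1 / (x$a)\<^sup>2" "(\<lambda>x::real^'n. 1 / (x$a)\<^sup>2) \<in> borel_measurable borel"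
    using am by (auto intro!: continuous_intros simp: half_space_def)
  have uL: "set_integrable lborel K u" "(\<lambda>k. LINT x:K|lborel. \<bar>u x - v k x\<bar>) \<longlonglongrightarrow> 0" if "compact K" "K \<subseteq> HS" for K
    using local_L1_convergence[OF um cv rho(3) rho(1,2) _ C4 ub that] by simp_all
  have gL: "set_integrable lborel K (g i)" "(\<lambda>k. LINT x:K|lborel. \<bar>g i x - partial_deriv i (v k) x\<bar>) \<longlonglongrightarrow> 0"
    if "compact K" "K \<subseteq> HS" for K i
    using local_L1_convergence[OF gm cp weight_measurable continuous_on_subset[OF continuous_weight subset_UNIV] weight_pos weight_nonneg C4 gb that]
    by blast+
  have hwp: "has_weak_partial HS i u (g i)" for i
    unfolding has_weak_partial_def
  proof (intro conjI ballI)
    show "locally_integrable_on HS u" by (rule locally_integrable_lborel[OF uL(1)])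
    show "locally_integrable_on HS (g i)" by (rule locally_integrable_lborel[OF gL(1)])
    fix \<phi> assume "\<phi> \<in> test_functions HS"
    then have \<phi>: "\<phi> \<in> C1H" by (rule test_functions_C1)
    define K where "K = closure {x. \<phi> x \<noteq> 0}"
    have K: "compact K" "K \<subseteq> HS" using Cck1_D(2,3)[OF \<phi>] unfolding K_def by blast+
    have z: "\<phi> x = 0" "partial_deriv i \<phi> x = 0" if "x \<notin> K" for x
      using that zero_off_support[of x \<phi>] unfolding K_def by blast+
    have l1: "(\<lambda>k. \<integral>x. v k x * partial_deriv i \<phi> x \<partial>lborel) \<longlonglongrightarrow> (\<integral>x. u x * partial_deriv i \<phi> x \<partial>lborel)"
      by (rule L1_limit_against_continuous[OF uL(1)[OF K] cv uL(2)[OF K] K(1) Cck1_D(5)[OF \<phi>] z(2)])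
    have l2: "(\<lambda>k. - (\<integral>x. partial_deriv i (v k) x * \<phi> x \<partial>lborel)) \<longlonglongrightarrow> - (\<integral>x. g i x * \<phi> x \<partial>lborel)"
      by (intro tendsto_minus L1_limit_against_continuous[OF gL(1)[OF K] cp gL(2)[OF K] K(1) Cck1_D(4)[OF \<phi>] z(1)])
    have "(\<integral>x. u x * partial_deriv i \<phi> x \<partial>lborel) = - (\<integral>x. g i x * \<phi> x \<partial>lborel)"
      using LIMSEQ_unique[OF l1 l2[folded integration_by_parts[OF Cck1_D(1)[OF v] \<phi>]]] .
    moreover have "\<phi> \<in> borel_measurable borel" "partial_deriv i \<phi> \<in> borel_measurable borel"
      using Cck1_D(4,5)[OF \<phi>] by (auto intro: borel_measurable_continuous_onI)
    ultimately show "(\<integral>x. u x * partial_deriv i \<phi> x \<partial>lebesgue_on HS) = - (\<integral>x. g i x * \<phi> x \<partial>lebesgue_on HS)"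
      unfolding integral_test_eq[OF open_HS \<phi>] using um gm
      by (subst (1 2) integral_lebesgue_lborel) auto
  qed
  have D: "integrable lborel (wsq (\<lambda>i x. g i x - partial_deriv i (v k) x))"
    "(\<integral>x. wsq (\<lambda>i x. g i x - partial_deriv i (v k) x) x \<partial>lborel) \<le> real CARD('n) * (4 * C) / 4^k" for k
  proof -
    have int: "integrable lborel (\<lambda>x. weight i x * (g i x - partial_deriv i (v k) x)\<^sup>2)" for i
      using gb[of i k] gm[of i] weight_nonneg by (intro integrableI_nonneg) (auto intro: le_less_trans)
    have le: "(\<integral>x. weight i x * (g i x - partial_deriv i (v k) x)\<^sup>2 \<partial>lborel) \<le> 4 * C / 4^k" for i
    proof -
      have "ennreal (\<integral>x. weight i x * (g i x - partial_deriv i (v k) x)\<^sup>2 \<partial>lborel) \<le> ennreal (4 * C / 4^k)"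
        using nn_integral_eq_integral[OF int[of i]] gb[of i k] weight_nonneg by simp
      then show ?thesis using C by (subst (asm) ennreal_le_iff) auto
    qed
    show "integrable lborel (wsq (\<lambda>i x. g i x - partial_deriv i (v k) x))"
      unfolding wsq_def[abs_def] by (intro Bochner_Integration.integrable_sum int)
    have "(\<integral>x. wsq (\<lambda>i x. g i x - partial_deriv i (v k) x) x \<partial>lborel) = (\<Sum>i\<in>UNIV. \<integral>x. weight i x * (g i x - partial_deriv i (v k) x)\<^sup>2 \<partial>lborel)"
      unfolding wsq_def by (intro Bochner_Integration.integral_sum int)
    also have "\<dots> \<le> (\<Sum>i\<in>(UNIV::'n set). 4 * C / 4^k)" by (rule sum_mono[OF le])
    finally show "(\<integral>x. wsq (\<lambda>i x. g i x - partial_deriv i (v k) x) x \<partial>lborel) \<le> real CARD('n) * (4 * C) / 4^k" by simp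
  qed
  have intg: "integrable lborel (wsq g)"
  proof (rule Bochner_Integration.integrable_bound[OF Bochner_Integration.integrable_add[OF integrable_mult_right[OF integrable_dens[OF v[of 0]], of 2] integrable_mult_right[OF D(1)[of 0], of 2]]])
    show "wsq g \<in> borel_measurable lborel" using wsq_measurable[OF gm] by simp
    have le: "wsq g x \<le> 2 * dens (v 0) x + 2 * wsq (\<lambda>i x. g i x - partial_deriv i (v 0) x) x" for x
      unfolding wsq_partial[symmetric] wsq_def sum_distrib_left sum.distrib[symmetric]
    proof (rule sum_mono)
      fix i
      have "(g i x)\<^sup>2 \<le> 2 * (partial_deriv i (v 0) x)\<^sup>2 + 2 * (g i x - partial_deriv i (v 0) x)\<^sup>2"
        using square_perturbation[of 1 "g i x" "partial_deriv i (v 0) x"] by simp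
      from mult_left_mono[OF this weight_nonneg[of i x]]
      show "weight i x * (g i x)\<^sup>2 \<le> 2 * (weight i x * (partial_deriv i (v 0) x)\<^sup>2) + 2 * (weight i x * (g i x - partial_deriv i (v 0) x)\<^sup>2)"
        by (simp add: algebra_simps)
    qed
    show "AE x in lborel. norm (wsq g x) \<le> norm (2 * dens (v 0) x + 2 * wsq (\<lambda>i x. g i x - partial_deriv i (v 0) x) x)"
    proof (rule AE_I2)
      show "norm (wsq g x) \<le> norm (2 * dens (v 0) x + 2 * wsq (\<lambda>i x. g i x - partial_deriv i (v 0) x) x)" for x
        using le[of x] wsq_nonneg[of g x] unfolding real_norm_def by linarith
    qed
  qed
  show thesis by (rule that[OF um gm u0 g0 lim hwp intg D])
qed

lemma energy_of_limit:
  assumes v: "\<And>k. v k \<in> C1H" and g: "integrable lborel (wsq g)" "\<And>k. integrable lborel (wsq (\<lambda>i x. g i x - partial_deriv i (v k) x))"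
    and le: "\<And>k. (\<integral>x. wsq (\<lambda>i x. g i x - partial_deriv i (v k) x) x \<partial>lborel) \<le> B / 4^k" and B: "B \<ge> 0"
    and d: "(\<lambda>k. en (v k)) \<longlonglongrightarrow> d"
  shows "(\<integral>x. wsq g x \<partial>lborel) = d"
proof -
  define I where "I = (\<integral>x. wsq g x \<partial>lborel)"
  define D where "D k = (\<integral>x. wsq (\<lambda>i x. g i x - partial_deriv i (v k) x) x \<partial>lborel)" for k
  have up: "wsq f x \<le> (1 + \<eta>) * wsq h x + (1 + 1/\<eta>) * wsq (\<lambda>i x. f i x - h i x) x" if "\<eta> > 0" for f h \<eta> x
    unfolding wsq_def sum_distrib_left sum.distrib[symmetric]
  proof (rule sum_mono)
    fix i
    from mult_left_mono[OF square_perturbation[OF that, of "f i x" "h i x"] weight_nonneg[of i x]]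
    show "weight i x * (f i x)\<^sup>2 \<le> (1 + \<eta>) * (weight i x * (h i x)\<^sup>2) + (1 + 1/\<eta>) * (weight i x * (f i x - h i x)\<^sup>2)"
      by (simp add: algebra_simps)
  qed
  have sym: "wsq (\<lambda>i x. partial_deriv i (v k) x - g i x) = wsq (\<lambda>i x. g i x - partial_deriv i (v k) x)" for k
    unfolding wsq_def[abs_def] by (simp add: power2_commute)
  define \<eta> where "\<eta> k = (1/2::real)^k" for k :: nat
  define R where "R k = (1 + 1 / \<eta> k) * (B / 4^k)" for k
  have \<eta>0: "\<eta> k > 0" for k by (simp add: \<eta>_def)
  have R: "(1 + 1 / \<eta> k) * D k \<le> R k" for k
    unfolding R_def D_def using \<eta>0[of k] by (intro mult_left_mono le) auto
  have k1: "I \<le> (1 + \<eta> k) * en (v k) + R k" for k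
  proof -
    have "I \<le> (\<integral>x. (1 + \<eta> k) * dens (v k) x + (1 + 1 / \<eta> k) * wsq (\<lambda>i x. g i x - partial_deriv i (v k) x) x \<partial>lborel)"
      unfolding I_def wsq_partial[symmetric]
      by (intro integral_mono g(1) Bochner_Integration.integrable_add integrable_mult_right g(2) up \<eta>0
           integrable_dens[OF v[of k], folded wsq_partial])
    also have "\<dots> = (1 + \<eta> k) * en (v k) + (1 + 1 / \<eta> k) * D k"
      unfolding en_def D_def
      using Bochner_Integration.integral_add[OF integrable_mult_right[OF integrable_dens[OF v[of k]], of "1 + \<eta> k"] integrable_mult_right[OF g(2)[of k], of "1 + 1 / \<eta> k"]]
      by (simp only: integral_mult_right_zero)
    finally show ?thesis using R[of k] by linarith
  qed
  have k2: "en (v k) \<le> (1 + \<eta> k) * I + R k" for k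
  proof -
    have "en (v k) \<le> (\<integral>x. (1 + \<eta> k) * wsq g x + (1 + 1 / \<eta> k) * wsq (\<lambda>i x. g i x - partial_deriv i (v k) x) x \<partial>lborel)"
      unfolding en_def wsq_partial[symmetric] sym[symmetric]
      by (intro integral_mono g(1) Bochner_Integration.integrable_add integrable_mult_right g(2)[folded sym] up \<eta>0
           integrable_dens[OF v[of k], folded wsq_partial])
    also have "\<dots> = (1 + \<eta> k) * I + (1 + 1 / \<eta> k) * D k"
      unfolding I_def D_def
      using Bochner_Integration.integral_add[OF integrable_mult_right[OF g(1), of "1 + \<eta> k"] integrable_mult_right[OF g(2)[of k], of "1 + 1 / \<eta> k"]]
      by (simp only: integral_mult_right_zero)
    finally show ?thesis using R[of k] by linarith
  qed
  have \<eta>l: "\<eta> \<longlonglongrightarrow> 0" unfolding \<eta>_def[abs_def] by (rule LIMSEQ_power_zero) simp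
  have Rl: "R \<longlonglongrightarrow> 0"
  proof -
    have "R = (\<lambda>k. B * (1/4)^k + B * (1/2)^k)"
      unfolding R_def \<eta>_def by (auto simp: fun_eq_iff field_simps simp flip: power_mult_distrib)
    moreover have "(\<lambda>k. B * (1/4)^k + B * (1/2)^k) \<longlonglongrightarrow> B * 0 + B * 0"
      by (intro tendsto_intros LIMSEQ_power_zero) auto
    ultimately show ?thesis by simp
  qed
  have "(\<lambda>k. (1 + \<eta> k) * en (v k) + R k) \<longlonglongrightarrow> (1 + 0) * d + 0" by (intro tendsto_intros \<eta>l d Rl)
  then have "I \<le> d" using k1 by (intro LIMSEQ_le_const[where X="\<lambda>k. (1 + \<eta> k) * en (v k) + R k"]) auto
  moreover have "(\<lambda>k. (1 + \<eta> k) * I + R k) \<longlonglongrightarrow> (1 + 0) * I + 0" by (intro tendsto_intros \<eta>l Rl)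
  then have "d \<le> I" using k2 by (intro LIMSEQ_le[OF d]) auto
  ultimately show ?thesis unfolding I_def by linarith
qed

end

section \<open>Existence of a minimiser\<close>

text \<open>
For \<open>0 < q < 1\<close> a number strictly between 0 and 1 is less than its \<open>q\<close>-th power.
\<close>

lemma concave_power_sum:
  fixes A q :: real
  assumes A: "0 < A" "A \<le> 1" and q: "0 < q" "q < 1" and le: "A powr q + (1 - A) powr q \<le> 1"
  shows "A = 1"
proof (rule ccontr)
  assume "A \<noteq> 1"
  then have A1: "A < 1" using A by simp
  have "1 * ln A < q * ln A"
    using q A A1 by (intro mult_strict_right_mono_neg) auto
  then have "A powr 1 < A powr q" unfolding powr_def using A by (simp del: exp_ln)
  moreover have "(1 - A) powr 1 \<le> (1 - A) powr q" using A A1 q by (intro powr_mono') auto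
  ultimately show False using le A A1 by simp
qed

context degenerate_energy
begin

definition wunion :: "(int \<times> ('n \<Rightarrow> int)) set \<Rightarrow> (real^'n) set" where
  "wunion F = (\<Union>w\<in>F. wbox w)"

lemma convex_powr_p:
  fixes x y t :: real
  assumes "0 \<le> t" "t \<le> 1"
  shows "\<bar>(1 - t) * x + t * y\<bar> powr p \<le> (1 - t) * \<bar>x\<bar> powr p + t * \<bar>y\<bar> powr p"
proof -
  consider "t = 0" | "t = 1" | "0 < t" "t < 1" using assms by linarith
  then show ?thesis
  proof cases
    case 3
    have e: "z powr p * z powr (1 - p) = z" if "z > 0" for z :: real using that by (simp flip: powr_add)
    have "\<bar>(1 - t) * x + t * y\<bar> powr p \<le> ((1 - t) * \<bar>x\<bar> + t * \<bar>y\<bar>) powr p"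
    proof (rule powr_mono2)
      have "\<bar>(1 - t) * x + t * y\<bar> \<le> \<bar>(1 - t) * x\<bar> + \<bar>t * y\<bar>" by (rule abs_triangle_ineq)
      then show "\<bar>(1 - t) * x + t * y\<bar> \<le> (1 - t) * \<bar>x\<bar> + t * \<bar>y\<bar>" using 3 by (simp add: abs_mult)
    qed (use p_pos in auto)
    also have "\<dots> \<le> ((1 - t) + t) powr (p - 1) * (((1 - t) * \<bar>x\<bar>) powr p * (1 - t) powr (1 - p) + (t * \<bar>y\<bar>) powr p * t powr (1 - p))"
      using 3 p_gt_2 by (intro powr_add_le_split) auto
    also have "\<dots> = ((1 - t) powr p * (1 - t) powr (1 - p)) * \<bar>x\<bar> powr p + (t powr p * t powr (1 - p)) * \<bar>y\<bar> powr p"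
      using 3 by (simp add: powr_mult mult_ac)
    also have "\<dots> = (1 - t) * \<bar>x\<bar> powr p + t * \<bar>y\<bar> powr p" using 3 by (simp add: e)
    finally show ?thesis .
  qed auto
qed

text \<open>
Balls of \<open>L\<^sup>p\<close> are convex: closeness to \<open>h\<close> passes from \<open>U\<close> to its convex hull.
\<close>

lemma chull_close:
  assumes U: "\<And>f. f \<in> U \<Longrightarrow> f \<in> C1H" and h: "h \<in> C1H"
    and close: "\<And>f. f \<in> U \<Longrightarrow> wint w (\<lambda>x. \<bar>f x - h x\<bar> powr p) \<le> \<epsilon>"
    and f: "f \<in> chull U"
  shows "wint w (\<lambda>x. \<bar>f x - h x\<bar> powr p) \<le> \<epsilon>"
  using f
proof induction
  case (base f)
  then show ?case by (rule close)
next
  case (step f g t)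
  have C: "f \<in> C1H" "g \<in> C1H" using step chull_C1H[of U] U by blast+
  note ch = Cck1_D(4)[OF h] and cf = Cck1_D(4)[OF C(1)] and cg = Cck1_D(4)[OF C(2)]
  have i: "set_integrable lborel (wbox w) (\<lambda>x. (1 - t) * \<bar>f x - h x\<bar> powr p)" "set_integrable lborel (wbox w) (\<lambda>x. t * \<bar>g x - h x\<bar> powr p)"
    by (intro wbox_integrable continuous_on_mult_left continuous_powr_p continuous_on_diff cf cg ch)+
  have "wint w (\<lambda>x. \<bar>(1 - t) * f x + t * g x - h x\<bar> powr p) \<le> wint w (\<lambda>x. (1 - t) * \<bar>f x - h x\<bar> powr p + t * \<bar>g x - h x\<bar> powr p)"
  proof (intro set_integral_mono set_integral_add(1) i wbox_integrable continuous_powr_p continuous_on_diff continuous_on_add continuous_on_mult_left cf cg ch)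
    fix x
    have "(1 - t) * f x + t * g x - h x = (1 - t) * (f x - h x) + t * (g x - h x)" by (simp add: algebra_simps)
    then show "\<bar>(1 - t) * f x + t * g x - h x\<bar> powr p \<le> (1 - t) * \<bar>f x - h x\<bar> powr p + t * \<bar>g x - h x\<bar> powr p"
      using convex_powr_p[OF step.hyps(3,4), of "f x - h x" "g x - h x"] by simp
  qed
  also have "\<dots> = (1 - t) * wint w (\<lambda>x. \<bar>f x - h x\<bar> powr p) + t * wint w (\<lambda>x. \<bar>g x - h x\<bar> powr p)"
    using set_integral_add(2)[OF i] by simp
  also have "\<dots> \<le> (1 - t) * \<epsilon> + t * \<epsilon>"
    using step by (intro add_mono mult_left_mono) auto
  finally show ?case by (simp add: algebra_simps)
qed

text \<open>
Here \<open>um\<close> is the minimising sequence, \<open>v k\<close> and \<open>d\<close> come from \<open>tail_minimization\<close>, and \<open>u\<close> is the limit of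
the \<open>v k\<close>. Since \<open>v k\<close> lies in the convex hull of late members of \<open>um\<close>, the sequence \<open>um\<close> itself
converges to \<open>u\<close> in \<open>L\<^sup>p\<close> of every Whitney box (\<open>close\<close>). This gives \<open>A \<ge> kappa > 0\<close> and bounds the mass
that \<open>um m\<close> can have on the support of \<open>v k\<close> (\<open>local\<close>). The remaining mass enters \<open>key\<close>, and letting first
\<open>j\<close> and then \<open>k\<close> tend to infinity leads to \<open>key3\<close>.
\<close>

theorem minimiser_exists:
  "\<exists>u\<in>Hs a b s. \<not> (AE x in lebesgue_on HS. u x = 0) \<and>
     sobolev_quotient a b s (\<lambda>i. weak_partial HS i u) u = S"
proof -
  have "\<exists>f. f \<in> C1H \<and> mass f = 1 \<and> en f \<le> S + 1 / real (Suc m) \<and> kappa \<le> wint w0 (\<lambda>x. \<bar>f x\<bar> powr p)" for m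
  proof -
    have "0 < 1 / real (Suc m)" "1 / real (Suc m) \<le> 1" by simp_all
    from near_minimiser[OF this] show ?thesis unfolding Bex_def .
  qed
  from choice[OF allI[OF this]] obtain um0 where um0': "\<forall>m. um0 m \<in> C1H \<and> mass (um0 m) = 1 \<and>
    en (um0 m) \<le> S + 1 / real (Suc m) \<and> kappa \<le> wint w0 (\<lambda>x. \<bar>um0 m x\<bar> powr p)" by (rule exE)
  have um0: "um0 m \<in> C1H" "mass (um0 m) = 1" "en (um0 m) \<le> S + 1 / real (Suc m)"
    "kappa \<le> wint w0 (\<lambda>x. \<bar>um0 m x\<bar> powr p)" for m
    using um0'[rule_format, of m] by blast+
  have en0: "en (um0 m) \<le> S + 1" for m
  proof -
    have "1 / real (Suc m) \<le> 1" by simp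
    then show ?thesis using um0(3)[of m] by linarith
  qed
  obtain k :: "nat \<Rightarrow> nat" where k: "strict_mono k" and cauchy: "\<And>w \<epsilon>. w \<in> whitney \<Longrightarrow> \<epsilon> > 0 \<Longrightarrow>
      \<exists>M. \<forall>m\<ge>M. \<forall>m'\<ge>M. wint w (\<lambda>x. \<bar>um0 (k m) x - um0 (k m') x\<bar> powr p) \<le> \<epsilon>"
  proof (rule local_cauchy_subsequence[of um0 "S + 1", OF um0(1,2) en0], goal_cases)
    case (1 k)
    show ?case by (rule 1(1)[of k]; rule 1(2-3); assumption?)
  qed
  define um where "um m = um0 (k m)" for m
  have um: "um m \<in> C1H" "mass (um m) = 1" "en (um m) \<le> S + 1" "kappa \<le> wint w0 (\<lambda>x. \<bar>um m x\<bar> powr p)" for m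
    using um0 en0 by (auto simp: um_def)
  have enS: "en (um m) \<le> S + 1 / real (Suc m)" for m
  proof -
    have "m \<le> k m" using k by (rule seq_suble)
    then have "1 / real (Suc (k m)) \<le> 1 / real (Suc m)" by (intro divide_left_mono) auto
    then show ?thesis using um0(3)[of "k m"] by (simp add: um_def)
  qed
  obtain v N d where vc: "\<And>k. v k \<in> chull (um ` {N k..})" and Nk: "\<And>k. N k \<ge> k"
    and vC: "\<And>j k. j \<ge> k \<Longrightarrow> en (\<lambda>x. v j x - v k x) \<le> 6 / 4^k"
    and vu: "\<And>k m. m \<ge> N k \<Longrightarrow> (1 - 1 / 2^k) * en (\<lambda>x. v k x - um m x) \<le> en (um m) - en (v k) + 1 / 2^k"
    and vd: "(\<lambda>k. en (v k)) \<longlonglongrightarrow> d" and du: "\<And>k m. m \<ge> N k \<Longrightarrow> d - 1 / 4^k \<le> en (um m)"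
  proof (rule tail_minimization[of um "S + 1", OF um(1,3)], goal_cases)
    case (1 v N d)
    show ?case by (rule 1(1)[of v N d]; rule 1(2-7); assumption?)
  qed
  have v: "v k \<in> C1H" for k using chull_C1H[OF _ vc[of k]] um(1) by blast
  have vCM: "v k \<in> chull (um ` {M..})" if "k \<ge> M" for k M
  proof (rule chull_mono[OF _ vc[of k]])
    show "um ` {N k..} \<subseteq> um ` {M..}" using Nk[of k] that by (intro image_mono) auto
  qed
  have six: "(0::real) \<le> 6" by simp
  obtain u g where u: "u \<in> borel_measurable borel" "\<And>i. g i \<in> borel_measurable borel"
    "\<And>x. x \<notin> HS \<Longrightarrow> u x = 0" "\<And>i x. x \<notin> HS \<Longrightarrow> g i x = 0"
    "AE x in lborel. (\<lambda>k. v k x) \<longlonglongrightarrow> u x" "\<And>i. has_weak_partial HS i u (g i)"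
    and ig: "integrable lborel (wsq g)"
    "\<And>k. integrable lborel (wsq (\<lambda>i x. g i x - partial_deriv i (v k) x))"
    and Dle: "\<And>k. (\<integral>x. wsq (\<lambda>i x. g i x - partial_deriv i (v k) x) x \<partial>lborel) \<le> real CARD('n) * (4 * 6) / 4^k"
  proof (rule limit_function[OF v six], rule vC, assumption, goal_cases)
    case (1 u g)
    show ?case by (rule 1(1)[of u g]; rule 1(2-10); assumption?)
  qed
  have energy: "(\<integral>x. wsq g x \<partial>lborel) = d"
    by (rule energy_of_limit[OF v ig Dle _ vd]) simp
  define A where "A = (\<integral>x. \<bar>u x\<bar> powr p \<partial>lborel)"
  have pm: "(\<lambda>x. \<bar>f x\<bar> powr p) \<in> borel_measurable borel" if "f \<in> borel_measurable borel" for f :: "real^'n \<Rightarrow> real"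
    using that by measurable
  have vm: "mass (v k) \<le> (en (v k) / S) powr (p/2)" for k
  proof -
    have "mass (v k) powr (2/p) \<le> en (v k) / S"
      using S_le[OF v[of k]] S_pos by (simp add: field_simps)
    then have "(mass (v k) powr (2/p)) powr (p/2) \<le> (en (v k) / S) powr (p/2)"
      using p_pos by (intro powr_mono2) auto
    then show ?thesis unfolding powr_powr using p_pos mass_nonneg[of "v k"] by simp
  qed
  have d0: "d \<ge> 0" using en_nonneg by (intro LIMSEQ_le_const[OF vd]) auto
  have bl: "(\<lambda>k. (en (v k) / S) powr (p/2)) \<longlonglongrightarrow> (d / S) powr (p/2)"
    using S_pos p_pos en_nonneg by (intro tendsto_powr2 tendsto_divide vd tendsto_const) auto
  have limp: "AE x in lborel. (\<lambda>k. \<bar>v k x\<bar> powr p) \<longlonglongrightarrow> \<bar>u x\<bar> powr p"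
    using u(5) by eventually_elim (intro tendsto_powr2 tendsto_rabs tendsto_const; simp add: p_pos)
  have iu: "integrable lborel (\<lambda>x. \<bar>u x\<bar> powr p)" and Ad: "A \<le> (d / S) powr (p/2)"
    unfolding A_def
    using fatou_bound[of lborel "\<lambda>k x. \<bar>v k x\<bar> powr p" "\<lambda>k. (en (v k) / S) powr (p/2)" "\<lambda>x. \<bar>u x\<bar> powr p" "(d / S) powr (p/2)",
        OF integrable_mass[OF v] _ vm[unfolded mass_def] _ _ limp bl] pm[OF u(1)] by simp_all
  have A0: "A \<ge> 0" unfolding A_def by (intro integral_nonneg_AE) simp
  \<comment> \<open>The Sobolev inequality for \<open>v k\<close> in the limit.\<close>
  have SA: "S * A powr (2/p) \<le> d"
  proof -
    have "A powr (2/p) \<le> ((d / S) powr (p/2)) powr (2/p)" using Ad A0 p_pos by (intro powr_mono2) auto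
    also have "\<dots> = d / S" unfolding powr_powr using p_pos d0 S_pos by simp
    finally show ?thesis using S_pos by (simp add: field_simps)
  qed
  have one0: "(\<lambda>m. 1 / real (Suc m)) \<longlonglongrightarrow> 0"
    using LIMSEQ_inverse_real_of_nat by (simp add: inverse_eq_divide)
  have dS: "d \<le> S"
  proof -
    have "d - 1 / 4^k \<le> S" for k
    proof (rule LIMSEQ_le_const)
      show "(\<lambda>m. S + 1 / real (Suc m)) \<longlonglongrightarrow> S" using tendsto_add[OF tendsto_const one0, of S] by simp
      show "\<exists>M. \<forall>m\<ge>M. d - 1 / 4^k \<le> S + 1 / real (Suc m)"
        using du[of k] enS by (intro exI[of _ "N k"]) (meson order_trans)
    qed
    then have "d \<le> S + (1/4)^k" for k by (simp add: power_divide field_simps)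
    moreover have "(\<lambda>k. S + (1/4::real)^k) \<longlonglongrightarrow> S + 0" by (intro tendsto_add tendsto_const LIMSEQ_power_zero) simp
    ultimately show ?thesis by (intro LIMSEQ_le_const[where X="\<lambda>k. S + (1/4::real)^k"]) auto
  qed
  have close: "\<exists>M. \<forall>m\<ge>M. set_integrable lborel (wbox w) (\<lambda>x. \<bar>um m x - u x\<bar> powr p) \<and> wint w (\<lambda>x. \<bar>um m x - u x\<bar> powr p) \<le> \<epsilon>"
    if w: "w \<in> whitney" and e: "\<epsilon> > 0" for w \<epsilon>
  proof -
    obtain M where M: "\<And>m m'. m \<ge> M \<Longrightarrow> m' \<ge> M \<Longrightarrow> wint w (\<lambda>x. \<bar>um m x - um m' x\<bar> powr p) \<le> \<epsilon>"
      using cauchy[OF w e] unfolding um_def by blast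
    have "set_integrable lborel (wbox w) (\<lambda>x. \<bar>um m x - u x\<bar> powr p) \<and> wint w (\<lambda>x. \<bar>um m x - u x\<bar> powr p) \<le> \<epsilon>" if m: "m \<ge> M" for m
    proof -
      have cl: "wint w (\<lambda>x. \<bar>v (j + M) x - um m x\<bar> powr p) \<le> \<epsilon>" for j
        by (rule chull_close[where U="um ` {M..}", OF _ um(1) _ vCM]) (use um(1) M m in auto)
      have int: "integrable lborel (\<lambda>x. indicat_real (wbox w) x * \<bar>v (j + M) x - um m x\<bar> powr p)" for j
        using wbox_integrable[OF continuous_powr_p[OF continuous_on_diff[OF Cck1_D(4)[OF v[of "j + M"]] Cck1_D(4)[OF um(1)[of m]]]], of w]
        by (simp add: set_integrable_def)
      have mm: "(\<lambda>x. u x - um m x) \<in> borel_measurable borel"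
        using u(1) borel_measurable_continuous_onI[OF Cck1_D(4)[OF um(1)[of m]]] by measurable
      have meas: "(\<lambda>x. indicat_real (wbox w) x * \<bar>u x - um m x\<bar> powr p) \<in> borel_measurable lborel"
        using pm[OF mm] by simp
      have lim: "AE x in lborel. (\<lambda>j. indicat_real (wbox w) x * \<bar>v (j + M) x - um m x\<bar> powr p) \<longlonglongrightarrow> indicat_real (wbox w) x * \<bar>u x - um m x\<bar> powr p"
        using u(5)
      proof eventually_elim
        case (elim x)
        have "(\<lambda>j. v (j + M) x) \<longlonglongrightarrow> u x" using elim by (rule LIMSEQ_ignore_initial_segment)
        then show ?case by (intro tendsto_mult_left tendsto_powr2 tendsto_rabs tendsto_diff tendsto_const) (auto simp: p_pos)
      qed
      have fb: "integrable lborel (\<lambda>x. indicat_real (wbox w) x * \<bar>u x - um m x\<bar> powr p)"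
        "(\<integral>x. indicat_real (wbox w) x * \<bar>u x - um m x\<bar> powr p \<partial>lborel) \<le> \<epsilon>"
        using fatou_bound[OF int _ _ meas _ lim tendsto_const[of \<epsilon>]] cl by (simp_all add: set_lebesgue_integral_def)
      then show ?thesis by (simp add: set_integrable_def set_lebesgue_integral_def abs_minus_commute)
    qed
    then show ?thesis by blast
  qed
  have local: "\<exists>M. \<forall>m\<ge>M. (LINT x:wunion F|lborel. \<bar>um m x\<bar> powr p) \<le> (A powr (1/p) + \<epsilon>) powr p"
    if F: "finite F" "F \<subseteq> whitney" and e: "\<epsilon> > 0" for F \<epsilon>
  proof -
    define \<epsilon>' where "\<epsilon>' = \<epsilon> powr p / (real (card F) + 1)"
    have e': "\<epsilon>' > 0" using e by (simp add: \<epsilon>'_def)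
    have "\<forall>w\<in>F. \<exists>M. \<forall>m\<ge>M. set_integrable lborel (wbox w) (\<lambda>x. \<bar>um m x - u x\<bar> powr p) \<and> wint w (\<lambda>x. \<bar>um m x - u x\<bar> powr p) \<le> \<epsilon>'"
    proof
      fix w assume "w \<in> F"
      then have "w \<in> whitney" using F(2) by blast
      from close[OF this e'] show "\<exists>M. \<forall>m\<ge>M. set_integrable lborel (wbox w) (\<lambda>x. \<bar>um m x - u x\<bar> powr p) \<and> wint w (\<lambda>x. \<bar>um m x - u x\<bar> powr p) \<le> \<epsilon>'" .
    qed
    from bchoice[OF this] obtain Mf where Mf': "\<forall>w\<in>F. \<forall>m\<ge>Mf w. set_integrable lborel (wbox w) (\<lambda>x. \<bar>um m x - u x\<bar> powr p) \<and> wint w (\<lambda>x. \<bar>um m x - u x\<bar> powr p) \<le> \<epsilon>'"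
      by (rule exE)
    have Mf: "w \<in> F \<Longrightarrow> m \<ge> Mf w \<Longrightarrow> set_integrable lborel (wbox w) (\<lambda>x. \<bar>um m x - u x\<bar> powr p) \<and> wint w (\<lambda>x. \<bar>um m x - u x\<bar> powr p) \<le> \<epsilon>'" for w m
      using Mf' by blast
    define M where "M = Max (insert 0 (Mf ` F))"
    have MM: "Mf w \<le> M" if "w \<in> F" for w unfolding M_def using that F(1) by (intro Max_ge) auto
    have "(LINT x:wunion F|lborel. \<bar>um m x\<bar> powr p) \<le> (A powr (1/p) + \<epsilon>) powr p" if m: "m \<ge> M" for m
    proof -
      have mw: "set_integrable lborel (wbox w) (\<lambda>x. \<bar>um m x - u x\<bar> powr p)" "wint w (\<lambda>x. \<bar>um m x - u x\<bar> powr p) \<le> \<epsilon>'" if "w \<in> F" for w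
        using Mf[OF that, of m] MM[OF that] m by auto
      have Fs: "wunion F \<in> sets lborel" unfolding wunion_def using F(1) by (intro sets.finite_UN) auto
      have dj: "disjoint_family_on wbox F" using disjoint_whitney F(2) by (rule disjoint_family_on_mono[rotated])
      have wb: "wbox i \<in> sets lborel" for i by simp
      have i1: "set_integrable lborel (wunion F) (\<lambda>x. \<bar>um m x - u x\<bar> powr p)"
        unfolding wunion_def using F(1) mw(1) by (intro set_integrable_UN) auto
      have i2: "set_integrable lborel (wunion F) (\<lambda>x. \<bar>u x\<bar> powr p)"
        unfolding set_integrable_def by (rule integrable_mult_indicator[OF Fs iu])
      have i3: "set_integrable lborel (wunion F) (\<lambda>x. \<bar>um m x\<bar> powr p)"
        unfolding set_integrable_def by (rule integrable_mult_indicator[OF Fs integrable_mass[OF um(1)]])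
      have b1: "(LINT x:wunion F|lborel. \<bar>um m x - u x\<bar> powr p) \<le> \<epsilon> powr p"
      proof -
        have "(LINT x:wunion F|lborel. \<bar>um m x - u x\<bar> powr p) = (\<Sum>w\<in>F. wint w (\<lambda>x. \<bar>um m x - u x\<bar> powr p))"
          unfolding wunion_def by (rule set_integral_finite_disjoint_UN[OF F(1) dj wb mw(1)])
        also have "\<dots> \<le> (\<Sum>w\<in>F. \<epsilon>')" by (rule sum_mono[OF mw(2)])
        also have "\<dots> = real (card F) * \<epsilon>'" by simp
        also have "\<dots> \<le> (real (card F) + 1) * \<epsilon>'" using e' by (intro mult_right_mono) auto
        also have "\<dots> = \<epsilon> powr p" by (simp add: \<epsilon>'_def)
        finally show ?thesis .
      qed
      have b2: "(LINT x:wunion F|lborel. \<bar>u x\<bar> powr p) \<le> (A powr (1/p)) powr p"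
      proof -
        have "(LINT x:wunion F|lborel. \<bar>u x\<bar> powr p) \<le> A"
          using i2 iu unfolding A_def set_lebesgue_integral_def set_integrable_def
          by (intro integral_mono) (auto simp: indicator_def)
        then show ?thesis unfolding powr_powr using A0 p_pos by simp
      qed
      have "(LINT x:wunion F|lborel. \<bar>(um m x - u x) + u x\<bar> powr p) \<le> (\<epsilon> + A powr (1/p)) powr p"
        by (rule set_minkowski[OF _ _ _ i1 i2 _ b1 b2]) (use e p_gt_2 i3 in simp_all)
      then show ?thesis by (simp add: add.commute)
    qed
    then show ?thesis by blast
  qed
  \<comment> \<open>Upper bounds for the limiting mass of \<open>um m\<close> on finite unions of boxes, decreasing to \<open>A\<close>.\<close>
  define c where "c j = (A powr (1/p) + 1 / real (Suc j)) powr p" for j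
  have c: "c \<longlonglongrightarrow> A"
  proof -
    have "c \<longlonglongrightarrow> (A powr (1/p) + 0) powr p"
      unfolding c_def[abs_def] using p_pos by (intro tendsto_powr2 tendsto_add tendsto_const one0) auto
    then show ?thesis using A0 p_pos by (simp add: powr_powr)
  qed
  have "kappa \<le> c j" for j
  proof -
    obtain M where "\<And>m. m \<ge> M \<Longrightarrow> (LINT x:wunion {w0}|lborel. \<bar>um m x\<bar> powr p) \<le> c j"
      using local[of "{w0}" "1 / real (Suc j)"] w0_whitney unfolding c_def by auto
    from this[of M] um(4)[of M] show ?thesis by (simp add: wunion_def)
  qed
  then have "kappa \<le> A" by (intro LIMSEQ_le_const[OF c]) auto
  then have Apos: "A > 0" using kappa_pos by linarith
  \<comment> \<open>For large \<open>m\<close> at most the mass \<open>c j\<close> of \<open>um m\<close> lies on a union of boxes containing the support of \<open>v k\<close>.\<close>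
  have key: "(1 - 1 / 2^k) * (S * (max 0 (1 - c j)) powr (2/p)) \<le> S + 1 / real (Suc j) - en (v k) + 1 / 2^k" for k j
  proof -
    obtain F where F: "finite F" "F \<subseteq> whitney" and cov: "supp (v k) \<subseteq> (\<Union>w\<in>F. wbox w)"
      using compact_finite_whitney[OF Cck1_D(2,3)[OF v[of k]]] by blast
    obtain M where M: "\<And>m. m \<ge> M \<Longrightarrow> (LINT x:wunion F|lborel. \<bar>um m x\<bar> powr p) \<le> c j"
      using local[OF F, of "1 / real (Suc j)"] unfolding c_def by auto
    define m where "m = max M (max (N k) j)"
    have m: "m \<ge> M" "m \<ge> N k" "m \<ge> j" by (auto simp: m_def)
    define z where "z x = v k x - um m x" for x
    have z: "z \<in> C1H" unfolding z_def[abs_def] by (intro Cck1_diff v um)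
    have Fs: "wunion F \<in> sets lborel" unfolding wunion_def using F(1) by (intro sets.finite_UN) auto
    have i: "integrable lborel (\<lambda>x. indicat_real (wunion F) x *\<^sub>R \<bar>um m x\<bar> powr p)"
      by (rule integrable_mult_indicator[OF Fs integrable_mass[OF um(1)]])
    have "1 - c j \<le> mass (um m) - (LINT x:wunion F|lborel. \<bar>um m x\<bar> powr p)"
      using M[OF m(1)] um(2)[of m] by simp
    also have "\<dots> = (\<integral>x. \<bar>um m x\<bar> powr p - indicat_real (wunion F) x *\<^sub>R \<bar>um m x\<bar> powr p \<partial>lborel)"
      unfolding mass_def set_lebesgue_integral_def
      using Bochner_Integration.integral_diff[OF integrable_mass[OF um(1)] i] by simp
    also have "\<dots> \<le> mass z"
      unfolding mass_def
    proof (rule integral_mono[OF Bochner_Integration.integrable_diff[OF integrable_mass[OF um(1)] i] integrable_mass[OF z]])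
      fix x
      show "\<bar>um m x\<bar> powr p - indicat_real (wunion F) x *\<^sub>R \<bar>um m x\<bar> powr p \<le> \<bar>z x\<bar> powr p"
      proof (cases "x \<in> wunion F")
        case False
        then have "v k x = 0" using cov zero_off_support(1)[of x "v k"] unfolding wunion_def by blast
        then show ?thesis using False by (simp add: z_def)
      qed simp
    qed
    finally have mz: "max 0 (1 - c j) \<le> mass z" using mass_nonneg[of z] by simp
    have "S * (max 0 (1 - c j)) powr (2/p) \<le> S * mass z powr (2/p)"
      using S_pos mz p_pos by (intro mult_left_mono powr_mono2) auto
    also have "\<dots> \<le> en z" by (rule S_le[OF z])
    finally have "(1 - 1 / 2^k) * (S * (max 0 (1 - c j)) powr (2/p)) \<le> (1 - 1 / 2^k) * en z"
      by (intro mult_left_mono) auto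
    also have "\<dots> \<le> en (um m) - en (v k) + 1 / 2^k" unfolding z_def[abs_def] by (rule vu[OF m(2)])
    also have "en (um m) \<le> S + 1 / real (Suc j)"
    proof -
      have "1 / real (Suc m) \<le> 1 / real (Suc j)" using m(3) by (intro divide_left_mono) auto
      then show ?thesis using enS[of m] by linarith
    qed
    finally show ?thesis by simp
  qed
  have key2: "(1 - 1 / 2^k) * (S * (max 0 (1 - A)) powr (2/p)) \<le> S - en (v k) + 1 / 2^k" for k
  proof (rule LIMSEQ_le)
    show "(\<lambda>j. (1 - 1 / 2^k) * (S * (max 0 (1 - c j)) powr (2/p))) \<longlonglongrightarrow> (1 - 1 / 2^k) * (S * (max 0 (1 - A)) powr (2/p))"
      using p_pos by (intro tendsto_mult_left tendsto_powr2 tendsto_max tendsto_diff tendsto_const c) auto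
    show "(\<lambda>j. S + 1 / real (Suc j) - en (v k) + 1 / 2^k) \<longlonglongrightarrow> S - en (v k) + 1 / 2^k"
      using tendsto_add[OF tendsto_const one0, of "S - en (v k) + 1 / 2^k"] by (simp add: algebra_simps)
    show "\<exists>N. \<forall>j\<ge>N. (1 - 1 / 2^k) * (S * (max 0 (1 - c j)) powr (2/p)) \<le> S + 1 / real (Suc j) - en (v k) + 1 / 2^k"
      using key by blast
  qed
  have two0: "(\<lambda>k. 1 / (2::real)^k) \<longlonglongrightarrow> 0"
    using LIMSEQ_power_zero[of "1/2::real"] by (simp add: power_divide)
  have key3: "S * (max 0 (1 - A)) powr (2/p) \<le> S - d"
  proof (rule LIMSEQ_le)
    show "(\<lambda>k. (1 - 1 / 2^k) * (S * (max 0 (1 - A)) powr (2/p))) \<longlonglongrightarrow> S * (max 0 (1 - A)) powr (2/p)"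
      using tendsto_mult_right[OF tendsto_diff[OF tendsto_const two0], of 1 "S * (max 0 (1 - A)) powr (2/p)"] by simp
    show "(\<lambda>k. S - en (v k) + 1 / 2^k) \<longlonglongrightarrow> S - d"
      using tendsto_add[OF tendsto_diff[OF tendsto_const vd] two0, of S] by simp
    show "\<exists>N. \<forall>k\<ge>N. (1 - 1 / 2^k) * (S * (max 0 (1 - A)) powr (2/p)) \<le> S - en (v k) + 1 / 2^k"
      using key2 by blast
  qed
  have A1: "A \<le> 1"
  proof (rule ccontr)
    assume "\<not> A \<le> 1"
    then have "1 powr (2/p) < A powr (2/p)" using p_pos by (intro powr_less_mono2) auto
    then have "S < S * A powr (2/p)" using S_pos by simp
    then show False using SA dS by linarith
  qed
  have "S * (A powr (2/p) + (1 - A) powr (2/p)) \<le> S * 1"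
    using SA key3 A1 by (simp add: distrib_left max_def)
  then have "A powr (2/p) + (1 - A) powr (2/p) \<le> 1" using S_pos by (simp add: mult_le_cancel_left_pos)
  then have Aone: "A = 1" using concave_power_sum[OF Apos A1, of "2/p"] p_gt_2 by simp
  have d_eq: "d = S" using SA dS Aone by simp
  have HSl: "HS \<in> sets lebesgue" using HS_borel by (intro sets_completionI_sets) (simp only: sets_lborel)
  have massu: "(\<integral>x. \<bar>u x\<bar> powr p \<partial>lebesgue_on HS) = 1"
  proof -
    have "(\<integral>x. \<bar>u x\<bar> powr p \<partial>lebesgue_on HS) = (LINT x:HS|lborel. \<bar>u x\<bar> powr p)"
      by (rule lebesgue_HS_integral[OF pm[OF u(1)]])
    also have "\<dots> = A" unfolding A_def by (rule set_integral_HS) (simp add: u(3))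
    finally show ?thesis using Aone by simp
  qed
  have iuH: "integrable (lebesgue_on HS) (\<lambda>x. \<bar>u x\<bar> powr p)"
    using massu not_integrable_integral_eq by fastforce
  have um_H: "u \<in> borel_measurable (lebesgue_on HS)"
    using u(1) by (intro measurable_restrict_space1 measurable_completion) simp
  have en_u: "integrable (lebesgue_on HS) (energy_density a b s (\<lambda>i. weak_partial HS i u))"
    "energy a b s (\<lambda>i. weak_partial HS i u) = d"
    using weak_energy[OF u(6,2,4) ig(1)] energy by simp_all
  have amb: "u \<in> Hs_ambient a b s"
    unfolding Hs_ambient_def p_def[symmetric] using um_H iuH u(6) en_u(1) by blast
  have norm_k: "Hs_norm a b s (\<lambda>x. u x - v k x) \<le> sqrt (real CARD('n) * (4 * 6) / 4^k)" for k
  proof -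
    have hw: "has_weak_partial HS i (\<lambda>x. u x - v k x) (\<lambda>x. g i x - partial_deriv i (v k) x)" for i
      by (rule has_weak_partial_diff[OF open_HS u(6) C1_has_weak_partial[OF open_HS Cck1_D(1)[OF v]]])
    have gm: "(\<lambda>x. g i x - partial_deriv i (v k) x) \<in> borel_measurable borel" for i
      using u(2) borel_measurable_continuous_onI[OF Cck1_D(5)[OF v]] by (intro borel_measurable_diff)
    have g0: "g i x - partial_deriv i (v k) x = 0" if "x \<notin> HS" for i x
      using u(4)[OF that] C1H_off_HS(2)[OF v that] by simp
    have "energy a b s (\<lambda>i. weak_partial HS i (\<lambda>x. u x - v k x)) = (\<integral>x. wsq (\<lambda>i x. g i x - partial_deriv i (v k) x) x \<partial>lborel)"
      by (rule weak_energy(2)[OF hw gm g0 ig(2)])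
    then show ?thesis unfolding Hs_norm_def using Dle[of k] by simp
  qed
  have Hsu: "u \<in> Hs a b s"
  proof -
    have "\<exists>\<phi>\<in>C1H. Hs_norm a b s (\<lambda>x. u x - \<phi> x) < \<epsilon>" if e: "\<epsilon> > 0" for \<epsilon>
    proof -
      have "(\<lambda>k. sqrt (real CARD('n) * (4 * 6) * (1/4)^k)) \<longlonglongrightarrow> sqrt (real CARD('n) * (4 * 6) * 0)"
        by (intro tendsto_real_sqrt tendsto_mult_left LIMSEQ_power_zero) simp
      then have "\<forall>\<^sub>F k in sequentially. sqrt (real CARD('n) * (4 * 6) * (1/4)^k) < \<epsilon>"
        using e by (intro order_tendstoD(2)) auto
      then obtain k where "sqrt (real CARD('n) * (4 * 6) * (1/4)^k) < \<epsilon>" by (auto simp: eventually_sequentially)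
      then have "Hs_norm a b s (\<lambda>x. u x - v k x) < \<epsilon>" using norm_k[of k] by (simp add: power_divide)
      then show ?thesis using v by blast
    qed
    then show ?thesis unfolding Hs_def using amb by blast
  qed
  have nz: "\<not> (AE x in lebesgue_on HS. u x = 0)"
  proof
    assume "AE x in lebesgue_on HS. u x = 0"
    then have "AE x in lebesgue_on HS. \<bar>u x\<bar> powr p = 0" by eventually_elim simp
    then have "(\<integral>x. \<bar>u x\<bar> powr p \<partial>lebesgue_on HS) = 0" by (rule integral_eq_zero_AE)
    with massu show False by simp
  qed
  have "sobolev_quotient a b s (\<lambda>i. weak_partial HS i u) u = S"
    unfolding sobolev_quotient_def Let_def p_def[symmetric] massu en_u(2) d_eq by simp
  then show ?thesis using Hsu nz by blast
qed

end

theorem theorem1p6: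
  fixes a b :: "'n::finite" and s :: real
  assumes "a \<noteq> b" and "s > 0"
  shows "sobolev_const a b s > 0 \<and>
    (\<exists>u\<in>Hs a b s. \<not> (AE x in lebesgue_on (half_space a). u x = 0) \<and>
       sobolev_quotient a b s (\<lambda>i. weak_partial (half_space a) i u) u = sobolev_const a b s)"
proof -
  interpret degenerate_energy a b s by unfold_locales (fact assms)+
  show ?thesis using S_pos minimiser_exists unfolding S_def by blast
qed

end
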